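(* Consider the kinematics $\dot R=R\omega^\times$, $\dot p=v$, $\dot v=g+Ra$ (with $R\in SO(3)$, $p,v\in\mathbb R^3$ and constant gravity vector $g\in\mathbb R^3$) with landmark measurements $y_i=R^\top(p_i-p)$, $i=1,\dots,N$, together with the hybrid observer (not using $g$) with state $(\hat R,\eta,\hat p,\hat v,\hat g)\in SO(3)\times(\mathbb R^3)^4$ which flows, when $\tau\in[0,T_M]$, as $$\dot{\hat R}=\hat R(\omega+\hat R^\top\eta)^\times,\quad\dot\eta=0_{3\times1},\quad\dot{\hat p}=\eta^\times(\hat p-p_c)+\hat v,\quad\dot{\hat v}=\eta^\times\hat v+\hat g+\hat Ra,\quad\dot{\hat g}=\eta^\times\hat g,$$ and jumps, when $\tau=0$, as $$\hat R^+=\hat R,\quad\eta^+=k_R\sigma_R,\quad\hat p^+=\hat p+\hat RK_p\hat R^\top y,\quad\hat v^+=\hat v+\hat RK_v\hat R^\top y,\quad\hat g^+=\hat g+\hat RK_g\hat R^\top y,$$ where $k_R>0$, $\sigma_R=\tfrac12\sum_{i=1}^Nk_i(p_i-p_c)^\times(p_i-\hat p-\hat Ry_i)$, $y=\sum_{i=1}^Nk_i(p_i-\hat p-\hat Ry_i)$, and the timer obeys $\dot\tau=-1$ for $\tau\in[0,T_M]$, $\tau^+\in[T_m,T_M]$ for $\tau=0$, $\tau(0)\in[0,T_M]$. The gain $K=[K_p^\top,K_v^\top,K_g^\top]^\top\in\mathbb R^{9\times3}$ is $K=PC^\top(CPC^\top+Q_t)^{-1}$, where $P\in\mathbb R^{9\times9}$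 is the solution of the continuous-discrete Riccati equation $$\dot P=A_tP+PA_t^\top+V_t\ \ (\tau\in[0,T_M]),\qquad P^+=P-PC^\top(CPC^\top+Q_t)^{-1}CP\ \ (\tau\in\{0\}),$$ with $P(0)$ positive definite and $$A_t=\begin{bmatrix}-\omega^\times&I_3&0_{3\times3}\\0_{3\times3}&-\omega^\times&I_3\\0_{3\times3}&0_{3\times3}&-\omega^\times\end{bmatrix},\qquad C=[I_3\ \ 0_{3\times3}\ \ 0_{3\times3}].$$ Suppose that $0<T_m\le T_M<\infty$ and that at least three of the $N\ge3$ landmarks $p_1,\dots,p_N\in\mathbb R^3$ are non-collinear. Assume that $\omega(t)$ and $V_t$ are continuous and bounded, $Q_t$ is bounded, and $V_t,Q_t$ are uniformly positive definite. Then, for any $0<\epsilon<1$, there exist constants $\eta^*,k_R^*>0$ such that, for any $0<k_R<k_R^*$, the closed set $$\bar{\mathcal A}=\{(\tilde R,\eta,\mathsf x,\tau)\in SO(3)\times\mathbb R^3\times\mathbb R^9\times[0,T_M]:\ \tilde R=I_3,\ \|\eta\|=0,\ \|\mathsf x\|=0\}$$ is exponentially stable for the closed-loop estimation-error system with state $x_2=(\tilde R,\eta,\mathsf x,\tau)$, for all initial conditions with $|\tilde R(0)|_I\le\epsilon\sqrt{\varsigma_M}$, $\|\eta(0)\|\le\eta^*$ and $\mathsf x(0)\in\mathbb R^9$; that is, there exist $\kappa,\lambda>0$ such that every maximal solution $x_2$ of the error system from such an initial condition is complete and satisfies $|x_2(t,j)|_{\bar{\mathcal A}}\le\kappa e^{-\lambda(t+j)}|x_2(0,0)|_{\bar{\mathcal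 A}}$ for all $(t,j)\in\operatorname{dom}x_2$.
   Context: Notation. For $x\in\mathbb R^3$, $x^\times$ is the skew-symmetric $3\times3$ matrix with $x^\times y=x\times y$ for all $y$. For $B=[b_{ij}]\in\mathbb R^{3\times3}$, $\psi(B)=\tfrac12[b_{32}-b_{23},\,b_{13}-b_{31},\,b_{21}-b_{12}]^\top$. For $R\in SO(3)$, $|R|_I\in[0,1]$ is defined by $|R|_I^2=\tfrac14\operatorname{tr}(I_3-R)$. The signals $\omega,a$ (angular velocity and apparent acceleration in the body frame) are continuously measured. Positive definite matrices are symmetric; $V_t\in\mathbb R^{9\times9}$ and $Q_t\in\mathbb R^{3\times3}$ are matrix-valued functions of time $t\ge0$, and uniformly positive definite means bounded below by $cI$ for some constant $c>0$ independent of $t$. $P$ flows and jumps at the same hybrid times as the other variables; in $K$ and in the jump rule of $P$, the value of $P$ just before the jump is used. Landmarks. $p_1,\dots,p_N\in\mathbb R^3$ are fixed points; $k_1,\dots,k_N>0$ are scalars with $\sum_{i=1}^Nk_i=1$; $p_c=\sum_{i=1}^Nk_ip_i$; $M=\sum_{i=1}^Nk_i(p_i-p_c)(p_i-p_c)^\top$; $\bar M=\tfrac12(\operatorname{tr}(M)I_3-M)$ (positive definite); $\varsigma_M=\lambda_{\min}(\bar M)/\lambda_{\max}(\bar M)$. Timer. $\tau$ models measurement instants $t_j$ with $0\le t_1\le T_M$ and $T_m\le t_{j+1}-t_j\le T_M$. Errors. $\tilde R=R\hat R^\top$, $\tilde p=p-\tilde R\hat p-(I_3-\tilde R)p_c$,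 $\tilde v=v-\tilde R\hat v$, $\tilde g=g-\tilde R\hat g$, $\mathsf x=[\tilde p^\top R,\tilde v^\top R,\tilde g^\top R]^\top\in\mathbb R^9$. The variables $R,p,v$ do not change at jumps. The closed-loop estimation-error system is the hybrid system $$\begin{cases}\dot{\tilde R}=\tilde R(-\eta)^\times,\quad \dot\eta=0_{3\times1},\quad \dot{\mathsf x}=A_t\mathsf x,\quad \dot\tau=-1, & \tau\in[0,T_M],\\ \tilde R^+=\tilde R,\quad \eta^+=k_R\,\psi(M\tilde R),\quad \mathsf x^+=(I_9-KC)\mathsf x,\quad \tau^+\in[T_m,T_M], & \tau\in\{0\}.\end{cases}$$ Hybrid systems. A hybrid time domain is a set $E\subset\mathbb R_{\ge0}\times\mathbb N$ which is a union of intervals $[t_j,t_{j+1}]\times\{j\}$ with $0=t_0\le t_1\le\cdots$ (finitely or infinitely many, the last one, if any, possibly of the form $[t_j,T)\times\{j\}$ with $T$ finite or $+\infty$). A solution is a function $x$ on a hybrid time domain $\operatorname{dom}x$, locally absolutely continuous in $t$ for each fixed $j$, satisfying the differential equation for almost all $t$ while staying in the flow set (here $\tau\in[0,T_M]$), and with $x^+=x(t,j+1)$ obtained from $x=x(t,j)$ in the jump set (here $\tau=0$) by the jump rule. It is maximal if it cannot be extended, and complete if its domain is unbounded. $x(0)$ denotes the value at $(t,j)=(0,0)$. Distance: $|x_2|_{\bar{\mathcal A}}=\big(|\tilde R|_I^2+\|\eta\|^2+\|\mathsf x\|^2\big)^{1/2}$. *)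

theory Defs
  imports "HOL-Analysis.Analysis"
begin

section \<open>Hybrid systems\<close>

text \<open>
  Absolute continuity of a function on \<open>[a, b]\<close>: the finite families of non-overlapping compact
  subintervals are the library's divisions of subsets of \<open>[a, b]\<close>.
\<close>

definition absolutely_continuous_on :: "real \<Rightarrow> real \<Rightarrow> (real \<Rightarrow> 'a::real_normed_vector) \<Rightarrow> bool" where
  "absolutely_continuous_on a b f \<longleftrightarrow>
     (\<forall>e>0. \<exists>d>0. \<forall>D. D division_of \<Union>D \<and> \<Union>D \<subseteq> {a..b} \<and> (\<Sum>I\<in>D. Sup I - Inf I) < d
        \<longrightarrow> (\<Sum>I\<in>D. norm (f (Sup I) - f (Inf I))) < e)"

definition locally_absolutely_continuous_on :: "real set \<Rightarrow> (real \<Rightarrow> 'a::real_normed_vector) \<Rightarrow> bool" where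
  "locally_absolutely_continuous_on S f \<longleftrightarrow>
     (\<forall>a b. a \<le> b \<and> {a..b} \<subseteq> S \<longrightarrow> absolutely_continuous_on a b f)"

definition hybrid_time_domain :: "(real \<times> nat) set \<Rightarrow> bool" where
  "hybrid_time_domain E \<longleftrightarrow>
     (\<exists>s::nat \<Rightarrow> real. s 0 = 0 \<and> incseq s \<and>
        (E = (\<Union>j. {s j..s (Suc j)} \<times> {j}) \<or>
         (\<exists>J L. (L = {s J..s (Suc J)} \<or> (\<exists>T>s J. L = {s J..<T}) \<or> L = {s J..}) \<and>
                E = (\<Union>j<J. {s j..s (Suc j)} \<times> {j}) \<union> L \<times> {J})))"

text \<open>
  The flow map and the (set-valued) jump map may depend on the ordinary time \<open>t\<close>, through the
  exogenous signals.
\<close>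

record 'a hybrid_system =
  flow_set :: "'a set"
  flow_map :: "real \<Rightarrow> 'a \<Rightarrow> 'a"
  jump_set :: "'a set"
  jump_map :: "real \<Rightarrow> 'a \<Rightarrow> 'a set"

text \<open>
  Since a solution has to be in the flow set only in the interior of each interval of flow, an
  instantaneous jump at the start, or several jumps at the same time, are possible.
\<close>

definition hybrid_solution ::
    "'a::real_normed_vector hybrid_system \<Rightarrow> (real \<times> nat) set \<Rightarrow> (real \<Rightarrow> nat \<Rightarrow> 'a) \<Rightarrow> bool" where
  "hybrid_solution H E z \<longleftrightarrow>
     hybrid_time_domain E \<and>
     z 0 0 \<in> flow_set H \<union> jump_set H \<and>
     (\<forall>j. let I = {t. (t, j) \<in> E} in
        locally_absolutely_continuous_on I (\<lambda>t. z t j) \<and>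
        (\<forall>t\<in>interior I. z t j \<in> flow_set H) \<and>
        (\<exists>Z. negligible Z \<and>
           (\<forall>t\<in>I - Z. ((\<lambda>t. z t j) has_vector_derivative flow_map H t (z t j)) (at t within I)))) \<and>
     (\<forall>t j. (t, j) \<in> E \<and> (t, Suc j) \<in> E \<longrightarrow>
        z t j \<in> jump_set H \<and> z t (Suc j) \<in> jump_map H t (z t j))"

definition maximal_hybrid_solution ::
    "'a::real_normed_vector hybrid_system \<Rightarrow> (real \<times> nat) set \<Rightarrow> (real \<Rightarrow> nat \<Rightarrow> 'a) \<Rightarrow> bool" where
  "maximal_hybrid_solution H E z \<longleftrightarrow>
     hybrid_solution H E z \<and>
     \<not> (\<exists>E' z'. hybrid_solution H E' z' \<and> E \<subset> E' \<and> (\<forall>(t, j)\<in>E. z' t j = z t j))"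

definition complete_domain :: "(real \<times> nat) set \<Rightarrow> bool" where
  "complete_domain E \<longleftrightarrow> \<not> bounded ((\<lambda>(t, j). (t, real j)) ` E)"

section \<open>Matrices\<close>

definition skew :: "real^3 \<Rightarrow> real^3^3" where
  "skew x = matrix (cross3 x)"

definition psi :: "real^3^3 \<Rightarrow> real^3" where
  "psi B = (1/2) *\<^sub>R vector [B$3$2 - B$2$3, B$1$3 - B$3$1, B$2$1 - B$1$2]"

definition rot_dist :: "real^3^3 \<Rightarrow> real" where
  "rot_dist R = sqrt (trace (mat 1 - R) / 4)"

definition positive_definite :: "real^'n^'n \<Rightarrow> bool" where
  "positive_definite A \<longleftrightarrow> transpose A = A \<and> (\<forall>x. x \<noteq> 0 \<longrightarrow> 0 < x \<bullet> (A *v x))"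

definition uniformly_positive_definite :: "(real \<Rightarrow> real^'n^'n) \<Rightarrow> bool" where
  "uniformly_positive_definite A \<longleftrightarrow>
     (\<forall>t\<ge>0. transpose (A t) = A t) \<and> (\<exists>c>0. \<forall>t\<ge>0. \<forall>x. c * (x \<bullet> x) \<le> x \<bullet> (A t *v x))"

definition eigenvalues :: "real^'n^'n \<Rightarrow> real set" where
  "eigenvalues A = {l. \<exists>x. x \<noteq> 0 \<and> A *v x = l *\<^sub>R x}"

definition lambda_min :: "real^'n^'n \<Rightarrow> real" where
  "lambda_min A = Min (eigenvalues A)"

definition lambda_max :: "real^'n^'n \<Rightarrow> real" where
  "lambda_max A = Max (eigenvalues A)"

lemma skew_mult_vec: "skew x *v y = cross3 x y"
proof -
  have "linear (cross3 x)"
    by (rule linearI) (simp_all add: cross_add_right cross_mult_right)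
  then show ?thesis
    by (simp add: skew_def matrix_works)
qed

lemma rotation_matrix_trace_3:
  fixes R :: "real^3^3"
  assumes "rotation_matrix R"
  shows rotation_matrix_trace_le: "trace R \<le> 3"
    and rotation_matrix_trace_eq: "trace R = 3 \<longleftrightarrow> R = mat 1"
proof -
  have rows: "(\<Sum>j\<in>UNIV. (R $ i $ j)\<^sup>2) = 1" for i
  proof -
    have "R ** transpose R = mat 1"
      using assms by (simp add: rotation_matrix_def orthogonal_matrix_def)
    then have "(R ** transpose R) $ i $ i = 1"
      by (simp add: mat_def)
    then show ?thesis
      by (simp add: matrix_matrix_mult_def transpose_def power2_eq_square)
  qed
  have "(R $ i $ i)\<^sup>2 \<le> 1" for i
    using rows[of i] member_le_sum[of i UNIV "\<lambda>j. (R $ i $ j)\<^sup>2"] by simp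
  then have diag: "R $ i $ i \<le> 1" for i
    by (metis abs_le_D1 abs_square_le_1)
  then show "trace R \<le> 3"
    using sum_mono[of UNIV "\<lambda>i. R $ i $ i" "\<lambda>_. 1"] by (simp add: trace_def)
  show "trace R = 3 \<longleftrightarrow> R = mat 1"
  proof
    assume "trace R = 3"
    then have one: "R $ i $ i = 1" for i
      using diag[of 1] diag[of 2] diag[of 3] exhaust_3[of i] by (auto simp: trace_def sum_3)
    have "R $ i $ j = 0" if "i \<noteq> j" for i j
    proof -
      have "(\<Sum>j\<in>UNIV - {i}. (R $ i $ j)\<^sup>2) = 0"
        using rows[of i] one[of i] by (simp add: sum_diff1)
      then show ?thesis
        using that by (subst (asm) sum_nonneg_eq_0_iff) auto
    qed
    with one show "R = mat 1"
      by (auto simp: vec_eq_iff mat_def)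
  qed (simp add: trace_I)
qed

text \<open>
  The nine coordinates of the state of the Riccati observer are indexed by pairs: the index
  \<open>(b, i)\<close> is coordinate \<open>i\<close> of block \<open>b\<close>. A block matrix or block vector is written as a
  vector of its \<open>3 \<times> 3\<close> (respectively \<open>3 \<times> 1\<close>) blocks.
\<close>

type_synonym vec9 = "real^(3 \<times> 3)"
type_synonym mat9 = "real^(3 \<times> 3)^(3 \<times> 3)"

definition stack :: "real^3^3 \<Rightarrow> vec9" where
  "stack b = (\<chi> r. b $ fst r $ snd r)"

definition block_matrix :: "real^3^3^3^3 \<Rightarrow> mat9" where
  "block_matrix B = (\<chi> r c. B $ fst r $ fst c $ snd r $ snd c)"

definition block_row :: "real^3^3^3 \<Rightarrow> real^(3 \<times> 3)^3" where
  "block_row B = (\<chi> i c. B $ fst c $ i $ snd c)"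

text \<open>Block \<open>b\<close> of a \<open>9 \<times> 3\<close> matrix.\<close>

definition row_block :: "3 \<Rightarrow> real^3^(3 \<times> 3) \<Rightarrow> real^3^3" where
  "row_block b K = (\<chi> i j. K $ (b, i) $ j)"

definition A_mat :: "real^3 \<Rightarrow> mat9" where
  "A_mat w = block_matrix (vector
     [vector [- skew w, mat 1,    0],
      vector [0,        - skew w, mat 1],
      vector [0,        0,        - skew w]])"

definition C_mat :: "real^(3 \<times> 3)^3" where
  "C_mat = block_row (vector [mat 1, 0, 0])"

definition gain :: "mat9 \<Rightarrow> real^3^3 \<Rightarrow> real^3^(3 \<times> 3)" where
  "gain P Q = P ** transpose C_mat ** matrix_inv (C_mat ** P ** transpose C_mat + Q)"

definition riccati_flow :: "real^3 \<Rightarrow> mat9 \<Rightarrow> mat9 \<Rightarrow> mat9" where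
  "riccati_flow w V P = A_mat w ** P + P ** transpose (A_mat w) + V"

definition riccati_jump :: "real^3^3 \<Rightarrow> mat9 \<Rightarrow> mat9" where
  "riccati_jump Q P =
     P - P ** transpose C_mat ** matrix_inv (C_mat ** P ** transpose C_mat + Q) ** C_mat ** P"

section \<open>Landmarks\<close>

definition centroid :: "nat \<Rightarrow> (nat \<Rightarrow> real^3) \<Rightarrow> (nat \<Rightarrow> real) \<Rightarrow> real^3" where
  "centroid N lm k = (\<Sum>i=1..N. k i *\<^sub>R lm i)"

definition M_mat :: "nat \<Rightarrow> (nat \<Rightarrow> real^3) \<Rightarrow> (nat \<Rightarrow> real) \<Rightarrow> real^3^3" where
  "M_mat N lm k =
     (\<Sum>i=1..N. k i *\<^sub>R (let q = lm i - centroid N lm k in \<chi> r c. q$r * q$c))"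

definition Mbar :: "nat \<Rightarrow> (nat \<Rightarrow> real^3) \<Rightarrow> (nat \<Rightarrow> real) \<Rightarrow> real^3^3" where
  "Mbar N lm k = (1/2) *\<^sub>R (trace (M_mat N lm k) *\<^sub>R mat 1 - M_mat N lm k)"

definition varsigma_M :: "nat \<Rightarrow> (nat \<Rightarrow> real^3) \<Rightarrow> (nat \<Rightarrow> real) \<Rightarrow> real" where
  "varsigma_M N lm k = lambda_min (Mbar N lm k) / lambda_max (Mbar N lm k)"

section \<open>The kinematics with the hybrid observer\<close>

text \<open>State \<open>((R, p, v), (Rh, \<eta>, ph, vh, gh), \<tau>, P)\<close>.\<close>

type_synonym observer_state =
  "((real^3^3) \<times> (real^3) \<times> (real^3)) \<times>
   ((real^3^3) \<times> (real^3) \<times> (real^3) \<times> (real^3) \<times> (real^3)) \<times> real \<times> mat9"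

definition landmark_measurement :: "(nat \<Rightarrow> real^3) \<Rightarrow> real^3^3 \<Rightarrow> real^3 \<Rightarrow> nat \<Rightarrow> real^3" where
  "landmark_measurement lm R p i = transpose R *v (lm i - p)"

definition sigma_R ::
    "nat \<Rightarrow> (nat \<Rightarrow> real^3) \<Rightarrow> (nat \<Rightarrow> real) \<Rightarrow> (nat \<Rightarrow> real^3) \<Rightarrow> real^3^3 \<Rightarrow> real^3 \<Rightarrow> real^3" where
  "sigma_R N lm k y Rh ph =
     (1/2) *\<^sub>R (\<Sum>i=1..N. k i *\<^sub>R (skew (lm i - centroid N lm k) *v (lm i - ph - Rh *v y i)))"

definition innovation ::
    "nat \<Rightarrow> (nat \<Rightarrow> real^3) \<Rightarrow> (nat \<Rightarrow> real) \<Rightarrow> (nat \<Rightarrow> real^3) \<Rightarrow> real^3^3 \<Rightarrow> real^3 \<Rightarrow> real^3" where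
  "innovation N lm k y Rh ph = (\<Sum>i=1..N. k i *\<^sub>R (lm i - ph - Rh *v y i))"

fun observer_flow ::
    "real^3 \<Rightarrow> (real \<Rightarrow> real^3) \<Rightarrow> (real \<Rightarrow> real^3) \<Rightarrow> (real \<Rightarrow> mat9) \<Rightarrow> real^3 \<Rightarrow>
     real \<Rightarrow> observer_state \<Rightarrow> observer_state" where
  "observer_flow pc \<omega> a V g t ((R, p, v), (Rh, \<eta>, ph, vh, gh), \<tau>, P) =
     ((R ** skew (\<omega> t), v, g + R *v a t),
      (Rh ** skew (\<omega> t + transpose Rh *v \<eta>),
       0,
       skew \<eta> *v (ph - pc) + vh,
       skew \<eta> *v vh + gh + Rh *v a t,
       skew \<eta> *v gh),
      -1,
      riccati_flow (\<omega> t) (V t) P)"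

fun observer_jump ::
    "nat \<Rightarrow> (nat \<Rightarrow> real^3) \<Rightarrow> (nat \<Rightarrow> real) \<Rightarrow> real \<Rightarrow> (real \<Rightarrow> real^3^3) \<Rightarrow> real \<Rightarrow> real \<Rightarrow>
     real \<Rightarrow> observer_state \<Rightarrow> observer_state set" where
  "observer_jump N lm k kR Q Tm TM t ((R, p, v), (Rh, \<eta>, ph, vh, gh), \<tau>, P) =
     (let ym = landmark_measurement lm R p;
          y = innovation N lm k ym Rh ph;
          K = gain P (Q t)
      in {((R, p, v),
           (Rh,
            kR *\<^sub>R sigma_R N lm k ym Rh ph,
            ph + Rh *v (row_block 1 K *v (transpose Rh *v y)),
            vh + Rh *v (row_block 2 K *v (transpose Rh *v y)),
            gh + Rh *v (row_block 3 K *v (transpose Rh *v y))),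
           \<tau>',
           riccati_jump (Q t) P) | \<tau>'. \<tau>' \<in> {Tm..TM}})"

definition observer_system ::
    "nat \<Rightarrow> (nat \<Rightarrow> real^3) \<Rightarrow> (nat \<Rightarrow> real) \<Rightarrow> real \<Rightarrow> real \<Rightarrow> real \<Rightarrow> (real \<Rightarrow> real^3) \<Rightarrow>
     (real \<Rightarrow> real^3) \<Rightarrow> real^3 \<Rightarrow> (real \<Rightarrow> mat9) \<Rightarrow> (real \<Rightarrow> real^3^3) \<Rightarrow> observer_state hybrid_system" where
  "observer_system N lm k kR Tm TM \<omega> a g V Q =
     \<lparr>flow_set = {((R, p, v), (Rh, \<eta>, ph, vh, gh), \<tau>, P).
                    rotation_matrix R \<and> rotation_matrix Rh \<and> \<tau> \<in> {0..TM}},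
      flow_map = observer_flow (centroid N lm k) \<omega> a V g,
      jump_set = {((R, p, v), (Rh, \<eta>, ph, vh, gh), \<tau>, P).
                    rotation_matrix R \<and> rotation_matrix Rh \<and> \<tau> = 0},
      jump_map = observer_jump N lm k kR Q Tm TM\<rparr>"

section \<open>The estimation-error system\<close>

text \<open>State \<open>(Rt, \<eta>, x, \<tau>)\<close>, with \<open>Rt\<close> the attitude error.\<close>

type_synonym error_state = "(real^3^3) \<times> (real^3) \<times> vec9 \<times> real"

fun estimation_error :: "real^3 \<Rightarrow> real^3 \<Rightarrow> observer_state \<Rightarrow> error_state \<times> mat9" where
  "estimation_error pc g ((R, p, v), (Rh, \<eta>, ph, vh, gh), \<tau>, P) =
     (let Rt = R ** transpose Rh;
          pt = p - Rt *v ph - (mat 1 - Rt) *v pc;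
          vt = v - Rt *v vh;
          gt = g - Rt *v gh
      in ((Rt, \<eta>, stack (vector [transpose R *v pt, transpose R *v vt, transpose R *v gt]), \<tau>), P))"

fun error_flow ::
    "(real \<Rightarrow> real^3) \<Rightarrow> (real \<Rightarrow> mat9) \<Rightarrow> real \<Rightarrow> error_state \<times> mat9 \<Rightarrow> error_state \<times> mat9" where
  "error_flow \<omega> V t ((Rt, \<eta>, x, \<tau>), P) =
     ((Rt ** skew (- \<eta>), 0, A_mat (\<omega> t) *v x, -1), riccati_flow (\<omega> t) (V t) P)"

fun error_jump ::
    "real^3^3 \<Rightarrow> real \<Rightarrow> (real \<Rightarrow> real^3^3) \<Rightarrow> real \<Rightarrow> real \<Rightarrow>
     real \<Rightarrow> error_state \<times> mat9 \<Rightarrow> (error_state \<times> mat9) set" where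
  "error_jump M kR Q Tm TM t ((Rt, \<eta>, x, \<tau>), P) =
     {((Rt, kR *\<^sub>R psi (M ** Rt), (mat 1 - gain P (Q t) ** C_mat) *v x, \<tau>'), riccati_jump (Q t) P)
      | \<tau>'. \<tau>' \<in> {Tm..TM}}"

text \<open>
  The gain is determined by the solution \<open>P\<close> of the Riccati equation, which flows and jumps
  together with the error state; hence the two evolve jointly.
\<close>

definition error_system ::
    "nat \<Rightarrow> (nat \<Rightarrow> real^3) \<Rightarrow> (nat \<Rightarrow> real) \<Rightarrow> real \<Rightarrow> real \<Rightarrow> real \<Rightarrow> (real \<Rightarrow> real^3) \<Rightarrow>
     (real \<Rightarrow> mat9) \<Rightarrow> (real \<Rightarrow> real^3^3) \<Rightarrow> (error_state \<times> mat9) hybrid_system" where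
  "error_system N lm k kR Tm TM \<omega> V Q =
     \<lparr>flow_set = {((Rt, \<eta>, x, \<tau>), P). rotation_matrix Rt \<and> \<tau> \<in> {0..TM}},
      flow_map = error_flow \<omega> V,
      jump_set = {((Rt, \<eta>, x, \<tau>), P). rotation_matrix Rt \<and> \<tau> = 0},
      jump_map = error_jump (M_mat N lm k) kR Q Tm TM\<rparr>"

definition Abar :: "real \<Rightarrow> error_state set" where
  "Abar TM = {(Rt, \<eta>, x, \<tau>). rotation_matrix Rt \<and> \<tau> \<in> {0..TM} \<and>
                             Rt = mat 1 \<and> norm \<eta> = 0 \<and> norm x = 0}"

fun Abar_dist :: "error_state \<Rightarrow> real" where
  "Abar_dist (Rt, \<eta>, x, \<tau>) = sqrt ((rot_dist Rt)\<^sup>2 + (norm \<eta>)\<^sup>2 + (norm x)\<^sup>2)"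

lemma Abar_dist_eq_0_iff:
  assumes "rotation_matrix Rt" "\<tau> \<in> {0..TM}"
  shows "Abar_dist (Rt, \<eta>, x, \<tau>) = 0 \<longleftrightarrow> (Rt, \<eta>, x, \<tau>) \<in> Abar TM"
  using assms rotation_matrix_trace_3[OF assms(1)]
  by (auto simp: Abar_def rot_dist_def add_nonneg_eq_0_iff trace_sub trace_I)

end

theory Submission
  imports Defs
begin

text \<open>
  The flow map is continuous along a solution, so that the fundamental theorem of calculus for
  absolutely continuous functions makes every solution classical on each interval of flow.

  Translational errors. Along the adjoint equation \<open>y' = - A\<^sup>T y\<close>, run backwards through the jumps
  by \<open>y \<mapsto> (I - K C)\<^sup>T y\<close>, the pairing \<open>y \<bullet> x\<close> is constant, while \<open>y \<bullet> P y\<close> grows in forward time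
  at least like \<open>y \<bullet> V y\<close>. Replacing \<open>K\<^sup>T y\<close> at the jumps by another correction \<open>u\<close> can only increase
  the cost, and since the adjoint equation is a triple integrator in a rotating frame, corrections at
  three consecutive jumps steer it to zero; this bounds \<open>P\<close> from above uniformly in time. Then
  \<open>y \<bullet> P y\<close> grows exponentially, and \<open>x\<close> decays exponentially.

  Attitude error. The potential \<open>tr (M (I - R))\<close> has derivative \<open>- 2 \<psi>(M R) \<bullet> \<eta>\<close> and is comparable to
  the squared distance of \<open>R\<close> to \<open>I\<close> as long as \<open>R\<close> stays away from the rotations by a straight angle.
  For a small gain, the value of \<open>\<psi>(M R)\<close> sampled at the last jump is still a descent direction, so
  that the potential contracts by a fixed factor from jump to jump and the region is never left.
\<close>

section \<open>Absolutely continuous functions\<close>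

text \<open>The function x . P^{-1} x would call for the invertibility of \<open>P\<close>, the
  derivative of its inverse and bounds on \<open>P\<close> from both sides. The dual argument works
  with an upper bound: strict positivity of \<open>P\<close> enters only at time zero, where the
  pairing y . x is estimated by Cauchy-Schwarz. The two errors do not interact. Deviations from the
  centroid have weighted sum zero, so the position error cancels from \<open>sigma_R\<close>, and in
  the body frame the translational errors do not see the attitude error. Two separate estimates
  remain, on different clocks: \<open>x\<close> decays in \<open>t\<close>, the attitude error in
  the number of jumps, and the timer makes the clocks comparable. Before the first jump
  \<open>\<eta>\<close> is arbitrary and the potential may grow, hence the limit
  \<open>\<eta>s\<close>. The restriction by sqrt (l / L), with \<open>l\<close> and
  \<open>L\<close> the extreme eigenvalues of \<open>Mbar\<close>, comes from the gap between the
  bounds 4 l d^2 and 4 L d^2 of the potential at distance d: starting within e1 sqrt (l / L) keeps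
  it below 4 l e1^2, and this level confines the attitude error to distance e1.\<close>

lemma absolutely_continuous_on_integral:
  fixes f :: "real \<Rightarrow> 'a::banach"
  assumes ac: "absolutely_continuous_on a b f" and "a \<le> b" and Z: "negligible Z"
    and der: "\<And>t. t \<in> {a..b} - Z \<Longrightarrow> (f has_vector_derivative g t) (at t within {a..b})"
  shows "(g has_integral f b - f a) {a..b}"
proof -
  \<comment> \<open>The values of \<open>g\<close> on \<open>Z\<close> are arbitrary, so the Riemann
    sums are formed with \<open>h\<close>, which vanishes there. The gauge integral ignores null
    sets, and no integrability of \<open>g\<close> has to be known beforehand.\<close>
  define h where "h t = (if t \<in> Z then 0 else g t)" for t
  have "(h has_integral f b - f a) (cbox a b)"
    unfolding has_integral
  proof safe
    fix e0 :: real
    assume "e0 > 0"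
    define e where "e = e0 / (2 * (b - a + 1))"
    have "e > 0" using \<open>e0 > 0\<close> \<open>a \<le> b\<close> by (simp add: e_def)
    have e_le: "e * (b - a) \<le> e0 / 2"
      using \<open>e0 > 0\<close> \<open>a \<le> b\<close> by (simp add: e_def field_simps)
    have "\<forall>x. \<exists>d>0. x \<in> {a..b} - Z \<longrightarrow>
         (\<forall>y\<in>{a..b}. norm (y-x) < d \<longrightarrow> norm (f y - f x - (y-x) *\<^sub>R g x) \<le> e * norm (y-x))"
      using der[unfolded has_vector_derivative_def has_derivative_within_alt] \<open>e > 0\<close> by blast
    from choice[OF this] obtain d where d: "\<And>x. 0 < d x"
        "\<And>x y. \<lbrakk>x \<in> {a..b} - Z; y \<in> {a..b}; norm (y-x) < d x\<rbrakk>
             \<Longrightarrow> norm (f y - f x - (y-x) *\<^sub>R g x) \<le> e * norm (y-x)"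
      by blast
    obtain r where "r > 0" and r: "\<And>D. D division_of \<Union>D \<Longrightarrow> \<Union>D \<subseteq> {a..b} \<Longrightarrow>
        (\<Sum>I\<in>D. Sup I - Inf I) < r \<Longrightarrow> (\<Sum>I\<in>D. norm (f (Sup I) - f (Inf I))) < e0 / 2"
      using ac[unfolded absolutely_continuous_on_def, rule_format, OF half_gt_zero[OF \<open>e0 > 0\<close>]] by blast
    \<comment> \<open>The indicator of a null set has gauge integral 0. Hence some gauge
      \<open>c\<close> forces the intervals tagged in \<open>Z\<close> to have total length less
      than \<open>r\<close>, the modulus of absolute continuity of \<open>f\<close> for
      \<open>e0 / 2\<close>.\<close>
    have iZ: "((indicator Z :: real \<Rightarrow> real) has_integral 0) (cbox a b)"
      using Z by (simp add: negligible_def)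
    have "\<exists>c. gauge c \<and> (\<forall>p. p tagged_division_of cbox a b \<and> c fine p \<longrightarrow>
        norm ((\<Sum>(x,K)\<in>p. measure lborel K *\<^sub>R (indicator Z x :: real)) - 0) < r)"
      using iZ[unfolded has_integral, rule_format, OF \<open>r > 0\<close>] .
    then obtain c where c: "gauge c" and cZ: "\<And>p. p tagged_division_of cbox a b \<Longrightarrow> c fine p \<Longrightarrow>
        norm ((\<Sum>(x,K)\<in>p. measure lborel K *\<^sub>R (indicator Z x :: real)) - 0) < r"
      by (elim exE conjE) simp
    show "\<exists>\<gamma>. gauge \<gamma> \<and> (\<forall>p. p tagged_division_of cbox a b \<and> \<gamma> fine p \<longrightarrow>
        norm ((\<Sum>(x,K)\<in>p. measure lborel K *\<^sub>R h x) - (f b - f a)) < e0)"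
    proof (intro exI conjI allI impI; (elim conjE)?)
      show "gauge (\<lambda>x. ball x (d x) \<inter> c x)"
        using d(1) gauge_ball_dependent c by (intro gauge_Int) auto
    next
      fix p
      assume p: "p tagged_division_of cbox a b" and fine: "(\<lambda>x. ball x (d x) \<inter> c x) fine p"
      have cfine: "c fine p" and dfine: "(\<lambda>x. ball x (d x)) fine p"
        using fine by (auto simp: fine_Int)
      have fin: "finite p" using p by blast
      define q where "q = {xk \<in> p. fst xk \<in> Z}"
      have q: "q \<subseteq> p" "finite q" using fin by (auto simp: q_def)
      have cK: "measure lborel K = Sup K - Inf K" and le: "Inf K \<le> Sup K"
          and mem: "Inf K \<in> K" "Sup K \<in> K" and sub: "K \<subseteq> {a..b}"
          and bnd: "Inf K \<le> x \<and> x \<le> Sup K" if xK: "(x,K) \<in> p" for x K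
      proof -
        obtain u v where K: "K = cbox u v" and "x \<in> K"
          using p xK by (metis tagged_division_ofD(2) tagged_division_ofD(4))
        then have "u \<le> v" by auto
        then show "measure lborel K = Sup K - Inf K" "Inf K \<le> Sup K" "Inf K \<in> K" "Sup K \<in> K"
            "Inf K \<le> x \<and> x \<le> Sup K"
          using K \<open>x \<in> K\<close> by (auto simp: interval_bounds_real)
        show "K \<subseteq> {a..b}" using p xK by (auto dest: tagged_division_ofD(3))
      qed
      have fba: "f b - f a = (\<Sum>(x,K)\<in>p. f(Sup K) - f(Inf K))" 
        and ba: "b - a = (\<Sum>(x,K)\<in>p. Sup K - Inf K)"
        using additive_tagged_division_1[where f=f] additive_tagged_division_1[where f="\<lambda>x. x"]
          \<open>a \<le> b\<close> p by auto
      have 1: "norm (\<Sum>(x,K)\<in>p-q. measure lborel K *\<^sub>R h x - (f (Sup K) - f (Inf K))) \<le> e0 / 2"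
      proof -
        have "norm (\<Sum>(x,K)\<in>p-q. measure lborel K *\<^sub>R h x - (f (Sup K) - f (Inf K)))
            \<le> (\<Sum>(x,K)\<in>p-q. e * (Sup K - Inf K))"
        proof (rule sum_norm_le, safe)
          fix x K assume xK: "(x,K) \<in> p" "(x,K) \<notin> q"
          then have "x \<notin> Z" by (auto simp: q_def)
          have "x \<in> K" using p xK by (metis tagged_division_ofD(2))
          let ?u = "Inf K" and ?v = "Sup K"
          have xab: "x \<in> {a..b} - Z" using sub[OF xK(1)] \<open>x \<in> K\<close> \<open>x \<notin> Z\<close> by auto
          have "K \<subseteq> ball x (d x)" using dfine xK by (auto simp: fine_def)
          then have near: "norm (?u - x) < d x" "norm (?v - x) < d x"
            using mem[OF xK(1)] by (auto simp: dist_real_def abs_minus_commute)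
          have uxv: "?u \<le> x" "x \<le> ?v" using bnd[OF xK(1)] by auto
          \<comment> \<open>Straddle argument: the tag lies between the endpoints, so the errors of
            linear approximation at \<open>x\<close> on the two sides add up to at most
            \<open>e\<close> times the length of the interval.\<close>
          have "norm ((?v - ?u) *\<^sub>R g x - (f ?v - f ?u)) =
              norm ((f ?u - f x - (?u - x) *\<^sub>R g x) - (f ?v - f x - (?v - x) *\<^sub>R g x))"
            by (simp add: algebra_simps)
          also have "\<dots> \<le> e * norm (?u - x) + e * norm (?v - x)"
            using mem[OF xK(1)] sub[OF xK(1)]
            by (intro order_trans[OF norm_triangle_ineq4] add_mono d(2) xab near) auto
          also have "\<dots> = e * (?v - ?u)" using uxv by (simp add: algebra_simps)
          finally show "norm (measure lborel K *\<^sub>R h x - (f ?v - f ?u)) \<le> e * (?v - ?u)"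
            using \<open>x \<notin> Z\<close> by (simp add: cK[OF xK(1)] h_def)
        qed
        also have "\<dots> \<le> (\<Sum>(x,K)\<in>p. e * (Sup K - Inf K))"
          using fin \<open>e > 0\<close> le by (intro sum_mono2) auto
        also have "\<dots> = e * (b - a)"
          by (simp add: ba sum_distrib_left split_def)
        finally show ?thesis using e_le by simp
      qed
      have 2: "(\<Sum>(x,K)\<in>q. norm (f (Sup K) - f (Inf K))) < e0 / 2"
      proof -
        have qt: "q tagged_division_of \<Union>(snd ` q)"
          using p q(1) unfolding tagged_division_of_def
          by (intro tagged_partial_division_of_Union_self[unfolded tagged_division_of_def])
            (auto intro: tagged_partial_division_subset)
        \<comment> \<open>Absolute continuity speaks of sets of intervals, the Riemann sum of tagged
          pairs. Passing from one to the other asks that \<open>F\<close> vanishes on intervals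
          without interior.\<close>
        have s: "(\<Sum>(x,K)\<in>q. F K) = (\<Sum>K\<in>snd ` q. F K)" 
          if "\<And>u v::real. box u v = {} \<Longrightarrow> F (cbox u v) = 0" "F {} = 0" for F :: "real set \<Rightarrow> real"
          using sum.over_tagged_division_lemma[OF qt, of F] that by auto
        have dv: "snd ` q division_of \<Union>(snd ` q)"
          using division_of_tagged_division[OF qt] .
        have "(\<Sum>(x,K)\<in>q. measure lborel K) = (\<Sum>(x,K)\<in>p. measure lborel K *\<^sub>R (indicator Z x :: real))"
          using fin by (intro sum.mono_neutral_cong_left) (auto simp: q_def indicator_def)
        also have "\<dots> < r" using cZ[OF p cfine] by auto
        finally have "(\<Sum>(x,K)\<in>q. measure lborel K) < r" .
        then have "(\<Sum>K\<in>snd ` q. measure lborel K) < r"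
          using s[of "measure lborel"] by (simp add: content_eq_0_interior)
        then have "(\<Sum>K\<in>snd ` q. Sup K - Inf K) < r"
          using q(1) cK by (subst sum.cong[OF refl, of _ _ "measure lborel"]) auto
        then have "(\<Sum>K\<in>snd ` q. norm (f (Sup K) - f (Inf K))) < e0 / 2"
          using q(1) sub by (intro r[OF dv]) (force simp: UN_subset_iff, simp)
        moreover have "(\<Sum>(x,K)\<in>q. norm (f (Sup K) - f (Inf K))) \<le> (\<Sum>K\<in>snd ` q. norm (f (Sup K) - f (Inf K)))"
        proof -
          \<comment> \<open>The value at the empty interval is fixed to 0, since its
            \<open>Sup\<close> and \<open>Inf\<close> carry no meaning. No interval of
            \<open>q\<close> is empty, so the sums are unchanged.\<close>
          define F where "F K = (if K = {} then 0 else norm (f (Sup K) - f (Inf K)))" for K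
          have ne: "K \<noteq> {}" if "(x,K) \<in> q" for x K using that mem q(1) by blast
          have "(\<Sum>(x,K)\<in>q. F K) = (\<Sum>K\<in>snd ` q. F K)"
            by (rule s) (auto simp: F_def)
          moreover have "(\<Sum>(x,K)\<in>q. F K) = (\<Sum>(x,K)\<in>q. norm (f (Sup K) - f (Inf K)))"
            using ne by (intro sum.cong) (auto simp: F_def)
          moreover have "(\<Sum>K\<in>snd ` q. F K) = (\<Sum>K\<in>snd ` q. norm (f (Sup K) - f (Inf K)))"
            using ne by (intro sum.cong) (auto simp: F_def)
          ultimately show ?thesis by simp
        qed
        ultimately show ?thesis by simp
      qed
      have 3: "norm (\<Sum>(x,K)\<in>q. measure lborel K *\<^sub>R h x - (f (Sup K) - f (Inf K))) \<le> (\<Sum>(x,K)\<in>q. norm (f (Sup K) - f (Inf K)))"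
        by (rule sum_norm_le) (auto simp: q_def h_def norm_minus_commute)
      have "(\<Sum>(x,K)\<in>p. measure lborel K *\<^sub>R h x) - (f b - f a) =
          (\<Sum>(x,K)\<in>p. measure lborel K *\<^sub>R h x - (f (Sup K) - f (Inf K)))"
        by (simp add: fba sum_subtractf split_def)
      also have "\<dots> = (\<Sum>(x,K)\<in>p-q. measure lborel K *\<^sub>R h x - (f (Sup K) - f (Inf K))) +
          (\<Sum>(x,K)\<in>q. measure lborel K *\<^sub>R h x - (f (Sup K) - f (Inf K)))"
        by (rule sum.subset_diff[OF q(1) fin])
      finally have eq: "(\<Sum>(x,K)\<in>p. measure lborel K *\<^sub>R h x) - (f b - f a) =
          (\<Sum>(x,K)\<in>p-q. measure lborel K *\<^sub>R h x - (f (Sup K) - f (Inf K))) +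
          (\<Sum>(x,K)\<in>q. measure lborel K *\<^sub>R h x - (f (Sup K) - f (Inf K)))" .
      show "norm ((\<Sum>(x,K)\<in>p. measure lborel K *\<^sub>R h x) - (f b - f a)) < e0"
        unfolding eq by (rule order.strict_trans1[OF norm_triangle_ineq]) (use 1 2 3 in linarith)
    qed
  qed
  then have "(h has_integral f b - f a) {a..b}" by simp
  then show ?thesis
    by (rule has_integral_spike[OF Z, rotated]) (auto simp: h_def)
qed

section \<open>Restriction, moduli and closure properties of absolute continuity\<close>

lemma absolutely_continuous_on_subinterval:
  assumes "absolutely_continuous_on a b f" "{c..d} \<subseteq> {a..b}"
  shows "absolutely_continuous_on c d f"
  unfolding absolutely_continuous_on_def
proof (intro allI impI)
  fix e :: real assume "e > 0"
  obtain r where "r > 0" and r: "\<And>D. D division_of \<Union>D \<Longrightarrow> \<Union>D \<subseteq> {a..b} \<Longrightarrow>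
      (\<Sum>I\<in>D. Sup I - Inf I) < r \<Longrightarrow> (\<Sum>I\<in>D. norm (f (Sup I) - f (Inf I))) < e"
    using assms(1)[unfolded absolutely_continuous_on_def, rule_format, OF \<open>e > 0\<close>] by blast
  show "\<exists>r>0. \<forall>D. D division_of \<Union>D \<and> \<Union>D \<subseteq> {c..d} \<and> (\<Sum>I\<in>D. Sup I - Inf I) < r \<longrightarrow>
      (\<Sum>I\<in>D. norm (f (Sup I) - f (Inf I))) < e"
    using \<open>r > 0\<close> by (intro exI[of _ r] conjI allI impI r order_trans[OF _ assms(2)]) simp_all
qed

lemma absolutely_continuous_on_modulus:
  assumes "absolutely_continuous_on a b f" "0 < e"
  obtains d where "0 < d" "\<And>s t. s \<in> {a..b} \<Longrightarrow> t \<in> {a..b} \<Longrightarrow> \<bar>s - t\<bar> < d \<Longrightarrow> norm (f s - f t) < e"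
proof -
  obtain d where "d > 0" and d: "\<And>D. D division_of \<Union>D \<Longrightarrow> \<Union>D \<subseteq> {a..b} \<Longrightarrow>
      (\<Sum>I\<in>D. Sup I - Inf I) < d \<Longrightarrow> (\<Sum>I\<in>D. norm (f (Sup I) - f (Inf I))) < e"
    using assms(1)[unfolded absolutely_continuous_on_def, rule_format, OF assms(2)] by blast
  have *: "norm (f t - f s) < e" if "a \<le> s" "s \<le> t" "t \<le> b" "t - s < d" for s t
    using d[of "{{s..t}}"] that division_of_self[of s t] by auto
  show thesis
  proof (rule that[OF \<open>d > 0\<close>])
    fix s t assume "s \<in> {a..b}" "t \<in> {a..b}" "\<bar>s - t\<bar> < d"
    then show "norm (f s - f t) < e"
      using *[of s t] *[of t s] by (cases "s \<le> t") (auto simp: norm_minus_commute)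
  qed
qed

lemma absolutely_continuous_on_imp_continuous_on:
  assumes "absolutely_continuous_on a b f"
  shows "continuous_on {a..b} f"
  unfolding continuous_on_iff dist_norm
proof safe
  fix x e :: real assume "x \<in> {a..b}" "0 < e"
  obtain d where "0 < d" "\<And>s t. s \<in> {a..b} \<Longrightarrow> t \<in> {a..b} \<Longrightarrow> \<bar>s - t\<bar> < d \<Longrightarrow> norm (f s - f t) < e"
    using absolutely_continuous_on_modulus[OF assms \<open>0 < e\<close>] by blast
  then show "\<exists>d>0. \<forall>x'\<in>{a..b}. norm (x' - x) < d \<longrightarrow> norm (f x' - f x) < e"
    using \<open>x \<in> {a..b}\<close> by (intro exI[of _ d]) auto
qed

text \<open>One domination principle yields the closure properties: for Lipschitz functions,
  differences, linear images, products and pairs, increments are bounded by a combination of those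
  of two absolutely continuous functions. Dividing by \<open>B + C + 1\<close> keeps
  \<open>c\<close> meaningful when both factors are 0.\<close>

lemma absolutely_continuous_on_dominated:
  assumes f: "absolutely_continuous_on a b f" and g: "absolutely_continuous_on a b g"
    and "0 \<le> B" "0 \<le> C"
    and h: "\<And>s t. s \<in> {a..b} \<Longrightarrow> t \<in> {a..b} \<Longrightarrow> norm (h s - h t) \<le> B * norm (f s - f t) + C * norm (g s - g t)"
  shows "absolutely_continuous_on a b h"
  unfolding absolutely_continuous_on_def
proof (intro allI impI)
  fix e :: real assume "e > 0"
  define c where "c = e / (2 * (B + C + 1))"
  have "c > 0" using \<open>e > 0\<close> assms by (simp add: c_def)
  have ce: "B * c + C * c < e"
  proof -
    have "2 * (B + C + 1) * c = e" using assms(3,4) by (simp add: c_def)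
    then show ?thesis using \<open>c > 0\<close> \<open>e > 0\<close> by (simp add: algebra_simps)
  qed
  obtain d1 where "d1 > 0" and d1: "\<And>D. D division_of \<Union>D \<Longrightarrow> \<Union>D \<subseteq> {a..b} \<Longrightarrow>
      (\<Sum>I\<in>D. Sup I - Inf I) < d1 \<Longrightarrow> (\<Sum>I\<in>D. norm (f (Sup I) - f (Inf I))) < c"
    using f[unfolded absolutely_continuous_on_def, rule_format, OF \<open>c > 0\<close>] by blast
  obtain d2 where "d2 > 0" and d2: "\<And>D. D division_of \<Union>D \<Longrightarrow> \<Union>D \<subseteq> {a..b} \<Longrightarrow>
      (\<Sum>I\<in>D. Sup I - Inf I) < d2 \<Longrightarrow> (\<Sum>I\<in>D. norm (g (Sup I) - g (Inf I))) < c"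
    using g[unfolded absolutely_continuous_on_def, rule_format, OF \<open>c > 0\<close>] by blast
  show "\<exists>d>0. \<forall>D. D division_of \<Union>D \<and> \<Union>D \<subseteq> {a..b} \<and> (\<Sum>I\<in>D. Sup I - Inf I) < d \<longrightarrow>
      (\<Sum>I\<in>D. norm (h (Sup I) - h (Inf I))) < e"
  proof (intro exI[of _ "min d1 d2"] conjI allI impI; (elim conjE)?)
    fix D assume D: "D division_of \<Union>D" "\<Union>D \<subseteq> {a..b}" "(\<Sum>I\<in>D. Sup I - Inf I) < min d1 d2"
    have "(\<Sum>I\<in>D. norm (h (Sup I) - h (Inf I))) \<le>
        (\<Sum>I\<in>D. B * norm (f (Sup I) - f (Inf I)) + C * norm (g (Sup I) - g (Inf I)))"
    proof (intro sum_mono h)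
      fix I assume "I \<in> D"
      then obtain u v where "I = cbox u v" "u \<le> v" using D(1)
        by (metis atLeastatMost_empty_iff2 box_real(2) division_ofD(3) division_ofD(4))
      moreover have "I \<subseteq> {a..b}" using D(2) \<open>I \<in> D\<close> by blast
      ultimately show "Sup I \<in> {a..b}" "Inf I \<in> {a..b}" by auto
    qed
    also have "\<dots> = B * (\<Sum>I\<in>D. norm (f (Sup I) - f (Inf I))) + C * (\<Sum>I\<in>D. norm (g (Sup I) - g (Inf I)))"
      by (simp add: sum.distrib sum_distrib_left)
    also have "\<dots> \<le> B * c + C * c"
      using d1[OF D(1,2)] d2[OF D(1,2)] D(3) assms by (intro add_mono mult_left_mono) auto
    finally show "(\<Sum>I\<in>D. norm (h (Sup I) - h (Inf I))) < e" using ce by simp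
  qed (use \<open>d1 > 0\<close> \<open>d2 > 0\<close> in auto)
qed

lemma absolutely_continuous_on_ident: "absolutely_continuous_on a b (\<lambda>t::real. t)"
  unfolding absolutely_continuous_on_def
proof (intro allI impI)
  fix e :: real assume "e > 0"
  show "\<exists>d>0. \<forall>D. D division_of \<Union>D \<and> \<Union>D \<subseteq> {a..b} \<and> (\<Sum>I\<in>D. Sup I - Inf I) < d \<longrightarrow>
      (\<Sum>I\<in>D. norm (Sup I - Inf I)) < e"
  proof (intro exI[of _ e] conjI allI impI \<open>e > 0\<close>; (elim conjE)?)
    fix D :: "real set set" assume D: "D division_of \<Union>D" "(\<Sum>I\<in>D. Sup I - Inf I) < e"
    have "(\<Sum>I\<in>D. norm (Sup I - Inf I)) = (\<Sum>I\<in>D. Sup I - Inf I)"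
    proof (intro sum.cong refl)
      fix I assume "I \<in> D"
      then obtain u v where "I = cbox u v" "u \<le> v" using D(1)
        by (metis atLeastatMost_empty_iff2 box_real(2) division_ofD(3) division_ofD(4))
      then show "norm (Sup I - Inf I) = Sup I - Inf I" by auto
    qed
    then show "(\<Sum>I\<in>D. norm (Sup I - Inf I)) < e" using D(2) by simp
  qed
qed

lemma lipschitz_imp_absolutely_continuous_on:
  fixes h :: "real \<Rightarrow> 'a::real_normed_vector"
  assumes "0 \<le> B" "\<And>s t. s \<in> {a..b} \<Longrightarrow> t \<in> {a..b} \<Longrightarrow> norm (h s - h t) \<le> B * \<bar>s - t\<bar>"
  shows "absolutely_continuous_on a b h"
  by (rule absolutely_continuous_on_dominated[OF absolutely_continuous_on_ident
        absolutely_continuous_on_ident, where B=B and C=0]) (use assms in auto)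

lemma absolutely_continuous_on_const: "absolutely_continuous_on a b (\<lambda>_. c)"
  by (rule lipschitz_imp_absolutely_continuous_on[of 0]) auto

lemma absolutely_continuous_on_diff:
  assumes "absolutely_continuous_on a b f" "absolutely_continuous_on a b g"
  shows "absolutely_continuous_on a b (\<lambda>t. f t - g t)"
proof (rule absolutely_continuous_on_dominated[OF assms, of 1 1])
  fix s t show "norm (f s - g s - (f t - g t)) \<le> 1 * norm (f s - f t) + 1 * norm (g s - g t)"
    using norm_triangle_ineq4[of "f s - f t" "g s - g t"] by (simp add: algebra_simps)
qed auto

lemma absolutely_continuous_on_bounded_linear:
  assumes "bounded_linear L" "absolutely_continuous_on a b f"
  shows "absolutely_continuous_on a b (\<lambda>t. L (f t))"
proof -
  obtain K where "0 \<le> K" "\<And>x. norm (L x) \<le> norm x * K"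
    using bounded_linear.nonneg_bounded[OF assms(1)] by auto
  then show ?thesis
    by (intro absolutely_continuous_on_dominated[OF assms(2) assms(2), of K 0])
      (auto simp: linear_diff[OF bounded_linear.linear[OF assms(1)], symmetric] mult.commute)
qed

lemma absolutely_continuous_on_bounded_bilinear:
  assumes "bounded_bilinear prd" "absolutely_continuous_on a b f" "absolutely_continuous_on a b g"
  shows "absolutely_continuous_on a b (\<lambda>t. prd (f t) (g t))"
proof -
  interpret bounded_bilinear prd by fact
  have "bounded (f ` {a..b})" "bounded (g ` {a..b})"
    using assms(2,3) by (auto intro!: compact_imp_bounded compact_continuous_image
        absolutely_continuous_on_imp_continuous_on)
  then obtain F G where FG: "F > 0" "G > 0" "\<And>t. t \<in> {a..b} \<Longrightarrow> norm (f t) \<le> F"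
      "\<And>t. t \<in> {a..b} \<Longrightarrow> norm (g t) \<le> G"
    unfolding bounded_pos by auto
  obtain K where K: "0 \<le> K" "\<And>x y. norm (prd x y) \<le> norm x * norm y * K"
    using nonneg_bounded by auto
  show ?thesis
  proof (rule absolutely_continuous_on_dominated[OF assms(2,3), of "G * K" "F * K"])
    fix s t assume st: "s \<in> {a..b}" "t \<in> {a..b}"
    have "prd (f s) (g s) - prd (f t) (g t) = prd (f s - f t) (g s) + prd (f t) (g s - g t)"
      by (simp add: diff_left diff_right)
    also have "norm \<dots> \<le> norm (f s - f t) * norm (g s) * K + norm (f t) * norm (g s - g t) * K"
      using K(2) by (intro norm_triangle_le add_mono) auto
    also have "\<dots> \<le> norm (f s - f t) * G * K + F * norm (g s - g t) * K"
      using FG st K(1) by (intro add_mono mult_right_mono mult_left_mono) auto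
    finally show "norm (prd (f s) (g s) - prd (f t) (g t)) \<le>
        G * K * norm (f s - f t) + F * K * norm (g s - g t)"
      by (simp add: mult_ac)
  qed (use FG K in auto)
qed

lemma absolutely_continuous_on_fst:
  "absolutely_continuous_on a b f \<Longrightarrow> absolutely_continuous_on a b (\<lambda>t. fst (f t))"
  by (rule absolutely_continuous_on_bounded_linear[OF bounded_linear_fst])

lemma absolutely_continuous_on_snd:
  "absolutely_continuous_on a b f \<Longrightarrow> absolutely_continuous_on a b (\<lambda>t. snd (f t))"
  by (rule absolutely_continuous_on_bounded_linear[OF bounded_linear_snd])

lemma absolutely_continuous_on_Pair:
  assumes "absolutely_continuous_on a b f" "absolutely_continuous_on a b g"
  shows "absolutely_continuous_on a b (\<lambda>t. (f t, g t))"
proof (rule absolutely_continuous_on_dominated[OF assms, of 1 1])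
  fix s t show "norm ((f s, g s) - (f t, g t)) \<le> 1 * norm (f s - f t) + 1 * norm (g s - g t)"
    using norm_Pair_le[of "f s - f t" "g s - g t"] by simp
qed simp_all

lemma has_vector_derivative_imp_absolutely_continuous_on:
  fixes f :: "real \<Rightarrow> 'a::real_normed_vector"
  assumes der: "\<And>t. t \<in> {a..b} \<Longrightarrow> (f has_vector_derivative f' t) (at t within {a..b})"
    and cont: "continuous_on {a..b} f'"
  shows "absolutely_continuous_on a b f"
proof -
  have "bounded (f' ` {a..b})"
    using cont by (intro compact_imp_bounded compact_continuous_image) auto
  then obtain B where B: "B > 0" "\<And>t. t \<in> {a..b} \<Longrightarrow> norm (f' t) \<le> B"
    unfolding bounded_pos by auto
  show ?thesis
  proof (rule lipschitz_imp_absolutely_continuous_on[of B])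
    fix s t assume st: "s \<in> {a..b}" "t \<in> {a..b}"
    have "norm (f s - f t) \<le> B * norm (s - t)"
    proof (rule differentiable_bound[OF _ _ _ st])
      show "\<And>x. x \<in> {a..b} \<Longrightarrow> (f has_derivative (\<lambda>h. h *\<^sub>R f' x)) (at x within {a..b})"
        using der by (simp add: has_vector_derivative_def)
      show "\<And>x. x \<in> {a..b} \<Longrightarrow> onorm (\<lambda>h. h *\<^sub>R f' x) \<le> B"
        using B(2) by (intro onorm_le) (simp add: mult.commute[of B] mult_left_mono)
    qed auto
    then show "norm (f s - f t) \<le> B * \<bar>s - t\<bar>" by simp
  qed (use B in auto)
qed

text \<open>
  A solution in the sense of Caratheodory of an equation with continuous right-hand side is a
  classical solution, by the fundamental theorem of calculus for absolutely continuous functions.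
\<close>

lemma absolutely_continuous_on_imp_derivative:
  fixes f :: "real \<Rightarrow> 'a::euclidean_space"
  assumes ac: "absolutely_continuous_on a b f" and Z: "negligible Z"
    and der: "\<And>t. t \<in> {a..b} - Z \<Longrightarrow> (f has_vector_derivative g t) (at t within {a..b})"
    and g: "continuous_on {a..b} g" and t: "t \<in> {a..b}"
  shows "(f has_vector_derivative g t) (at t within {a..b})"
proof -
  have "f x = f a + integral {a..x} g" if "x \<in> {a..b}" for x
  proof -
    have "(g has_integral f x - f a) {a..x}"
      using that by (intro absolutely_continuous_on_integral[OF _ _ Z]
          absolutely_continuous_on_subinterval[OF ac])
        (auto intro!: has_vector_derivative_within_subset[OF der])
    then show ?thesis by (simp add: integral_unique)
  qed
  moreover have "((\<lambda>x. f a + integral {a..x} g) has_vector_derivative g t) (at t within {a..b})"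
    using has_vector_derivative_add[OF has_vector_derivative_const integral_has_vector_derivative[OF g t]] by simp
  ultimately show ?thesis
    by (rule has_vector_derivative_transform[OF t])
qed

section \<open>Differential equations\<close>

lemma derivative_bound_imp_increment_le:
  fixes f :: "real \<Rightarrow> real"
  assumes "a \<le> b"
    and der: "\<And>t. t \<in> {a..b} \<Longrightarrow> (f has_vector_derivative f' t) (at t within {a..b})"
    and le: "\<And>t. t \<in> {a..b} \<Longrightarrow> f' t \<le> c"
  shows "f b \<le> f a + c * (b - a)"
proof -
  have "\<exists>x\<in>{a..b}. f b - f a = (b - a) *\<^sub>R f' x"
    using der by (intro mvt_very_simple[OF \<open>a \<le> b\<close>]) (auto simp: has_vector_derivative_def)
  then obtain x where x: "x \<in> {a..b}" "f b - f a = (b - a) * f' x" by auto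
  have "(b - a) * f' x \<le> (b - a) * c"
    using le[OF x(1)] \<open>a \<le> b\<close> by (intro mult_left_mono) auto
  then show ?thesis using x(2) by (simp add: algebra_simps)
qed

text \<open>Gronwall's inequality: \<open>exp (- c * (t - a)) * f t\<close> has a nonpositive
  derivative. No sign is asked of \<open>c\<close> or \<open>f\<close>; the energy estimate for the
  adjoint system applies it to a negated function to get growth instead of a bound on
  growth.\<close>

lemma exp_growth_bound:
  fixes f :: "real \<Rightarrow> real"
  assumes "a \<le> b"
    and der: "\<And>t. t \<in> {a..b} \<Longrightarrow> (f has_vector_derivative f' t) (at t within {a..b})"
    and le: "\<And>t. t \<in> {a..b} \<Longrightarrow> f' t \<le> c * f t"
  shows "f b \<le> exp (c * (b - a)) * f a"
proof -
  define g where "g t = exp (- c * (t - a)) * f t" for t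
  have "(g has_vector_derivative exp (- c * (t - a)) * (f' t - c * f t)) (at t within {a..b})"
    if "t \<in> {a..b}" for t
  proof -
    have [derivative_intros]: "(f has_real_derivative f' t) (at t within {a..b})"
      using der[OF that] by (simp add: has_real_derivative_iff_has_vector_derivative)
    show ?thesis
      unfolding g_def has_real_derivative_iff_has_vector_derivative[symmetric]
      by (auto intro!: derivative_eq_intros simp: algebra_simps)
  qed
  then have "g b \<le> g a + 0 * (b - a)"
    by (rule derivative_bound_imp_increment_le[OF \<open>a \<le> b\<close>])
      (use le in \<open>auto simp: mult_le_0_iff\<close>)
  then have "exp (- c * (b - a)) * f b \<le> f a" by (simp add: g_def)
  then have "exp (c * (b - a)) * (exp (- c * (b - a)) * f b) \<le> exp (c * (b - a)) * f a"
    by (intro mult_left_mono) auto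
  then show ?thesis by (simp flip: mult.assoc exp_add)
qed

text \<open>Gronwall's inequality for the squared distance of the two solutions. The Lipschitz
  estimate is asked along these two solutions only; with \<open>L = 0\<close> and a constant
  \<open>g\<close> this says that a function with zero derivative is constant.\<close>

lemma lipschitz_ode_unique:
  fixes f g :: "real \<Rightarrow> 'a::real_inner"
  assumes "a \<le> b"
    and f: "\<And>t. t \<in> {a..b} \<Longrightarrow> (f has_vector_derivative F t (f t)) (at t within {a..b})"
    and g: "\<And>t. t \<in> {a..b} \<Longrightarrow> (g has_vector_derivative F t (g t)) (at t within {a..b})"
    and lip: "\<And>t. t \<in> {a..b} \<Longrightarrow> norm (F t (f t) - F t (g t)) \<le> L * norm (f t - g t)"
    and init: "f a = g a"
  shows "f b = g b"
proof -
  define h where "h t = (f t - g t) \<bullet> (f t - g t)" for t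
  have "(h has_vector_derivative 2 * ((f t - g t) \<bullet> (F t (f t) - F t (g t)))) (at t within {a..b})"
    if "t \<in> {a..b}" for t
  proof -
    have "(h has_vector_derivative
        (f t - g t) \<bullet> (F t (f t) - F t (g t)) + (F t (f t) - F t (g t)) \<bullet> (f t - g t)) (at t within {a..b})"
      unfolding h_def using f[OF that] g[OF that]
      by (intro bounded_bilinear.has_vector_derivative[OF bounded_bilinear_inner] has_vector_derivative_diff)
    then show ?thesis by (simp add: inner_commute)
  qed
  moreover have "2 * ((f t - g t) \<bullet> (F t (f t) - F t (g t))) \<le> 2 * L * h t" if "t \<in> {a..b}" for t
  proof -
    have "(f t - g t) \<bullet> (F t (f t) - F t (g t)) \<le> norm (f t - g t) * norm (F t (f t) - F t (g t))"
      by (rule norm_cauchy_schwarz)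
    also have "\<dots> \<le> norm (f t - g t) * (L * norm (f t - g t))"
      using lip[OF that] by (intro mult_left_mono) auto
    also have "\<dots> = L * h t" by (simp add: h_def dot_square_norm power2_eq_square)
    finally show ?thesis by simp
  qed
  ultimately have "h b \<le> exp (2 * L * (b - a)) * h a"
    by (rule exp_growth_bound[OF \<open>a \<le> b\<close>])
  then have "(f b - g b) \<bullet> (f b - g b) \<le> 0" using init by (simp add: h_def)
  then show ?thesis by (metis inner_eq_zero_iff inner_ge_zero order_antisym right_minus_eq)
qed

text \<open>
  Picard's operator becomes a contraction on the whole interval once the functions are
  rescaled by an exponential with rate larger than the Lipschitz constant.
\<close>

lemma lipschitz_ode_exists:
  fixes F :: "real \<Rightarrow> 'a::euclidean_space \<Rightarrow> 'a"
  assumes "a \<le> b"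
    and cont: "\<And>y. continuous_on {a..b} y \<Longrightarrow> continuous_on {a..b} (\<lambda>t. F t (y t))"
    and lip: "\<And>t x y. t \<in> {a..b} \<Longrightarrow> norm (F t x - F t y) \<le> L * norm (x - y)"
  obtains y where "y a = x0"
    "\<And>t. t \<in> {a..b} \<Longrightarrow> (y has_vector_derivative F t (y t)) (at t within {a..b})"
proof -
  define M where "M = \<bar>L\<bar> + 1"
  have "M > 0" "L \<le> M" by (auto simp: M_def)
  \<comment> \<open>The exponential weight. The integral of \<open>M * E\<close> over
    \<open>{a..t}\<close> is at most \<open>E t / 2\<close>, which is the contraction factor 1/2;
    the summand 1 in \<open>M\<close> makes it positive whatever \<open>L\<close> is.\<close>
  define E where "E t = exp (2 * M * (t - a))" for t
  have E: "E t > 0" "continuous_on S E" for t S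
    by (auto simp: E_def intro!: continuous_intros)
  have Eint: "((\<lambda>s. 2 * M * E s) has_integral E t - E a) {a..t}" if "a \<le> t" for t
    unfolding E_def by (rule fundamental_theorem_of_calculus[OF that])
      (auto simp flip: has_real_derivative_iff_has_vector_derivative intro!: derivative_eq_intros)
  define G where "G z t = (1 / E t) *\<^sub>R (x0 + integral {a..t} (\<lambda>s. F s (E s *\<^sub>R apply_bcontfun z s)))" for z t
  have Fc: "continuous_on {a..b} (\<lambda>s. F s (E s *\<^sub>R apply_bcontfun z s))" for z
    by (intro cont continuous_on_scaleR E(2) continuous_on_apply_bcontfun)
  have "continuous_on (cbox a b) (G z)" for z
    unfolding G_def using E(1) integrable_continuous_real[OF Fc]
    by (intro continuous_intros E(2)) (auto intro: indefinite_integral_continuous_1 simp: less_imp_neq[symmetric])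
  \<comment> \<open>The complete metric space consists of bounded continuous functions on the whole
    line; clamping the argument extends \<open>G z\<close> from \<open>{a..b}\<close> to such a
    function.\<close>
  then have "\<exists>g. \<forall>x. apply_bcontfun g x = G z (clamp a b x)" for z
    by (metis continuous_on_cbox_bcontfunE)
  then obtain P where P: "\<And>z x. apply_bcontfun (P z) x = G z (clamp a b x)"
    by metis
  have "dist (P z) (P w) \<le> 1 / 2 * dist z w" for z w
  proof (rule dist_bound)
    fix x :: real
    define t where "t = clamp a b x"
    have t: "t \<in> {a..b}" using clamp_in_interval[of a b x] \<open>a \<le> b\<close> by (simp add: t_def)
    have sub: "{a..t} \<subseteq> {a..b}" using t by auto
    have int: "(\<lambda>s. F s (E s *\<^sub>R apply_bcontfun v s)) integrable_on {a..t}" for v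
      by (rule integrable_continuous_real[OF continuous_on_subset[OF Fc sub]])
    have "norm (integral {a..t} (\<lambda>s. F s (E s *\<^sub>R apply_bcontfun z s)) - integral {a..t} (\<lambda>s. F s (E s *\<^sub>R apply_bcontfun w s)))
        = norm (integral {a..t} (\<lambda>s. F s (E s *\<^sub>R apply_bcontfun z s) - F s (E s *\<^sub>R apply_bcontfun w s)))"
      by (simp add: integral_diff int)
    also have "\<dots> \<le> integral {a..t} (\<lambda>s. dist z w / 2 * (2 * M * E s))"
    proof (rule integral_norm_bound_integral)
      show "(\<lambda>s. dist z w / 2 * (2 * M * E s)) integrable_on {a..t}"
        by (intro integrable_continuous_real continuous_intros E)
      fix s assume s: "s \<in> {a..t}"
      have "norm (F s (E s *\<^sub>R apply_bcontfun z s) - F s (E s *\<^sub>R apply_bcontfun w s)) \<le>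
          L * norm (E s *\<^sub>R apply_bcontfun z s - E s *\<^sub>R apply_bcontfun w s)"
        using s sub by (intro lip) auto
      also have "\<dots> \<le> M * norm (E s *\<^sub>R apply_bcontfun z s - E s *\<^sub>R apply_bcontfun w s)"
        using \<open>L \<le> M\<close> by (intro mult_right_mono) auto
      also have "\<dots> = M * (E s * dist (apply_bcontfun z s) (apply_bcontfun w s))"
        using E(1)[of s] by (simp add: dist_norm flip: scaleR_diff_right)
      also have "\<dots> \<le> M * (E s * dist z w)"
        using E(1)[of s] \<open>M > 0\<close> by (intro mult_left_mono dist_bounded) auto
      finally show "norm (F s (E s *\<^sub>R apply_bcontfun z s) - F s (E s *\<^sub>R apply_bcontfun w s)) \<le> dist z w / 2 * (2 * M * E s)"
        by (simp add: mult_ac)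
    qed (intro integrable_diff int)
    also have "\<dots> = dist z w / 2 * (E t - E a)"
      using integral_unique[OF Eint[of t]] t by simp
    also have "\<dots> \<le> dist z w / 2 * E t"
      using E(1)[of a] by (intro mult_left_mono) auto
    finally have *: "norm (integral {a..t} (\<lambda>s. F s (E s *\<^sub>R apply_bcontfun z s)) -
        integral {a..t} (\<lambda>s. F s (E s *\<^sub>R apply_bcontfun w s))) \<le> dist z w / 2 * E t" .
    have "dist (G z t) (G w t) = 1 / E t * norm (integral {a..t} (\<lambda>s. F s (E s *\<^sub>R apply_bcontfun z s)) -
        integral {a..t} (\<lambda>s. F s (E s *\<^sub>R apply_bcontfun w s)))"
      using E(1)[of t] by (simp add: G_def dist_norm flip: scaleR_diff_right)
    also have "\<dots> \<le> 1 / E t * (dist z w / 2 * E t)"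
      using E(1)[of t] * by (intro mult_left_mono) auto
    also have "\<dots> = 1 / 2 * dist z w" using E(1)[of t] by simp
    finally show "dist (apply_bcontfun (P z) x) (apply_bcontfun (P w) x) \<le> 1 / 2 * dist z w"
      by (simp add: P t_def)
  qed
  then obtain z where z: "P z = z"
    using banach_fix_type[of "1/2" P] by auto
  define y where "y t = E t *\<^sub>R apply_bcontfun z t" for t
  have y: "y t = x0 + integral {a..t} (\<lambda>s. F s (y s))" if "t \<in> {a..b}" for t
  proof -
    have "apply_bcontfun z t = G z t"
      using that P[of z t] clamp_cancel_cbox[of t a b] by (simp add: z)
    then show ?thesis using E(1)[of t] by (simp add: y_def G_def)
  qed
  show thesis
  proof (rule that)
    show "y a = x0" using y[of a] \<open>a \<le> b\<close> by simp
    fix t assume t: "t \<in> {a..b}"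
    have "((\<lambda>x. x0 + integral {a..x} (\<lambda>s. F s (y s))) has_vector_derivative 0 + F t (y t)) (at t within {a..b})"
      using Fc[of z] t unfolding y_def
      by (intro has_vector_derivative_add has_vector_derivative_const integral_has_vector_derivative)
    then show "(y has_vector_derivative F t (y t)) (at t within {a..b})"
      using has_vector_derivative_transform[OF t y] by simp
  qed
qed

section \<open>Matrices\<close>

declare transpose_matrix_vector [simp del]

lemma bounded_bilinear_matrix_vector_mult:
  "bounded_bilinear ((*v) :: real^'n^'m \<Rightarrow> real^'n \<Rightarrow> real^'m)"
  unfolding bilinear_conv_bounded_bilinear[symmetric] bilinear_def
  by (auto intro!: linearI simp: matrix_vector_mult_def vec_eq_iff algebra_simps sum.distrib sum_distrib_left)

lemma bounded_bilinear_matrix_matrix_mult: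
  "bounded_bilinear ((**) :: real^'n^'m \<Rightarrow> real^'k^'n \<Rightarrow> real^'k^'m)"
  unfolding bilinear_conv_bounded_bilinear[symmetric] bilinear_def
  by (auto intro!: linearI simp: matrix_matrix_mult_def vec_eq_iff algebra_simps sum.distrib sum_distrib_left)

lemma bounded_linear_transpose: "bounded_linear (transpose :: real^'n^'m \<Rightarrow> real^'m^'n)"
  unfolding linear_conv_bounded_linear[symmetric]
  by (auto intro!: linearI simp: transpose_def vec_eq_iff)

lemma bounded_linear_trace: "bounded_linear (trace :: real^'n^'n \<Rightarrow> real)"
  unfolding linear_conv_bounded_linear[symmetric]
  by (auto intro!: linearI simp: trace_def sum.distrib sum_distrib_left)

lemma skew_component:
  "skew x $ 1 $ 1 = 0" "skew x $ 1 $ 2 = - x$3" "skew x $ 1 $ 3 = x$2"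
  "skew x $ 2 $ 1 = x$3" "skew x $ 2 $ 2 = 0" "skew x $ 2 $ 3 = - x$1"
  "skew x $ 3 $ 1 = - x$2" "skew x $ 3 $ 2 = x$1" "skew x $ 3 $ 3 = 0"
  by (auto simp: skew_def matrix_def cross3_simps axis_def)

lemma psi_component:
  "psi B $ 1 = (B$3$2 - B$2$3) / 2" "psi B $ 2 = (B$1$3 - B$3$1) / 2" "psi B $ 3 = (B$2$1 - B$1$2) / 2"
  by (simp_all add: psi_def)

lemma bounded_linear_skew: "bounded_linear skew"
  unfolding linear_conv_bounded_linear[symmetric]
  by (auto intro!: linearI simp: vec_eq_iff forall_3 skew_component)

lemma bounded_linear_psi: "bounded_linear psi"
  unfolding linear_conv_bounded_linear[symmetric]
  by (auto intro!: linearI simp: vec_eq_iff forall_3 psi_component field_simps)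

lemma skew_minus: "skew (- x) = - skew x"
  and transpose_skew: "transpose (skew x) = - skew x"
  by (auto simp: vec_eq_iff forall_3 skew_component transpose_def)

lemma norm_matrix_vector_mult_le:
  fixes A :: "real^'n^'m"
  shows "norm (A *v x) \<le> norm A * norm x"
proof -
  have "norm (A *v x) = L2_set (\<lambda>i. norm ((A *v x) $ i)) UNIV"
    by (simp add: norm_vec_def)
  also have "\<dots> \<le> L2_set (\<lambda>i. norm x * norm (A $ i)) UNIV"
    using Cauchy_Schwarz_ineq2[of "A $ _" x]
    by (intro L2_set_mono) (auto simp: matrix_vector_mul_component mult.commute)
  also have "\<dots> = norm A * norm x"
    by (simp add: L2_set_right_distrib norm_vec_def[of A] mult.commute)
  finally show ?thesis .
qed

lemma norm_transpose: "norm (transpose A) = norm (A :: real^'n^'m)"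
proof -
  have "norm (transpose A) ^ 2 = norm A ^ 2"
    unfolding power2_norm_eq_inner inner_vec_def transpose_def
    by (simp add: sum.swap[of "\<lambda>i j. A $ j $ i * A $ j $ i"])
  then show ?thesis by (rule power2_eq_imp_eq) auto
qed

lemma norm_matrix_matrix_mult_le:
  fixes A :: "real^'n^'m" and B :: "real^'k^'n"
  shows "norm (A ** B) \<le> norm A * norm B"
proof -
  have row: "(A ** B) $ i = transpose B *v (A $ i)" for i
    by (simp add: matrix_matrix_mult_def matrix_vector_mult_def transpose_def vec_eq_iff mult.commute)
  have "norm (A ** B) = L2_set (\<lambda>i. norm ((A ** B) $ i)) UNIV"
    by (simp add: norm_vec_def)
  also have "\<dots> \<le> L2_set (\<lambda>i. norm B * norm (A $ i)) UNIV"
  proof (rule L2_set_mono)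
    show "norm ((A ** B) $ i) \<le> norm B * norm (A $ i)" for i
      using norm_matrix_vector_mult_le[of "transpose B" "A $ i"] by (simp add: row norm_transpose)
  qed simp
  also have "\<dots> = norm A * norm B"
    by (simp add: L2_set_right_distrib norm_vec_def[of A] mult.commute)
  finally show ?thesis .
qed

lemma inner_matrix_vector_mult: "x \<bullet> (A *v y) = (transpose A *v x) \<bullet> (y::real^'n)"
  by (simp add: dot_lmul_matrix transpose_matrix_vector)

lemma orthogonal_matrix_mult_vec_inner:
  "orthogonal_matrix R \<Longrightarrow> (R *v x) \<bullet> (R *v y) = x \<bullet> (y::real^'n)"
  by (simp add: inner_matrix_vector_mult matrix_vector_mul_assoc orthogonal_matrix_def)

lemma orthogonal_matrix_mult_vec_norm:
  "orthogonal_matrix R \<Longrightarrow> norm (R *v x) = norm (x::real^'n)"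
  by (simp add: norm_eq_sqrt_inner orthogonal_matrix_mult_vec_inner)

text \<open>A solution is in the flow set only in the interior of each interval of flow; closedness
  carries the constraint over to the endpoints.\<close>

lemma closed_rotation_matrix: "closed {R :: real^'n^'n. rotation_matrix R}"
proof -
  have "continuous_on UNIV (\<lambda>R::real^'n^'n. det R)"
    unfolding det_def by (intro continuous_intros)
  moreover have "continuous_on UNIV (\<lambda>R::real^'n^'n. transpose R ** R)"
    by (intro bounded_bilinear.continuous_on[OF bounded_bilinear_matrix_matrix_mult]
        linear_continuous_on bounded_linear_transpose continuous_on_id)
  ultimately have "closed ({R::real^'n^'n. transpose R ** R = mat 1} \<inter> {R. det R = 1})"
    by (intro closed_Int closed_Collect_eq continuous_on_const)
  then show ?thesis
    by (simp add: rotation_matrix_def orthogonal_matrix Collect_conj_eq)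
qed

text \<open>The norm is the Frobenius norm, which gives the factor sqrt 2 here and the value sqrt 3
  for orthogonal matrices below. Both are rounded up to 2 so that the later constants stay
  rational.\<close>

lemma norm_skew_le: "norm (skew x) \<le> 2 * norm x"
proof -
  have "norm (skew x) ^ 2 = 2 * norm x ^ 2"
    by (simp add: power2_norm_eq_inner inner_vec_def sum_3 skew_component)
  also have "\<dots> \<le> (2 * norm x) ^ 2" by (simp add: power_mult_distrib)
  finally show ?thesis by (rule power2_le_imp_le) simp
qed

lemma norm_orthogonal_matrix_le: "orthogonal_matrix R \<Longrightarrow> norm (R :: real^3^3) \<le> 2"
proof -
  assume "orthogonal_matrix R"
  then have "transpose R ** R = mat 1" by (simp add: orthogonal_matrix)
  then have "trace (transpose R ** R) = 3" by (simp add: trace_I)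
  then have "norm R ^ 2 = 3"
    by (simp add: power2_norm_eq_inner inner_vec_def sum_3 trace_def matrix_matrix_mult_def transpose_def)
  also have "\<dots> \<le> 2 ^ 2" by simp
  finally show ?thesis by (rule power2_le_imp_le) simp
qed

text \<open>The cross product is equivariant under rotations. It is needed for the term
  \<open>transpose Rh *v \<eta>\<close> in the observer, an angular velocity given in the frame of
  the estimate.\<close>

lemma rotation_matrix_skew:
  "rotation_matrix R \<Longrightarrow> R ** skew x ** transpose R = skew (R *v x)"
proof -
  assume R: "rotation_matrix R"
  then have RR: "R ** transpose R = mat 1" by (simp add: rotation_matrix_def orthogonal_matrix_def)
  have "(R ** skew x ** transpose R) *v y = skew (R *v x) *v y" for y
  proof -
    have "(R ** skew x ** transpose R) *v y = R *v cross3 x (transpose R *v y)"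
      by (simp only: matrix_vector_mul_assoc[symmetric] skew_mult_vec)
    also have "\<dots> = cross3 (R *v x) (R *v (transpose R *v y))"
      using cross_rotation_matrix[OF R] by simp
    finally show ?thesis by (simp only: matrix_vector_mul_assoc RR matrix_vector_mul_lid skew_mult_vec)
  qed
  then show ?thesis by (simp add: matrix_eq)
qed

section \<open>Eigenvalues of symmetric matrices\<close>

lemma symmetric_matrix_inner:
  fixes A :: "real^'n^'n"
  assumes "transpose A = A"
  shows "x \<bullet> (A *v y) = (A *v x) \<bullet> y"
  by (metis assms inner_matrix_vector_mult)

text \<open>Moving from \<open>u\<close> along \<open>B *v u\<close> changes the form by 2 s |B u|^2
  + O(s^2), which is negative for small negative s unless \<open>B *v u\<close> vanishes.\<close>

lemma positive_semidefinite_null: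
  fixes B :: "real^'n^'n"
  assumes sym: "transpose B = B" and psd: "\<And>x. 0 \<le> x \<bullet> (B *v x)" and null: "u \<bullet> (B *v u) = 0"
  shows "B *v u = 0"
proof (rule ccontr)
  assume "B *v u \<noteq> 0"
  define v where "v = B *v u"
  define b where "b = v \<bullet> v"
  define c where "c = v \<bullet> (B *v v)"
  have b: "b > 0" using \<open>B *v u \<noteq> 0\<close> by (simp add: b_def v_def)
  have c: "c \<ge> 0" using psd by (simp add: c_def)
  \<comment> \<open>The minimiser of 2 s b + s^2 c would be - b / c; as \<open>c\<close> may be 0,
    the denominator is \<open>1 + c\<close>, which still makes the change negative.\<close>
  define s where "s = - b / (1 + c)"
  have "(u + s *\<^sub>R v) \<bullet> (B *v (u + s *\<^sub>R v)) = u \<bullet> (B *v u) + s * (v \<bullet> (B *v u) + u \<bullet> (B *v v)) + s\<^sup>2 * c"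
    by (simp add: c_def inner_add_left inner_add_right matrix_vector_right_distrib
        matrix_vector_mult_scaleR power2_eq_square algebra_simps)
  also have "u \<bullet> (B *v v) = b"
    using symmetric_matrix_inner[OF sym, of u v] by (simp add: b_def v_def)
  also have "v \<bullet> (B *v u) = b" by (simp add: b_def v_def)
  finally have "0 \<le> s * (2 * b) + s\<^sup>2 * c"
    using psd[of "u + s *\<^sub>R v"] null by simp
  moreover have "s\<^sup>2 * c = - (s * b) - s\<^sup>2"
  proof -
    have "s * (1 + c) = - b" using c by (simp add: s_def)
    then have "s * (s * (1 + c)) = s * (- b)" by simp
    then show ?thesis by (simp add: algebra_simps power2_eq_square)
  qed
  moreover have "s * b < 0" using b c by (simp add: s_def divide_neg_pos mult_neg_pos)
  moreover have "s * (2 * b) = 2 * (s * b)" by simp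
  ultimately show False using zero_le_power2[of s] by linarith
qed

text \<open>A minimiser \<open>u\<close> of the form on the unit sphere, with value
  \<open>m\<close>, is a null vector of the positive semidefinite matrix A - m I, hence an
  eigenvector. This avoids Lagrange multipliers and the spectral theorem.\<close>

lemma rayleigh_minimum:
  fixes A :: "real^'n^'n"
  assumes sym: "transpose A = A"
  obtains m where "m \<in> eigenvalues A" "\<And>x. m * (x \<bullet> x) \<le> x \<bullet> (A *v x)"
proof -
  have "continuous_on (sphere 0 1) (\<lambda>x. x \<bullet> (A *v x))"
    by (intro continuous_on_inner continuous_on_id
        bounded_bilinear.continuous_on[OF bounded_bilinear_matrix_vector_mult] continuous_on_const)
  moreover have "(axis undefined 1 :: real^'n) \<in> sphere 0 1" by (simp add: norm_axis_1)
  ultimately obtain u where u: "u \<in> sphere 0 1"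
    and min: "\<And>x. x \<in> sphere 0 1 \<Longrightarrow> u \<bullet> (A *v u) \<le> x \<bullet> (A *v x)"
    using continuous_attains_inf[of "sphere 0 1" "\<lambda>x. x \<bullet> (A *v x)"] by auto
  define m where "m = u \<bullet> (A *v u)"
  have le: "m * (x \<bullet> x) \<le> x \<bullet> (A *v x)" for x
  proof (cases "x = 0")
    case False
    have "m \<le> (x /\<^sub>R norm x) \<bullet> (A *v (x /\<^sub>R norm x))"
      unfolding m_def by (rule min) (use False in simp)
    also have "\<dots> = (x \<bullet> (A *v x)) / (x \<bullet> x)"
      by (simp add: matrix_vector_mult_scaleR dot_square_norm power2_eq_square divide_simps)
    finally show ?thesis using False by (simp add: field_simps)
  qed simp
  have uu: "u \<bullet> u = 1" using u by (simp add: dot_square_norm)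
  have B: "(A - m *\<^sub>R mat 1) *v x = A *v x - m *\<^sub>R x" for x
    by (simp add: matrix_vector_mult_diff_rdistrib flip: scaleR_matrix_vector_assoc)
  have "(A - m *\<^sub>R mat 1) *v u = 0"
  proof (rule positive_semidefinite_null)
    show "transpose (A - m *\<^sub>R mat 1) = A - m *\<^sub>R mat 1"
      using sym by (simp add: vec_eq_iff transpose_def mat_def)
    show "0 \<le> x \<bullet> ((A - m *\<^sub>R mat 1) *v x)" for x
      using le[of x] by (simp add: B inner_diff_right)
    show "u \<bullet> ((A - m *\<^sub>R mat 1) *v u) = 0"
      unfolding B by (simp add: inner_diff_right uu m_def)
  qed
  then have "A *v u = m *\<^sub>R u" by (simp add: B)
  moreover have "u \<noteq> 0" using uu by auto
  ultimately have "m \<in> eigenvalues A" by (auto simp: eigenvalues_def)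
  with le that show thesis by blast
qed

lemma rayleigh_maximum:
  fixes A :: "real^'n^'n"
  assumes sym: "transpose A = A"
  obtains m where "m \<in> eigenvalues A" "\<And>x. x \<bullet> (A *v x) \<le> m * (x \<bullet> x)"
proof -
  have minus: "(- A) *v x = - (A *v x)" for x
    by (simp add: matrix_vector_mult_def vec_eq_iff sum_negf)
  have "transpose (- A) = - A" using sym by (simp add: vec_eq_iff transpose_def)
  then obtain m where m: "m \<in> eigenvalues (- A)" "\<And>x. m * (x \<bullet> x) \<le> x \<bullet> ((- A) *v x)"
    using rayleigh_minimum by blast
  then have "- m \<in> eigenvalues A"
    by (auto simp: eigenvalues_def minus minus_equation_iff[of "A *v _"] intro: sym)
  moreover have "x \<bullet> (A *v x) \<le> - m * (x \<bullet> x)" for x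
    using m(2)[of x] by (simp add: minus)
  ultimately show thesis using that by blast
qed

text \<open>\<open>lambda_min\<close> and \<open>lambda_max\<close> are a \<open>Min\<close> and a
  \<open>Max\<close>, which are meaningful for finite sets only. Eigenvectors of distinct
  eigenvalues are orthogonal, hence independent, hence finite in number.\<close>

lemma finite_eigenvalues:
  fixes A :: "real^'n^'n"
  assumes sym: "transpose A = A"
  shows "finite (eigenvalues A)"
proof -
  have "\<forall>l\<in>eigenvalues A. \<exists>x. x \<noteq> 0 \<and> A *v x = l *\<^sub>R x" by (auto simp: eigenvalues_def)
  then obtain v where v: "\<And>l. l \<in> eigenvalues A \<Longrightarrow> v l \<noteq> 0"
      "\<And>l. l \<in> eigenvalues A \<Longrightarrow> A *v v l = l *\<^sub>R v l" by metis
  have orth: "v l \<bullet> v m = 0" if "l \<in> eigenvalues A" "m \<in> eigenvalues A" "l \<noteq> m" for l m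
    using symmetric_matrix_inner[OF sym, of "v l" "v m"] v that by simp
  have inj: "inj_on v (eigenvalues A)"
    using orth v(1) by (metis inj_onI inner_eq_zero_iff)
  have "pairwise orthogonal (v ` eigenvalues A)"
    using orth by (auto simp: pairwise_def orthogonal_def)
  moreover have "0 \<notin> v ` eigenvalues A" using v(1) by auto
  ultimately have "independent (v ` eigenvalues A)" by (rule pairwise_orthogonal_independent)
  then have "finite (v ` eigenvalues A)" by (rule finiteI_independent)
  then show ?thesis using inj finite_imageD by blast
qed

lemma lambda_min_le_rayleigh:
  fixes A :: "real^'n^'n"
  assumes "transpose A = A"
  shows "lambda_min A * (x \<bullet> x) \<le> x \<bullet> (A *v x)"
proof -
  obtain m where m: "m \<in> eigenvalues A" "\<And>x. m * (x \<bullet> x) \<le> x \<bullet> (A *v x)"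
    using rayleigh_minimum[OF assms] by blast
  have "lambda_min A \<le> m" using m(1) finite_eigenvalues[OF assms] by (simp add: lambda_min_def)
  then have "lambda_min A * (x \<bullet> x) \<le> m * (x \<bullet> x)" by (intro mult_right_mono) auto
  then show ?thesis using m(2)[of x] by simp
qed

lemma rayleigh_le_lambda_max:
  fixes A :: "real^'n^'n"
  assumes "transpose A = A"
  shows "x \<bullet> (A *v x) \<le> lambda_max A * (x \<bullet> x)"
proof -
  obtain m where m: "m \<in> eigenvalues A" "\<And>x. x \<bullet> (A *v x) \<le> m * (x \<bullet> x)"
    using rayleigh_maximum[OF assms] by blast
  have "m \<le> lambda_max A" using m(1) finite_eigenvalues[OF assms] by (simp add: lambda_max_def)
  then have "m * (x \<bullet> x) \<le> lambda_max A * (x \<bullet> x)" by (intro mult_right_mono) auto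
  then show ?thesis using m(2)[of x] by simp
qed

lemma lambda_min_in_eigenvalues:
  fixes A :: "real^'n^'n"
  assumes "transpose A = A"
  shows "lambda_min A \<in> eigenvalues A"
  using rayleigh_minimum[OF assms] finite_eigenvalues[OF assms] unfolding lambda_min_def
  by (metis Min_in empty_iff)

section \<open>Landmarks\<close>

lemma matrix_vector_mult_sum_left:
  fixes A :: "'i \<Rightarrow> real^'n^'m"
  shows "sum A S *v x = (\<Sum>i\<in>S. A i *v x)"
  using bounded_bilinear.sum_left[OF bounded_bilinear_matrix_vector_mult] .

lemma transpose_M_mat: "transpose (M_mat N lm k) = M_mat N lm k"
  by (simp add: M_mat_def transpose_def vec_eq_iff Let_def mult.commute)

lemma transpose_Mbar: "transpose (Mbar N lm k) = Mbar N lm k"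
  using transpose_M_mat[of N lm k] by (simp add: Mbar_def vec_eq_iff transpose_def mat_def)

text \<open>Lagrange's identity |q x v|^2 = |q|^2 |v|^2 - (q . v)^2, summed over the landmarks: the
  trace of \<open>M_mat\<close> collects the first terms and its quadratic form the second.\<close>

lemma Mbar_quadratic_form:
  "x \<bullet> (Mbar N lm k *v x) = (1/2) * (\<Sum>i=1..N. k i * (norm (cross3 (lm i - centroid N lm k) x))\<^sup>2)"
proof -
  define q where "q i = lm i - centroid N lm k" for i
  have M: "M_mat N lm k = (\<Sum>i=1..N. k i *\<^sub>R (\<chi> r c. q i $ r * q i $ c))"
    by (simp add: M_mat_def q_def Let_def)
  have "(\<chi> r c. q i $ r * q i $ c) *v x = (q i \<bullet> x) *\<^sub>R q i" for i
    by (simp add: vec_eq_iff forall_3 matrix_vector_mult_def sum_3 inner_vec_def algebra_simps)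
  then have 1: "x \<bullet> (M_mat N lm k *v x) = (\<Sum>i=1..N. k i * (q i \<bullet> x)\<^sup>2)"
    by (simp add: M matrix_vector_mult_sum_left inner_sum_right power2_eq_square inner_commute mult.assoc
        flip: scaleR_matrix_vector_assoc)
  have "trace (\<chi> r c. q i $ r * q i $ c) = q i \<bullet> q i" for i
    by (simp add: trace_def sum_3 inner_vec_def)
  then have 2: "trace (M_mat N lm k) = (\<Sum>i=1..N. k i * (q i \<bullet> q i))"
    using linear_sum[OF bounded_linear.linear[OF bounded_linear_trace], of "\<lambda>i. k i *\<^sub>R (\<chi> r c. q i $ r * q i $ c)" "{1..N}"]
    by (simp add: M linear_scale[OF bounded_linear.linear[OF bounded_linear_trace]])
  have 3: "k i * (norm (cross3 (q i) x))\<^sup>2 = k i * (q i \<bullet> q i) * (x \<bullet> x) - k i * (q i \<bullet> x)\<^sup>2" for i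
    using norm_cross_dot[of "q i" x]
    by (simp add: power_mult_distrib dot_square_norm algebra_simps flip: distrib_left)
  have "x \<bullet> (Mbar N lm k *v x) = (1/2) * (trace (M_mat N lm k) * (x \<bullet> x) - x \<bullet> (M_mat N lm k *v x))"
    by (simp add: Mbar_def matrix_vector_mult_diff_rdistrib inner_diff_right
        flip: scaleR_matrix_vector_assoc)
  then show ?thesis
    unfolding q_def[symmetric] by (simp add: 1 2 3 sum_subtractf sum_distrib_right)
qed

text \<open>If the form vanished at \<open>x\<close>, every deviation from the centroid would be
  parallel to \<open>x\<close>, and all landmarks would lie on one line.\<close>

lemma Mbar_positive:
  assumes k: "\<forall>i\<in>{1..N}. 0 < k i"
    and nc: "\<exists>i\<in>{1..N}. \<exists>j\<in>{1..N}. \<exists>l\<in>{1..N}. \<not> collinear {lm i, lm j, lm l}"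
    and "x \<noteq> 0"
  shows "0 < x \<bullet> (Mbar N lm k *v x)"
proof -
  define q where "q i = lm i - centroid N lm k" for i
  have nn: "0 \<le> k i * (norm (cross3 (q i) x))\<^sup>2" if "i \<in> {1..N}" for i
    using k that by (intro mult_nonneg_nonneg) (auto intro: less_imp_le)
  have "(\<Sum>i=1..N. k i * (norm (cross3 (q i) x))\<^sup>2) \<noteq> 0"
  proof
    assume "(\<Sum>i=1..N. k i * (norm (cross3 (q i) x))\<^sup>2) = 0"
    then have "cross3 (q i) x = 0" if "i \<in> {1..N}" for i
      using nn that k by (subst (asm) sum_nonneg_eq_0_iff) force+
    then have "\<exists>c. q i = c *\<^sub>R x" if "i \<in> {1..N}" for i
      using that \<open>x \<noteq> 0\<close> cross_eq_0[of "q i" x] collinear_lemma[of x "q i"]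
      by (metis insert_commute scaleR_zero_left)
    then obtain c where c: "\<And>i. i \<in> {1..N} \<Longrightarrow> q i = c i *\<^sub>R x" by metis
    have "lm i - lm j = (c i - c j) *\<^sub>R x" if "i \<in> {1..N}" "j \<in> {1..N}" for i j
    proof -
      have "lm i - lm j = q i - q j" by (simp add: q_def)
      then show ?thesis by (simp add: c[OF that(1)] c[OF that(2)] scaleR_diff_left)
    qed
    then have "collinear (lm ` {1..N})" unfolding collinear_def by blast
    moreover obtain i j l where ijl: "i \<in> {1..N}" "j \<in> {1..N}" "l \<in> {1..N}" "\<not> collinear {lm i, lm j, lm l}"
      using nc by auto
    moreover have "{lm i, lm j, lm l} \<subseteq> lm ` {1..N}" using ijl by blast
    ultimately show False using collinear_subset by blast
  qed
  moreover have "0 \<le> (\<Sum>i=1..N. k i * (norm (cross3 (q i) x))\<^sup>2)"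
    by (intro sum_nonneg nn)
  ultimately show ?thesis unfolding Mbar_quadratic_form q_def by linarith
qed

section \<open>Rotations of three-dimensional space\<close>

text \<open>The columns of a rotation are the images of a right-handed frame and form one
  themselves; entry by entry, this says that \<open>R\<close> is its own cofactor matrix.\<close>

lemma rotation_matrix_cofactors:
  fixes R :: "real^3^3"
  assumes "rotation_matrix R"
  shows "R$1$1 = R$2$2 * R$3$3 - R$2$3 * R$3$2" "R$2$2 = R$1$1 * R$3$3 - R$1$3 * R$3$1"
    "R$3$3 = R$1$1 * R$2$2 - R$1$2 * R$2$1"
    "R$1$2 = R$2$3 * R$3$1 - R$2$1 * R$3$3" "R$2$1 = R$1$3 * R$3$2 - R$1$2 * R$3$3"
    "R$2$3 = R$3$1 * R$1$2 - R$3$2 * R$1$1" "R$3$2 = R$2$1 * R$1$3 - R$2$3 * R$1$1"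
    "R$3$1 = R$1$2 * R$2$3 - R$1$3 * R$2$2" "R$1$3 = R$3$2 * R$2$1 - R$3$1 * R$2$2"
proof -
  have col: "R *v axis i 1 = (\<chi> j. R $ j $ i)" for i
    by (simp add: matrix_vector_mult_def axis_def vec_eq_iff if_distrib cong: if_cong)
  have e: "cross3 (\<chi> j. R $ j $ 1) (\<chi> j. R $ j $ 2) = (\<chi> j. R $ j $ 3)"
    "cross3 (\<chi> j. R $ j $ 2) (\<chi> j. R $ j $ 3) = (\<chi> j. R $ j $ 1)"
    "cross3 (\<chi> j. R $ j $ 3) (\<chi> j. R $ j $ 1) = (\<chi> j. R $ j $ 2)"
    unfolding col[symmetric] cross_rotation_matrix[OF assms] cross_basis by simp_all
  show "R$1$1 = R$2$2 * R$3$3 - R$2$3 * R$3$2" "R$2$2 = R$1$1 * R$3$3 - R$1$3 * R$3$1"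
    "R$3$3 = R$1$1 * R$2$2 - R$1$2 * R$2$1"
    "R$1$2 = R$2$3 * R$3$1 - R$2$1 * R$3$3" "R$2$1 = R$1$3 * R$3$2 - R$1$2 * R$3$3"
    "R$2$3 = R$3$1 * R$1$2 - R$3$2 * R$1$1" "R$3$2 = R$2$1 * R$1$3 - R$2$3 * R$1$1"
    "R$3$1 = R$1$2 * R$2$3 - R$1$3 * R$2$2" "R$1$3 = R$3$2 * R$2$1 - R$3$1 * R$2$2"
    using e by (simp_all add: vec_eq_iff forall_3 cross_components mult.commute)
qed

lemma orthogonal_matrix_rows:
  assumes "orthogonal_matrix (R::real^3^3)"
  shows "R$i$1 * R$j$1 + R$i$2 * R$j$2 + R$i$3 * R$j$3 = (if i = j then 1 else 0)"
proof -
  have "(R ** transpose R) $ i $ j = (mat 1 :: real^3^3) $ i $ j"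
    using assms by (simp add: orthogonal_matrix_def)
  then show ?thesis by (simp add: matrix_matrix_mult_def transpose_def mat_def sum_3)
qed

text \<open>
  By the Cayley--Hamilton theorem \<open>R\<^sup>2 = (tr R) R - (tr R) I + R\<^sup>T\<close>, so that the symmetric part of
  a rotation is determined by its skew-symmetric part; here this is checked entrywise.
\<close>

lemma rotation_matrix_symmetric_part:
  assumes R: "rotation_matrix R"
  shows "(1 + trace R) *\<^sub>R (R + transpose R - 2 *\<^sub>R mat 1) = 4 *\<^sub>R (skew (psi R) ** skew (psi R))"
proof -
  have o: "orthogonal_matrix R" "orthogonal_matrix (transpose R)"
    using R by (auto simp: rotation_matrix_def)
  note rows = orthogonal_matrix_rows[OF o(1)]
  have cols: "R$1$i * R$1$j + R$2$i * R$2$j + R$3$i * R$3$j = (if i = j then 1 else 0)" for i j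
    using orthogonal_matrix_rows[OF o(2), of i j] by (simp add: transpose_def)
  note cof = rotation_matrix_cofactors[OF R]
  have cof': "R$1$1 = R$3$3 * R$2$2 - R$3$2 * R$2$3" "R$2$2 = R$3$3 * R$1$1 - R$3$1 * R$1$3"
    "R$3$3 = R$2$2 * R$1$1 - R$2$1 * R$1$2"
    by (simp only: cof(1) mult.commute, simp only: cof(2) mult.commute, simp only: cof(3) mult.commute)
  \<comment> \<open>One diagonal and one off-diagonal entry are settled as polynomial identities in
    plain reals; cyclic permutation of the indices 1, 2, 3 gives the remaining entries.\<close>
  have diag: "(1 + (a + e + i)) * (2 * a - 2) = - ((c - g)\<^sup>2 + (d - b)\<^sup>2)"
    if "a * a + b * b + c * c = 1" "a * a + d * d + g * g = 1" "e = a * i - c * g" "i = a * e - b * d"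
    for a b c d e g i :: real
    using that by algebra
  have off: "(1 + (a + e + i)) * (b + d) = (h - f) * (c - g)"
    if "a * d + b * e + c * f = 0" "a * b + d * e + g * h = 0" "b = f * g - d * i" "d = c * h - b * i"
    for a b c d e f g h i :: real
    using that by algebra
  have d1: "(1 + (R$1$1 + R$2$2 + R$3$3)) * (2 * R$1$1 - 2) = - ((R$1$3 - R$3$1)\<^sup>2 + (R$2$1 - R$1$2)\<^sup>2)"
    by (rule diag; use rows[of 1 1, simplified] cols[of 1 1, simplified] cof(2,3) in linarith)
  have d2: "(1 + (R$2$2 + R$3$3 + R$1$1)) * (2 * R$2$2 - 2) = - ((R$2$1 - R$1$2)\<^sup>2 + (R$3$2 - R$2$3)\<^sup>2)"
    by (rule diag; use rows[of 2 2, simplified] cols[of 2 2, simplified] cof(1) cof'(3) in linarith)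
  have d3: "(1 + (R$3$3 + R$1$1 + R$2$2)) * (2 * R$3$3 - 2) = - ((R$3$2 - R$2$3)\<^sup>2 + (R$1$3 - R$3$1)\<^sup>2)"
    by (rule diag; use rows[of 3 3, simplified] cols[of 3 3, simplified] cof' in linarith)
  have f12: "(1 + (R$1$1 + R$2$2 + R$3$3)) * (R$1$2 + R$2$1) = (R$3$2 - R$2$3) * (R$1$3 - R$3$1)"
    by (rule off; use rows[of 1 2, simplified] cols[of 1 2, simplified] cof(4,5) in linarith)
  have f23: "(1 + (R$2$2 + R$3$3 + R$1$1)) * (R$2$3 + R$3$2) = (R$1$3 - R$3$1) * (R$2$1 - R$1$2)"
    by (rule off; use rows[of 2 3, simplified] cols[of 2 3, simplified] cof(6,7) in linarith)
  have f31: "(1 + (R$3$3 + R$1$1 + R$2$2)) * (R$3$1 + R$1$3) = (R$2$1 - R$1$2) * (R$3$2 - R$2$3)"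
    by (rule off; use rows[of 3 1, simplified] cols[of 3 1, simplified] cof(8,9) in linarith)
  show ?thesis
    using d1 d2 d3 f12 f23 f31
    by (simp add: vec_eq_iff forall_3 matrix_matrix_mult_def sum_3 transpose_def mat_def
        skew_component psi_component trace_def power2_eq_square field_simps)
qed

text \<open>Rodrigues' formula parametrised by \<open>psi R\<close> in place of an angle: for a
  rotation by \<theta> about a unit axis n, \<open>w\<close> is sin \<theta> n and 2 / (1 + tr R) is
  1 / (1 + cos \<theta>). The second fact is |w|^2 = (sin \<theta>)^2; positivity of 1 + tr R
  excludes straight angles.\<close>

lemma rotation_matrix_rodrigues:
  assumes R: "rotation_matrix R" and t: "0 < 1 + trace R"
  defines "w \<equiv> psi R"
  shows "R = mat 1 + skew w + (2 / (1 + trace R)) *\<^sub>R (skew w ** skew w)"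
    and "(norm w)\<^sup>2 = (1 + trace R) * (3 - trace R) / 4"
proof -
  have sym: "(1 + trace R) *\<^sub>R (R + transpose R - 2 *\<^sub>R mat 1) = 4 *\<^sub>R (skew w ** skew w)"
    unfolding w_def by (rule rotation_matrix_symmetric_part[OF R])
  have "R + transpose R - 2 *\<^sub>R mat 1 = (1 / (1 + trace R)) *\<^sub>R ((1 + trace R) *\<^sub>R (R + transpose R - 2 *\<^sub>R mat 1))"
    using t by simp
  also have "\<dots> = (4 / (1 + trace R)) *\<^sub>R (skew w ** skew w)" unfolding sym by simp
  finally have s: "R + transpose R - 2 *\<^sub>R mat 1 = (4 / (1 + trace R)) *\<^sub>R (skew w ** skew w)" .
  have k: "R - transpose R = 2 *\<^sub>R skew w"
    by (simp add: w_def vec_eq_iff forall_3 transpose_def skew_component psi_component field_simps)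
  have "2 *\<^sub>R R = 2 *\<^sub>R mat 1 + (R - transpose R) + (R + transpose R - 2 *\<^sub>R mat 1)"
    by (simp add: scaleR_2)
  then have "2 *\<^sub>R R = 2 *\<^sub>R mat 1 + 2 *\<^sub>R skew w + (4 / (1 + trace R)) *\<^sub>R (skew w ** skew w)"
    unfolding s k .
  then have "(1/2) *\<^sub>R (2 *\<^sub>R R) = (1/2) *\<^sub>R (2 *\<^sub>R mat 1 + 2 *\<^sub>R skew w + (4 / (1 + trace R)) *\<^sub>R (skew w ** skew w))"
    by simp
  then show "R = mat 1 + skew w + (2 / (1 + trace R)) *\<^sub>R (skew w ** skew w)"
    by (simp add: scaleR_add_right)
  have "trace ((1 + trace R) *\<^sub>R (R + transpose R - 2 *\<^sub>R mat 1)) = (1 + trace R) * (2 * trace R - 6)"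
    by (simp add: trace_def sum_3 transpose_def mat_def algebra_simps)
  moreover have "trace (4 *\<^sub>R (skew w ** skew w)) = - 8 * (norm w)\<^sup>2"
    by (simp add: trace_def sum_3 matrix_matrix_mult_def skew_component power2_norm_eq_inner inner_vec_def)
  ultimately show "(norm w)\<^sup>2 = (1 + trace R) * (3 - trace R) / 4"
    using sym by (simp add: algebra_simps)
qed

lemma rot_dist_square:
  assumes "rotation_matrix R"
  shows "(rot_dist R)\<^sup>2 = (3 - trace R) / 4"
  using rotation_matrix_trace_le[OF assms] by (simp add: rot_dist_def trace_sub trace_I)

lemma rot_dist_nonneg: "rotation_matrix R \<Longrightarrow> 0 \<le> rot_dist R"
  using rotation_matrix_trace_le[of R] by (simp add: rot_dist_def trace_sub trace_I)

lemma norm_rotation_matrix_diff_mat_1: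
  assumes "rotation_matrix R"
  shows "norm (R - mat 1) = sqrt 8 * rot_dist R"
proof -
  have o: "orthogonal_matrix R" using assms by (simp add: rotation_matrix_def)
  note orthogonal_matrix_rows[OF o, of 1 1] orthogonal_matrix_rows[OF o, of 2 2] orthogonal_matrix_rows[OF o, of 3 3]
  then have "(norm (R - mat 1))\<^sup>2 = (sqrt 8 * rot_dist R)\<^sup>2"
    by (simp add: power_mult_distrib rot_dist_square[OF assms] power2_norm_eq_inner inner_vec_def
        sum_3 mat_def trace_def algebra_simps)
  then show ?thesis by (rule power2_eq_imp_eq) (simp_all add: rot_dist_nonneg[OF assms])
qed

text \<open>Up to the factor sqrt 8, \<open>rot_dist\<close> is the Frobenius distance to the
  identity and inherits its triangle inequality; 1 / sqrt 8 is rounded up to 1/2.\<close>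

lemma rot_dist_le_rot_dist_add:
  assumes "rotation_matrix R" "rotation_matrix R'"
  shows "rot_dist R' \<le> rot_dist R + norm (R' - R) / 2"
proof -
  have "norm (R' - mat 1) \<le> norm (R - mat 1) + norm (R' - R)"
    using norm_triangle_ineq[of "R - mat 1" "R' - R"] by simp
  then have "sqrt 8 * rot_dist R' \<le> sqrt 8 * rot_dist R + norm (R' - R)"
    by (simp add: norm_rotation_matrix_diff_mat_1 assms)
  also have "norm (R' - R) \<le> sqrt 8 * (norm (R' - R) / 2)"
  proof -
    have "2 \<le> sqrt 8" by (rule real_le_rsqrt) simp
    then have "2 * (norm (R' - R) / 2) \<le> sqrt 8 * (norm (R' - R) / 2)"
      by (rule mult_right_mono) simp
    then show ?thesis by simp
  qed
  finally have "sqrt 8 * rot_dist R' \<le> sqrt 8 * (rot_dist R + norm (R' - R) / 2)"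
    by (simp only: distrib_left)
  then show ?thesis by simp
qed

context
  fixes M :: "real^3^3"
  assumes symM: "transpose M = M"
begin

private abbreviation "Mb \<equiv> (1/2) *\<^sub>R (trace M *\<^sub>R mat 1 - M)"

lemma symmetric_entries: "M$2$1 = M$1$2" "M$3$1 = M$1$3" "M$3$2 = M$2$3"
proof -
  have "M $ i $ j = M $ j $ i" for i j
    using arg_cong[OF symM, of "\<lambda>A. A $ j $ i"] by (simp only: transpose_def vec_lambda_beta)
  then show "M$2$1 = M$1$2" "M$3$1 = M$1$3" "M$3$2 = M$2$3" by blast+
qed

text \<open>The origin of \<open>Mbar\<close>: it represents \<open>psi\<close> and the trace of
  \<open>M\<close> times the powers of \<open>skew w\<close>. Together with Rodrigues' formula this
  makes the potential and its gradient explicit in \<open>w\<close>.\<close>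

lemma psi_mult_skew:
  "psi M = 0" "psi (M ** skew w) = Mb *v w" "psi (M ** (skew w ** skew w)) = - cross3 w (Mb *v w)"
  by (simp_all add: vec_eq_iff forall_3 psi_component symmetric_entries matrix_matrix_mult_def sum_3
      skew_component matrix_vector_mult_def trace_def mat_def cross_components field_simps)

lemma trace_mult_skew:
  "trace (M ** skew w) = 0" "trace (M ** (skew w ** skew w)) = - 2 * (w \<bullet> (Mb *v w))"
  by (simp_all add: symmetric_entries matrix_matrix_mult_def sum_3 inner_vec_def
      skew_component matrix_vector_mult_def trace_def mat_def field_simps)

text \<open>With w = psi R and d = rot_dist R, the potential is 2 q (w . Mb w) where 2 q |w|^2 = 4
  d^2. Further psi (M R) = m - q (w x m) with m = Mb w; the two terms are orthogonal, so its norm is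
  at least |m|, which is at least l |w|, and |w|^2 = 4 d^2 (1 - d^2). The factor 1 - d^2 is the loss
  of gradient near a straight angle.\<close>

lemma attitude_potential_bounds:
  assumes R: "rotation_matrix R" and d: "rot_dist R < 1"
    and lo: "\<And>x. l * (x \<bullet> x) \<le> x \<bullet> (Mb *v x)" and up: "\<And>x. x \<bullet> (Mb *v x) \<le> L * (x \<bullet> x)" and "0 < l"
  shows "4 * l * (rot_dist R)\<^sup>2 \<le> trace (M ** (mat 1 - R))"
    and "trace (M ** (mat 1 - R)) \<le> 4 * L * (rot_dist R)\<^sup>2"
    and "4 * l\<^sup>2 * (rot_dist R)\<^sup>2 * (1 - (rot_dist R)\<^sup>2) \<le> (norm (psi (M ** R)))\<^sup>2"
proof -
  define t where "t = trace R"
  define w where "w = psi R"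
  define q where "q = 2 / (1 + t)"
  have rd: "(rot_dist R)\<^sup>2 = (3 - t) / 4" using rot_dist_square[OF R] by (simp add: t_def)
  have "(rot_dist R)\<^sup>2 < 1" using d rot_dist_nonneg[OF R] by (simp add: abs_square_less_1)
  then have t: "1 + t > 0" using rd by simp
  have Req: "R = mat 1 + skew w + q *\<^sub>R (skew w ** skew w)" and ww: "w \<bullet> w = (1 + t) * (3 - t) / 4"
    using rotation_matrix_rodrigues[OF R] t unfolding t_def w_def q_def by (simp_all add: power2_norm_eq_inner)
  have q: "q \<ge> 0" using t by (simp add: q_def)
  have qw: "2 * q * (w \<bullet> w) = 4 * (rot_dist R)\<^sup>2" using t by (simp add: q_def ww rd)
  have lin: "linear (\<lambda>B. M ** B)" "linear psi" "linear (trace :: real^3^3 \<Rightarrow> real)"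
    using bounded_linear.linear[OF bounded_bilinear.bounded_linear_right[OF bounded_bilinear_matrix_matrix_mult]]
      bounded_linear.linear[OF bounded_linear_psi] bounded_linear.linear[OF bounded_linear_trace] by auto
  have MR: "M ** R = M + M ** skew w + q *\<^sub>R (M ** (skew w ** skew w))"
    by (subst Req) (simp add: linear_add[OF lin(1)] linear_scale[OF lin(1)])
  have "trace (M ** (mat 1 - R)) = trace M - trace (M ** R)"
    by (simp add: linear_diff[OF lin(1)] linear_diff[OF lin(3)])
  also have "\<dots> = 2 * q * (w \<bullet> (Mb *v w))"
    by (simp add: MR linear_add[OF lin(3)] linear_scale[OF lin(3)] trace_mult_skew)
  finally have U: "trace (M ** (mat 1 - R)) = 2 * q * (w \<bullet> (Mb *v w))" .
  have "2 * q * (l * (w \<bullet> w)) \<le> 2 * q * (w \<bullet> (Mb *v w))"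
    using lo[of w] q by (intro mult_left_mono) auto
  moreover have "2 * q * (l * (w \<bullet> w)) = 4 * l * (rot_dist R)\<^sup>2"
  proof -
    have "2 * q * (l * (w \<bullet> w)) = l * (2 * q * (w \<bullet> w))" by simp
    also have "\<dots> = l * (4 * (rot_dist R)\<^sup>2)" by (simp only: qw)
    finally show ?thesis by simp
  qed
  ultimately show "4 * l * (rot_dist R)\<^sup>2 \<le> trace (M ** (mat 1 - R))"
    unfolding U by linarith
  have "2 * q * (w \<bullet> (Mb *v w)) \<le> 2 * q * (L * (w \<bullet> w))"
    using up[of w] q by (intro mult_left_mono) auto
  moreover have "2 * q * (L * (w \<bullet> w)) = 4 * L * (rot_dist R)\<^sup>2"
  proof -
    have "2 * q * (L * (w \<bullet> w)) = L * (2 * q * (w \<bullet> w))" by simp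
    also have "\<dots> = L * (4 * (rot_dist R)\<^sup>2)" by (simp only: qw)
    finally show ?thesis by simp
  qed
  ultimately show "trace (M ** (mat 1 - R)) \<le> 4 * L * (rot_dist R)\<^sup>2"
    unfolding U by linarith
  define m where "m = Mb *v w"
  have "psi (M ** R) = m - q *\<^sub>R cross3 w m"
    by (simp add: MR linear_add[OF lin(2)] linear_scale[OF lin(2)] psi_mult_skew m_def)
  moreover have "m \<bullet> cross3 w m = 0" by (simp add: dot_cross_self)
  ultimately have "(norm (psi (M ** R)))\<^sup>2 = m \<bullet> m + q * q * (cross3 w m \<bullet> cross3 w m)"
    by (simp add: power2_norm_eq_inner inner_diff_left inner_diff_right inner_commute[of "cross3 w m" m])
  moreover have "0 \<le> q * q * (cross3 w m \<bullet> cross3 w m)" by simp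
  ultimately have 1: "m \<bullet> m \<le> (norm (psi (M ** R)))\<^sup>2" by linarith
  have "l * (w \<bullet> w) \<le> norm w * norm m"
    using lo[of w] norm_cauchy_schwarz[of w m] by (simp add: m_def)
  then have "norm w * (l * norm w) \<le> norm w * norm m" by (simp add: dot_square_norm power2_eq_square mult_ac)
  then have "l * norm w \<le> norm m"
    by (cases "w = 0") (simp, metis mult_left_le_imp_le zero_less_norm_iff)
  then have "(l * norm w)\<^sup>2 \<le> (norm m)\<^sup>2" using \<open>0 < l\<close> by (intro power_mono) auto
  then have "l\<^sup>2 * (w \<bullet> w) \<le> m \<bullet> m" by (simp add: power_mult_distrib power2_norm_eq_inner)
  moreover have "4 * (rot_dist R)\<^sup>2 * (1 - (rot_dist R)\<^sup>2) = w \<bullet> w"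
    by (simp add: rd ww field_simps)
  then have "4 * l\<^sup>2 * (rot_dist R)\<^sup>2 * (1 - (rot_dist R)\<^sup>2) = l\<^sup>2 * (w \<bullet> w)"
    by (metis mult.assoc mult.left_commute)
  ultimately show "4 * l\<^sup>2 * (rot_dist R)\<^sup>2 * (1 - (rot_dist R)\<^sup>2) \<le> (norm (psi (M ** R)))\<^sup>2"
    using 1 by linarith
qed

end

section \<open>Block vectors\<close>

definition blk :: "3 \<Rightarrow> vec9 \<Rightarrow> real^3" where
  "blk b x = (\<chi> i. x $ (b, i))"

abbreviation join3 :: "real^3 \<Rightarrow> real^3 \<Rightarrow> real^3 \<Rightarrow> vec9" where
  "join3 a b c \<equiv> stack (vector [a, b, c])"

lemma sum_UNIV_33: "(\<Sum>r\<in>(UNIV::(3\<times>3) set). f r) = (\<Sum>b\<in>UNIV. \<Sum>i\<in>UNIV. f (b, i))"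
  by (simp add: sum.cartesian_product flip: UNIV_Times_UNIV)

lemma blk_eq_iff: "x = y \<longleftrightarrow> blk 1 x = blk 1 y \<and> blk 2 x = blk 2 y \<and> blk 3 x = blk 3 y"
  by (simp add: blk_def vec_eq_iff split_paired_all forall_3 Ball_def)

lemma blk_join3 [simp]: "blk 1 (join3 a b c) = a" "blk 2 (join3 a b c) = b" "blk 3 (join3 a b c) = c"
  by (simp_all add: blk_def stack_def vec_eq_iff)

lemma join3_blk [simp]: "join3 (blk 1 x) (blk 2 x) (blk 3 x) = x"
  by (simp add: blk_eq_iff[of _ x])

lemma bounded_linear_blk: "bounded_linear (blk b)"
  unfolding linear_conv_bounded_linear[symmetric]
  by (auto intro!: linearI simp: blk_def vec_eq_iff)

lemmas blk_linear_simps = linear_add[OF bounded_linear.linear[OF bounded_linear_blk]]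
  linear_diff[OF bounded_linear.linear[OF bounded_linear_blk]]
  linear_scale[OF bounded_linear.linear[OF bounded_linear_blk]]
  linear_neg[OF bounded_linear.linear[OF bounded_linear_blk]]
  linear_0[OF bounded_linear.linear[OF bounded_linear_blk]]

lemma inner_blk: "x \<bullet> y = blk 1 x \<bullet> blk 1 y + blk 2 x \<bullet> blk 2 y + blk 3 x \<bullet> blk 3 y"
  by (simp add: inner_vec_def sum_UNIV_33 blk_def sum_3)

lemma norm_blk_le: "norm (blk b x) \<le> norm x"
proof -
  have "(norm (blk b x))\<^sup>2 \<le> (norm x)\<^sup>2"
    using exhaust_3[of b] by (auto simp: power2_norm_eq_inner inner_blk[of x])
  then show ?thesis by (rule power2_le_imp_le) simp
qed

lemma norm_join3_le: "norm (join3 a b c) \<le> norm a + norm b + norm c"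
proof -
  have "(norm (join3 a b c))\<^sup>2 = (norm a)\<^sup>2 + (norm b)\<^sup>2 + (norm c)\<^sup>2"
    by (simp add: power2_norm_eq_inner inner_blk)
  also have "\<dots> \<le> (norm a + norm b + norm c)\<^sup>2"
    by (simp add: power2_eq_square algebra_simps)
  finally show ?thesis by (rule power2_le_imp_le) simp
qed

lemma bounded_linear_join3: "bounded_linear (\<lambda>(a, b, c). join3 a b c)"
  unfolding linear_conv_bounded_linear[symmetric]
  by (auto intro!: linearI simp: blk_eq_iff blk_linear_simps)

lemma has_vector_derivative_join3:
  assumes "(a has_vector_derivative a') (at t within S)" "(b has_vector_derivative b') (at t within S)"
    "(c has_vector_derivative c') (at t within S)"
  shows "((\<lambda>t. join3 (a t) (b t) (c t)) has_vector_derivative join3 a' b' c') (at t within S)"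
  using bounded_linear.has_vector_derivative[OF bounded_linear_join3
      has_vector_derivative_Pair[OF assms(1) has_vector_derivative_Pair[OF assms(2,3)]]] by simp

lemma blk_block_matrix:
  "blk b (block_matrix B *v x) = (\<Sum>c\<in>UNIV. B $ b $ c *v blk c x)"
  by (simp add: blk_def block_matrix_def vec_eq_iff matrix_vector_mult_def sum_UNIV_33)

lemma blk_A_mat:
  "blk 1 (A_mat w *v x) = blk 2 x - cross3 w (blk 1 x)"
  "blk 2 (A_mat w *v x) = blk 3 x - cross3 w (blk 2 x)"
  "blk 3 (A_mat w *v x) = - cross3 w (blk 3 x)"
proof -
  have minus: "(- skew w) *v u = - cross3 w u" for u
    using skew_mult_vec[of "- w" u] by (simp add: skew_minus)
  show "blk 1 (A_mat w *v x) = blk 2 x - cross3 w (blk 1 x)"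
    "blk 2 (A_mat w *v x) = blk 3 x - cross3 w (blk 2 x)"
    "blk 3 (A_mat w *v x) = - cross3 w (blk 3 x)"
    by (simp_all add: A_mat_def blk_block_matrix sum_3 minus)
qed

text \<open>Read off from the pairing with \<open>A_mat\<close>. The chain runs the other way than
  for \<open>A_mat\<close>: block 1 drives block 2, which drives block 3. Since
  \<open>transpose C_mat\<close> writes into block 1, corrections reach every block.\<close>

lemma blk_transpose_A_mat:
  "blk 1 (transpose (A_mat w) *v y) = cross3 w (blk 1 y)"
  "blk 2 (transpose (A_mat w) *v y) = blk 1 y + cross3 w (blk 2 y)"
  "blk 3 (transpose (A_mat w) *v y) = blk 2 y + cross3 w (blk 3 y)"
proof -
  have cyc: "u \<bullet> cross3 w v = - (cross3 w u \<bullet> v)" for u v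
    by (metis cross_triple cross_skew inner_commute inner_minus_right)
  have "(transpose (A_mat w) *v y) \<bullet> x =
      join3 (cross3 w (blk 1 y)) (blk 1 y + cross3 w (blk 2 y)) (blk 2 y + cross3 w (blk 3 y)) \<bullet> x" for x
    unfolding inner_matrix_vector_mult[symmetric]
    by (simp add: inner_blk[of _ x] inner_blk[of _ "A_mat w *v x"] blk_A_mat inner_diff_right inner_add_left cyc)
  then have "transpose (A_mat w) *v y = join3 (cross3 w (blk 1 y)) (blk 1 y + cross3 w (blk 2 y)) (blk 2 y + cross3 w (blk 3 y))"
    by (metis vector_eq_rdot)
  then show "blk 1 (transpose (A_mat w) *v y) = cross3 w (blk 1 y)"
    "blk 2 (transpose (A_mat w) *v y) = blk 1 y + cross3 w (blk 2 y)"
    "blk 3 (transpose (A_mat w) *v y) = blk 2 y + cross3 w (blk 3 y)"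
    by simp_all
qed

lemma C_mat_mult_vec: "C_mat *v x = blk 1 x"
  by (simp add: C_mat_def block_row_def blk_def vec_eq_iff matrix_vector_mult_def sum_UNIV_33 sum_3
      mat_def forall_3)

lemma transpose_C_mat_mult_vec: "transpose C_mat *v u = join3 u 0 0"
proof -
  have "(transpose C_mat *v u) \<bullet> x = join3 u 0 0 \<bullet> x" for x
    unfolding inner_matrix_vector_mult[symmetric] by (simp add: C_mat_mult_vec inner_blk[of _ x])
  then show ?thesis by (metis vector_eq_rdot)
qed

text \<open>The identity blocks make \<open>A_mat\<close> affine rather than linear in the angular
  velocity; subtracting \<open>A_mat 0\<close> leaves a linear map, and continuity follows.\<close>

lemma linear_A_mat_diff: "linear (\<lambda>w. A_mat w - A_mat 0)"
proof (rule linearI)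
  have eqI: "A = B" if "\<And>x. A *v x = B *v x" for A B :: mat9
    using that by (simp add: matrix_eq)
  have add: "A_mat (v + w) + A_mat 0 = A_mat v + A_mat w" for v w
    by (rule eqI) (simp add: blk_eq_iff blk_linear_simps blk_A_mat matrix_vector_mult_add_rdistrib cross_add_left)
  have scale: "A_mat (r *\<^sub>R v) + r *\<^sub>R A_mat 0 = r *\<^sub>R A_mat v + A_mat 0" for r v
    by (rule eqI) (simp add: blk_eq_iff blk_linear_simps blk_A_mat cross_mult_left
        matrix_vector_mult_add_rdistrib scaleR_diff_left scaleR_diff_right flip: scaleR_matrix_vector_assoc)
  show "A_mat (v + w) - A_mat 0 = (A_mat v - A_mat 0) + (A_mat w - A_mat 0)" for v w
  proof -
    have "A_mat (v + w) = A_mat v + A_mat w - A_mat 0" using add[of v w] by (simp add: eq_diff_eq)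
    then show ?thesis by simp
  qed
  show "A_mat (r *\<^sub>R v) - A_mat 0 = r *\<^sub>R (A_mat v - A_mat 0)" for r v
  proof -
    have "A_mat (r *\<^sub>R v) = r *\<^sub>R A_mat v + A_mat 0 - r *\<^sub>R A_mat 0"
      using scale[of r v] by (simp add: eq_diff_eq)
    then show ?thesis by (simp add: scaleR_diff_right)
  qed
qed

lemma continuous_on_A_mat:
  assumes "continuous_on S f"
  shows "continuous_on S (\<lambda>t. A_mat (f t))"
proof -
  have "continuous_on S (\<lambda>t. (A_mat (f t) - A_mat 0) + A_mat 0)"
    using linear_conv_bounded_linear linear_A_mat_diff bounded_linear.continuous_on[OF _ assms]
    by (intro continuous_on_add continuous_on_const) blast
  then show ?thesis by simp
qed

section \<open>Hybrid time domains and solutions\<close>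

text \<open>Taken from the domain itself, as the sequence in \<open>hybrid_time_domain\<close> is an
  existential witness that is not determined beyond the last interval. For an index that does not
  occur the value carries no meaning.\<close>

definition entry_time :: "(real \<times> nat) set \<Rightarrow> nat \<Rightarrow> real" where
  "entry_time E j = Inf {t. (t, j) \<in> E}"

lemma hybrid_time_domain_props:
  assumes "hybrid_time_domain E"
  shows origin_in_hybrid_time_domain: "(0, 0) \<in> E"
    and entry_time_0: "entry_time E 0 = 0"
    and entry_time_le: "\<And>t j. (t, j) \<in> E \<Longrightarrow> entry_time E j \<le> t"
    and hybrid_time_domain_between: "\<And>t j r. (t, j) \<in> E \<Longrightarrow> entry_time E j \<le> r \<Longrightarrow> r \<le> t \<Longrightarrow> (r, j) \<in> E"
    and hybrid_time_domain_Suc: "\<And>t j. (t, Suc j) \<in> E \<Longrightarrow> (entry_time E (Suc j), j) \<in> E"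
    and convex_hybrid_time_domain: "\<And>j. convex {t. (t, j) \<in> E}"
proof -
  obtain s :: "nat \<Rightarrow> real" where s: "s 0 = 0" "incseq s" and
    E: "E = (\<Union>j. {s j..s (Suc j)} \<times> {j}) \<or>
         (\<exists>J L. (L = {s J..s (Suc J)} \<or> (\<exists>T>s J. L = {s J..<T}) \<or> L = {s J..}) \<and>
                E = (\<Union>j<J. {s j..s (Suc j)} \<times> {j}) \<union> L \<times> {J})"
    using assms unfolding hybrid_time_domain_def by blast
  have mono: "s i \<le> s (Suc i)" for i using s(2) by (simp add: incseq_SucD)
  have main: "(0,0) \<in> E \<and> (\<forall>t j. (t,j) \<in> E \<longrightarrow> s j \<le> t \<and> (\<forall>r\<in>{s j..t}. (r,j) \<in> E) \<and>
      (\<forall>i. j = Suc i \<longrightarrow> (s j, i) \<in> E)) \<and> (\<forall>j. convex {t. (t, j) \<in> E})"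
    using E
  proof
    assume E: "E = (\<Union>j. {s j..s (Suc j)} \<times> {j})"
    then have "{t. (t, j) \<in> E} = {s j..s (Suc j)}" for j by auto
    then show ?thesis using s mono mono[of 0] by (auto simp: E)
  next
    assume "\<exists>J L. (L = {s J..s (Suc J)} \<or> (\<exists>T>s J. L = {s J..<T}) \<or> L = {s J..}) \<and>
                E = (\<Union>j<J. {s j..s (Suc j)} \<times> {j}) \<union> L \<times> {J}"
    then obtain J L where L: "L = {s J..s (Suc J)} \<or> (\<exists>T>s J. L = {s J..<T}) \<or> L = {s J..}"
      and E: "E = (\<Union>j<J. {s j..s (Suc j)} \<times> {j}) \<union> L \<times> {J}" by blast
    have slice: "{t. (t, j) \<in> E} = (if j < J then {s j..s (Suc j)} else if j = J then L else {})" for j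
      by (auto simp: E)
    have mem: "(t, j) \<in> E \<longleftrightarrow> j < J \<and> t \<in> {s j..s (Suc j)} \<or> j = J \<and> t \<in> L" for t j
      by (auto simp: E)
    have L1: "s J \<le> t" "\<forall>r\<in>{s J..t}. r \<in> L" if "t \<in> L" for t using L that by auto
    have L2: "s J \<in> L" "convex L" using L mono by (auto simp: convex_real_interval)
    have "(0,0) \<in> E" using L2(1) s mono[of 0] by (cases J) (auto simp: mem)
    moreover have "convex {t. (t, j) \<in> E}" for j unfolding slice using L2(2) by auto
    moreover have "s j \<le> t \<and> (\<forall>r\<in>{s j..t}. (r,j) \<in> E) \<and> (\<forall>i. j = Suc i \<longrightarrow> (s j, i) \<in> E)"
      if "(t, j) \<in> E" for t j
    proof -
      have "j < J \<and> t \<in> {s j..s (Suc j)} \<or> j = J \<and> t \<in> L" using that by (simp add: mem)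
      then have "s j \<le> t" "j \<le> J" "\<forall>r\<in>{s j..t}. (r,j) \<in> E" using L1[of t] by (auto simp: mem)
      moreover have "(s j, i) \<in> E" if "j = Suc i" for i
        using that \<open>j \<le> J\<close> mono[of i] by (simp add: mem)
      ultimately show ?thesis by blast
    qed
    ultimately show ?thesis by blast
  qed
  note m = main[THEN conjunct2, THEN conjunct1, THEN spec, THEN spec, THEN mp]
  note m1 = m[THEN conjunct1]
  have m2: "(r, j) \<in> E" if "(t, j) \<in> E" "s j \<le> r" "r \<le> t" for t j r
    using m[OF that(1), THEN conjunct2, THEN conjunct1] that(2,3) by simp
  have m3: "(s (Suc i), i) \<in> E" if "(t, Suc i) \<in> E" for t i
    using m[OF that, THEN conjunct2, THEN conjunct2] by simp
  have entry: "entry_time E j = s j" if "(t, j) \<in> E" for t j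
    unfolding entry_time_def
  proof (rule cInf_eq_minimum)
    show "s j \<in> {t. (t, j) \<in> E}" using m2[OF that, of "s j"] m1[OF that] by simp
    show "\<And>x. x \<in> {t. (t, j) \<in> E} \<Longrightarrow> s j \<le> x" using m1 by simp
  qed
  show "(0, 0) \<in> E" "\<And>j. convex {t. (t, j) \<in> E}"
    using main[THEN conjunct1] main[THEN conjunct2, THEN conjunct2, THEN spec] by simp_all
  then show "entry_time E 0 = 0" using entry[of 0 0] s(1) by simp
  show "entry_time E j \<le> t" if "(t, j) \<in> E" for t j
    using entry[OF that] m1[OF that] by simp
  show "(r, j) \<in> E" if "(t, j) \<in> E" "entry_time E j \<le> r" "r \<le> t" for t j r
    using entry[OF that(1)] m2[OF that(1)] that by simp
  show "(entry_time E (Suc j), j) \<in> E" if "(t, Suc j) \<in> E" for t j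
    using entry[OF that] m3[OF that] by simp
qed

lemma entry_time_in_hybrid_time_domain:
  assumes "hybrid_time_domain E" "(t, j) \<in> E"
  shows "(entry_time E j, j) \<in> E"
  using hybrid_time_domain_between[OF assms] entry_time_le[OF assms] by auto

text \<open>The part of \<open>hybrid_solution\<close> that concerns a single interval of flow,
  isolated so that extensions can be checked one interval at a time.\<close>

definition hybrid_arc :: "'a::real_normed_vector hybrid_system \<Rightarrow> real set \<Rightarrow> (real \<Rightarrow> 'a) \<Rightarrow> bool" where
  "hybrid_arc H I f \<longleftrightarrow> locally_absolutely_continuous_on I f \<and> (\<forall>t\<in>interior I. f t \<in> flow_set H) \<and>
    (\<exists>Z. negligible Z \<and> (\<forall>t\<in>I - Z. (f has_vector_derivative flow_map H t (f t)) (at t within I)))"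

lemma hybrid_solutionI:
  assumes "hybrid_time_domain E" "z 0 0 \<in> flow_set H \<union> jump_set H"
    "\<And>j. hybrid_arc H {t. (t, j) \<in> E} (\<lambda>t. z t j)"
    "\<And>t j. (t, j) \<in> E \<Longrightarrow> (t, Suc j) \<in> E \<Longrightarrow> z t j \<in> jump_set H \<and> z t (Suc j) \<in> jump_map H t (z t j)"
  shows "hybrid_solution H E z"
  using assms unfolding hybrid_solution_def hybrid_arc_def Let_def by blast

lemma hybrid_solutionD:
  assumes "hybrid_solution H E z"
  shows "hybrid_time_domain E" "z 0 0 \<in> flow_set H \<union> jump_set H"
    "\<And>j. hybrid_arc H {t. (t, j) \<in> E} (\<lambda>t. z t j)"
    "\<And>t j. (t, j) \<in> E \<Longrightarrow> (t, Suc j) \<in> E \<Longrightarrow> z t j \<in> jump_set H \<and> z t (Suc j) \<in> jump_map H t (z t j)"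
  using assms unfolding hybrid_solution_def hybrid_arc_def Let_def by blast+

text \<open>The differential equation holds almost everywhere by definition; continuity of the
  right-hand side along the arc upgrades this to every point of a closed interval of flow, endpoints
  included.\<close>

lemma hybrid_solution_flow:
  fixes H :: "'a::euclidean_space hybrid_system"
  assumes sol: "hybrid_solution H E z" and ab: "{a..b} \<times> {j} \<subseteq> E" "a \<le> b"
  shows hybrid_solution_continuous: "continuous_on {a..b} (\<lambda>t. z t j)"
    and hybrid_solution_derivative: "continuous_on {a..b} (\<lambda>t. flow_map H t (z t j)) \<Longrightarrow> t \<in> {a..b} \<Longrightarrow>
      ((\<lambda>t. z t j) has_vector_derivative flow_map H t (z t j)) (at t within {a..b})"
    and hybrid_solution_flow_set: "t \<in> {a<..<b} \<Longrightarrow> z t j \<in> flow_set H"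
proof -
  define I where "I = {t. (t, j) \<in> E}"
  have sub: "{a..b} \<subseteq> I" using ab(1) by (auto simp: I_def)
  have lac: "locally_absolutely_continuous_on I (\<lambda>t. z t j)" and int: "\<forall>t\<in>interior I. z t j \<in> flow_set H"
    and "\<exists>Z. negligible Z \<and> (\<forall>t\<in>I - Z. ((\<lambda>t. z t j) has_vector_derivative flow_map H t (z t j)) (at t within I))"
    using hybrid_solutionD(3)[OF sol, of j] unfolding hybrid_arc_def I_def by blast+
  then obtain Z where Z: "negligible Z"
    "\<And>t. t \<in> I - Z \<Longrightarrow> ((\<lambda>t. z t j) has_vector_derivative flow_map H t (z t j)) (at t within I)"
    by blast
  have ac: "absolutely_continuous_on a b (\<lambda>t. z t j)"
    using lac sub ab(2) by (auto simp: locally_absolutely_continuous_on_def)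
  then show "continuous_on {a..b} (\<lambda>t. z t j)" by (rule absolutely_continuous_on_imp_continuous_on)
  show "((\<lambda>t. z t j) has_vector_derivative flow_map H t (z t j)) (at t within {a..b})"
    if "continuous_on {a..b} (\<lambda>t. flow_map H t (z t j))" "t \<in> {a..b}"
    using sub by (intro absolutely_continuous_on_imp_derivative[OF ac Z(1) _ that]
        has_vector_derivative_within_subset[OF Z(2)]) auto
  show "z t j \<in> flow_set H" if "t \<in> {a<..<b}"
  proof -
    have "{a<..<b} \<subseteq> interior I" using sub by (intro interior_maximal) auto
    then show ?thesis using int that by auto
  qed
qed

section \<open>Solutions of the error system\<close>

lemma has_vector_derivative_components:
  assumes "((\<lambda>t. ((R t, \<eta> t, x t, \<tau> t), P t)) has_vector_derivative ((R', \<eta>', x', \<tau>'), P')) F"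
  shows "(R has_vector_derivative R') F" "(\<eta> has_vector_derivative \<eta>') F" "(x has_vector_derivative x') F"
    "(\<tau> has_vector_derivative \<tau>') F" "(P has_vector_derivative P') F"
proof -
  note f = bounded_linear.has_vector_derivative[OF bounded_linear_fst]
    and s = bounded_linear.has_vector_derivative[OF bounded_linear_snd]
  show "(P has_vector_derivative P') F" using s[OF assms] by simp
  have 1: "((\<lambda>t. (R t, \<eta> t, x t, \<tau> t)) has_vector_derivative (R', \<eta>', x', \<tau>')) F" using f[OF assms] by simp
  show "(R has_vector_derivative R') F" using f[OF 1] by simp
  have 2: "((\<lambda>t. (\<eta> t, x t, \<tau> t)) has_vector_derivative (\<eta>', x', \<tau>')) F" using s[OF 1] by simp
  show "(\<eta> has_vector_derivative \<eta>') F" using f[OF 2] by simp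
  have 3: "((\<lambda>t. (x t, \<tau> t)) has_vector_derivative (x', \<tau>')) F" using s[OF 2] by simp
  show "(x has_vector_derivative x') F" "(\<tau> has_vector_derivative \<tau>') F" using f[OF 3] s[OF 3] by simp_all
qed

lemma continuous_on_error_flow:
  assumes "continuous_on S z" "continuous_on S \<omega>" "continuous_on S V"
  shows "continuous_on S (\<lambda>t. error_flow \<omega> V t (z t))"
proof -
  have c: "continuous_on S (\<lambda>t. fst (fst (z t)))" "continuous_on S (\<lambda>t. fst (snd (fst (z t))))"
    "continuous_on S (\<lambda>t. fst (snd (snd (fst (z t)))))" "continuous_on S (\<lambda>t. snd (z t))"
    using assms(1) by (auto intro!: continuous_intros)
  have eq: "error_flow \<omega> V t (z t) = ((fst (fst (z t)) ** skew (- fst (snd (fst (z t)))), 0,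
      A_mat (\<omega> t) *v fst (snd (snd (fst (z t)))), -1), riccati_flow (\<omega> t) (V t) (snd (z t)))" for t
  proof -
    obtain q p where 1: "z t = (q, p)" by fastforce
    obtain a b c d where "q = (a, b, c, d)" using prod_cases4 by blast
    with 1 show ?thesis by simp
  qed
  have A: "continuous_on S (\<lambda>t. A_mat (\<omega> t))" by (rule continuous_on_A_mat[OF assms(2)])
  note mm = bounded_bilinear.continuous_on[OF bounded_bilinear_matrix_matrix_mult]
    and mv = bounded_bilinear.continuous_on[OF bounded_bilinear_matrix_vector_mult]
    and sk = bounded_linear.continuous_on[OF bounded_linear_skew]
    and tr = bounded_linear.continuous_on[OF bounded_linear_transpose]
  show ?thesis
    unfolding eq riccati_flow_def
    by (intro continuous_on_Pair continuous_on_add continuous_on_minus continuous_on_const mm mv sk tr A c assms)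
qed

text \<open>Names the components of a solution once and for all. \<open>P\<close> is one of them, so
  the gain at a jump is computed from the value just before that jump.\<close>

locale error_solution =
  fixes N :: nat and lm :: "nat \<Rightarrow> real^3" and k :: "nat \<Rightarrow> real" and kR Tm TM :: real
    and \<omega> :: "real \<Rightarrow> real^3" and V :: "real \<Rightarrow> mat9" and Q :: "real \<Rightarrow> real^3^3"
    and E R \<eta> x \<tau> P
  assumes Tm: "0 < Tm" "Tm \<le> TM"
    and cont_\<omega>: "continuous_on {0..} \<omega>" and cont_V: "continuous_on {0..} V"
    and sol: "hybrid_solution (error_system N lm k kR Tm TM \<omega> V Q) E
          (\<lambda>t j. ((R t j, \<eta> t j, x t j, \<tau> t j), P t j))"
begin

lemma domain: "hybrid_time_domain E"
  using sol by (simp add: hybrid_solution_def)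

abbreviation "en \<equiv> entry_time E"

lemmas between = hybrid_time_domain_between[OF domain]
  and en_le = entry_time_le[OF domain]
  and en_in = entry_time_in_hybrid_time_domain[OF domain]
  and en_Suc_in = hybrid_time_domain_Suc[OF domain]
  and en_0 = entry_time_0[OF domain]
  and origin = origin_in_hybrid_time_domain[OF domain]

lemma en_nonneg: "(t, j) \<in> E \<Longrightarrow> 0 \<le> en j"
proof (induction j arbitrary: t)
  case (Suc j)
  have "(en (Suc j), j) \<in> E" using en_Suc_in[OF Suc.prems] .
  then show ?case using Suc.IH[of "en (Suc j)"] en_le[of "en (Suc j)" j] by auto
qed (simp add: en_0)

lemma time_nonneg: "(t, j) \<in> E \<Longrightarrow> 0 \<le> t"
  using en_nonneg en_le by fastforce

lemma flow_derivatives: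
  assumes t: "(t, j) \<in> E" and r: "r \<in> {en j..t}"
  shows "((\<lambda>t. R t j) has_vector_derivative R r j ** skew (- \<eta> r j)) (at r within {en j..t})"
    and "((\<lambda>t. \<eta> t j) has_vector_derivative 0) (at r within {en j..t})"
    and "((\<lambda>t. x t j) has_vector_derivative A_mat (\<omega> r) *v x r j) (at r within {en j..t})"
    and "((\<lambda>t. \<tau> t j) has_vector_derivative - 1) (at r within {en j..t})"
    and "((\<lambda>t. P t j) has_vector_derivative riccati_flow (\<omega> r) (V r) (P r j)) (at r within {en j..t})"
proof -
  let ?z = "\<lambda>t. ((R t j, \<eta> t j, x t j, \<tau> t j), P t j)"
  have sub: "{en j..t} \<times> {j} \<subseteq> E" using between[OF t] by auto
  have pos: "{en j..t} \<subseteq> {0..}" using en_nonneg[OF t] by auto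
  have "continuous_on {en j..t} (\<lambda>t. error_flow \<omega> V t (?z t))"
    using cont_\<omega> cont_V pos
    by (intro continuous_on_error_flow hybrid_solution_continuous[OF sol sub en_le[OF t]])
      (auto intro: continuous_on_subset)
  then have "(?z has_vector_derivative error_flow \<omega> V r (?z r)) (at r within {en j..t})"
    using hybrid_solution_derivative[OF sol sub en_le[OF t] _ r] by (simp add: error_system_def)
  then have d: "(?z has_vector_derivative ((R r j ** skew (- \<eta> r j), 0, A_mat (\<omega> r) *v x r j, - 1),
      riccati_flow (\<omega> r) (V r) (P r j))) (at r within {en j..t})" by simp
  show "((\<lambda>t. R t j) has_vector_derivative R r j ** skew (- \<eta> r j)) (at r within {en j..t})"
    "((\<lambda>t. \<eta> t j) has_vector_derivative 0) (at r within {en j..t})"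
    "((\<lambda>t. x t j) has_vector_derivative A_mat (\<omega> r) *v x r j) (at r within {en j..t})"
    "((\<lambda>t. \<tau> t j) has_vector_derivative - 1) (at r within {en j..t})"
    "((\<lambda>t. P t j) has_vector_derivative riccati_flow (\<omega> r) (V r) (P r j)) (at r within {en j..t})"
    using has_vector_derivative_components[OF d] by simp_all
qed

lemma jump:
  assumes "(t, Suc j) \<in> E"
  defines "r \<equiv> en (Suc j)"
  shows "rotation_matrix (R r j)" "\<tau> r j = 0" "R r (Suc j) = R r j"
    "\<eta> r (Suc j) = kR *\<^sub>R psi (M_mat N lm k ** R r j)"
    "x r (Suc j) = (mat 1 - gain (P r j) (Q r) ** C_mat) *v x r j"
    "P r (Suc j) = riccati_jump (Q r) (P r j)"
    "\<tau> r (Suc j) \<in> {Tm..TM}"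
proof -
  have "(r, j) \<in> E" "(r, Suc j) \<in> E"
    using en_Suc_in[OF assms(1)] en_in[OF assms(1)] by (simp_all add: r_def)
  then show "rotation_matrix (R r j)" "\<tau> r j = 0" "R r (Suc j) = R r j"
    "\<eta> r (Suc j) = kR *\<^sub>R psi (M_mat N lm k ** R r j)"
    "x r (Suc j) = (mat 1 - gain (P r j) (Q r) ** C_mat) *v x r j"
    "P r (Suc j) = riccati_jump (Q r) (P r j)" "\<tau> r (Suc j) \<in> {Tm..TM}"
    using hybrid_solutionD(4)[OF sol, of r j] by (auto simp: error_system_def)
qed

text \<open>At entry the constraints come from the initial condition or from the jump, inside the
  interval from the flow set, and at its right end from continuity, since rotations and timer values
  form closed sets.\<close>

lemma state_constraints:
  assumes "(t, j) \<in> E"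
  shows "rotation_matrix (R t j) \<and> 0 \<le> \<tau> t j \<and> \<tau> t j \<le> TM"
proof -
  have entry: "rotation_matrix (R (en j) j) \<and> 0 \<le> \<tau> (en j) j \<and> \<tau> (en j) j \<le> TM"
  proof (cases j)
    case 0
    have "((R 0 0, \<eta> 0 0, x 0 0, \<tau> 0 0), P 0 0) \<in> flow_set (error_system N lm k kR Tm TM \<omega> V Q) \<union>
        jump_set (error_system N lm k kR Tm TM \<omega> V Q)"
      using hybrid_solutionD(2)[OF sol] by simp
    then show ?thesis using Tm by (auto simp: 0 en_0 error_system_def)
  next
    case (Suc i)
    then show ?thesis using jump[of t i] assms Tm by auto
  qed
  show ?thesis
  proof (cases "t = en j")
    case False
    then have lt: "en j < t" using en_le[OF assms] by simp
    have sub: "{en j..t} \<times> {j} \<subseteq> E" using between[OF assms] by auto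
    have fl: "(R r j, \<tau> r j) \<in> {R. rotation_matrix R} \<times> {0..TM}" if "r \<in> {en j<..<t}" for r
      using hybrid_solution_flow_set[OF sol sub _ that] lt by (auto simp: error_system_def)
    have "continuous_on {en j..t} (\<lambda>r. (R r j, \<tau> r j))"
      using flow_derivatives(1,4)[OF assms]
      by (intro continuous_on_Pair continuous_on_vector_derivative)
    then have "continuous_on (closure {en j<..<t}) (\<lambda>r. (R r j, \<tau> r j))" using lt by simp
    moreover have "closed ({R :: real^3^3. rotation_matrix R} \<times> {0..TM})"
      by (intro closed_Times closed_rotation_matrix closed_atLeastAtMost)
    ultimately have "(\<lambda>r. (R r j, \<tau> r j)) ` closure {en j<..<t} \<subseteq> {R. rotation_matrix R} \<times> {0..TM}"
      using fl by (intro image_closure_subset) auto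
    moreover have "t \<in> closure {en j<..<t}" using lt by simp
    ultimately show ?thesis by force
  qed (use entry in simp)
qed

lemma timer:
  assumes "(t, j) \<in> E"
  shows "\<tau> t j = \<tau> (en j) j - (t - en j)"
proof -
  have d: "((\<lambda>t. \<tau> t j + t) has_vector_derivative - 1 + 1) (at r within {en j..t})" if "r \<in> {en j..t}" for r
    using flow_derivatives(4)[OF assms that] by (intro has_vector_derivative_add) (auto intro!: derivative_intros)
  have "\<tau> t j + t = \<tau> (en j) j + en j"
    using derivative_bound_imp_increment_le[OF en_le[OF assms] d, of 0]
      derivative_bound_imp_increment_le[OF en_le[OF assms] has_vector_derivative_minus[OF d], of 0] by simp
  then show ?thesis by simp
qed

lemma \<eta>_flow:
  assumes "(t, j) \<in> E"
  shows "\<eta> t j = \<eta> (en j) j"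
  using lipschitz_ode_unique[OF en_le[OF assms], of "\<lambda>t. \<eta> t j" "\<lambda>_ _. 0" "\<lambda>_. \<eta> (en j) j" 0]
    flow_derivatives(2)[OF assms] by auto

lemma flow_length: "(t, j) \<in> E \<Longrightarrow> t - en j \<le> TM"
  using timer[of t j] state_constraints[of t j] state_constraints[OF en_in, of t j] by auto

text \<open>The first interval is excluded: the initial value of the timer is anywhere in
  \<open>{0..TM}\<close>, possibly 0, while every later interval starts from a reset value of at
  least \<open>Tm\<close>.\<close>

lemma jump_interval:
  assumes "(t, Suc j) \<in> E" "0 < j"
  shows "Tm \<le> en (Suc j) - en j"
proof -
  obtain i where j: "j = Suc i" using assms(2) gr0_implies_Suc by blast
  have in_j: "(en (Suc j), j) \<in> E" using en_Suc_in[OF assms(1)] .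
  then have "Tm \<le> \<tau> (en j) j" using jump(7)[of _ i] j by auto
  then show ?thesis using timer[OF in_j] jump(2)[OF assms(1)] by simp
qed

text \<open>Translates between continuous time and jump count, so that decay in either one is decay
  in both. The shifts by 1 come from the current interval and from the first interval, which has no
  positive minimal length.\<close>

lemma time_bounds:
  assumes "(t, j) \<in> E"
  shows "t \<le> (real j + 1) * TM" "(real j - 1) * Tm \<le> t"
proof -
  have "en j \<le> real j * TM \<and> (real j - 1) * Tm \<le> en j" using assms
  proof (induction j arbitrary: t)
    case 0
    then show ?case using Tm by (simp add: en_0)
  next
    case (Suc j)
    have in_j: "(en (Suc j), j) \<in> E" using en_Suc_in[OF Suc.prems] .
    note IH = Suc.IH[OF in_j]
    have "en (Suc j) \<le> real (Suc j) * TM"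
      using flow_length[OF in_j] IH by (simp add: algebra_simps)
    moreover have "(real (Suc j) - 1) * Tm \<le> en (Suc j)"
    proof (cases "j = 0")
      case True
      then show ?thesis using en_nonneg[OF Suc.prems] by simp
    next
      case False
      then show ?thesis using jump_interval[OF Suc.prems] IH by (simp add: algebra_simps)
    qed
    ultimately show ?case by simp
  qed
  then show "t \<le> (real j + 1) * TM" "(real j - 1) * Tm \<le> t"
    using flow_length[OF assms] en_le[OF assms] by (auto simp: algebra_simps)
qed

end

section \<open>The Riccati observer\<close>

lemma matrix_inv_mult:
  assumes "invertible A"
  shows "A ** matrix_inv A = mat 1" "matrix_inv A ** A = mat 1"
proof -
  have "A ** matrix_inv A = mat 1 \<and> matrix_inv A ** A = mat 1"
    unfolding matrix_inv_def by (rule someI_ex) (use assms in \<open>simp add: invertible_def\<close>)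
  then show "A ** matrix_inv A = mat 1" "matrix_inv A ** A = mat 1" by auto
qed

lemma symmetric_matrix_iff:
  fixes A :: "real^'n^'n"
  shows "transpose A = A \<longleftrightarrow> (\<forall>x y. x \<bullet> (A *v y) = y \<bullet> (A *v x))"
proof
  assume *: "\<forall>x y. x \<bullet> (A *v y) = y \<bullet> (A *v x)"
  have "transpose A *v x = A *v x" for x
  proof -
    have "(transpose A *v x) \<bullet> y = (A *v x) \<bullet> y" for y
      using * by (simp only: inner_matrix_vector_mult[symmetric] inner_commute[of "A *v x"])
    then show ?thesis by (metis vector_eq_rdot)
  qed
  then show "transpose A = A" by (simp add: matrix_eq)
next
  assume "transpose A = A"
  then show "\<forall>x y. x \<bullet> (A *v y) = y \<bullet> (A *v x)"
    using symmetric_matrix_inner[of A] by (simp add: inner_commute)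
qed

lemma quadratic_form_le:
  fixes A :: "real^'n^'n"
  assumes "norm A \<le> b"
  shows "y \<bullet> (A *v y) \<le> b * (norm y)\<^sup>2"
proof -
  have "y \<bullet> (A *v y) \<le> norm y * norm (A *v y)" by (rule norm_cauchy_schwarz)
  also have "\<dots> \<le> norm y * (norm A * norm y)"
    by (intro mult_left_mono norm_matrix_vector_mult_le) simp
  also have "\<dots> \<le> norm y * (b * norm y)"
    using assms by (intro mult_left_mono mult_right_mono) auto
  finally show ?thesis by (simp add: power2_eq_square mult_ac)
qed

text \<open>
  The update of the Riccati equation as the minimal value of a quadratic cost over the dual
  correction \<open>u\<close>; the minimiser corresponds to the gain.
\<close>

context
  fixes P :: mat9 and Q :: "real^3^3" and q :: real
  assumes symP: "transpose P = P" and psdP: "\<And>y. 0 \<le> y \<bullet> (P *v y)"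
    and symQ: "transpose Q = Q" and q: "0 < q" and Qq: "\<And>u. q * (u \<bullet> u) \<le> u \<bullet> (Q *v u)"
begin

private definition "W = C_mat ** P ** transpose C_mat + Q"

lemma W_mult: "W *v u = C_mat *v (P *v (transpose C_mat *v u)) + Q *v u"
  by (simp add: W_def matrix_vector_mult_add_rdistrib matrix_vector_mul_assoc matrix_mul_assoc)

lemma inner_W: "u \<bullet> (W *v v) = (transpose C_mat *v u) \<bullet> (P *v (transpose C_mat *v v)) + u \<bullet> (Q *v v)"
  by (simp only: W_mult inner_add_right inner_matrix_vector_mult[of u C_mat])

lemma inner_W_sym: "u \<bullet> (W *v v) = v \<bullet> (W *v u)"
  using symP symQ unfolding inner_W symmetric_matrix_iff by metis

lemma inner_W_pos: "q * (u \<bullet> u) \<le> u \<bullet> (W *v u)"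
  using psdP[of "transpose C_mat *v u"] Qq[of u] unfolding inner_W by linarith

lemma W_inverse: "W *v (matrix_inv W *v u) = u" "matrix_inv W *v (W *v u) = u"
proof -
  have "u = 0" if "W *v u = 0" for u
  proof (rule ccontr)
    assume "u \<noteq> 0"
    then have "0 < q * (u \<bullet> u)" using q by simp
    then show False using inner_W_pos[of u] that by simp
  qed
  then have "invertible W" by (simp add: invertible_left_inverse matrix_left_invertible_ker)
  then show "W *v (matrix_inv W *v u) = u" "matrix_inv W *v (W *v u) = u"
    by (simp_all add: matrix_vector_mul_assoc matrix_inv_mult)
qed

lemma inner_riccati_jump:
  "y \<bullet> (riccati_jump Q P *v z) =
    y \<bullet> (P *v z) - (C_mat *v (P *v y)) \<bullet> (matrix_inv W *v (C_mat *v (P *v z)))"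
proof -
  have "riccati_jump Q P *v z =
      P *v z - P *v (transpose C_mat *v (matrix_inv W *v (C_mat *v (P *v z))))"
    by (simp add: riccati_jump_def W_def matrix_vector_mult_diff_rdistrib matrix_vector_mul_assoc
        matrix_mul_assoc)
  moreover have "y \<bullet> (P *v (transpose C_mat *v v)) = (C_mat *v (P *v y)) \<bullet> v" for v
    by (metis symP symmetric_matrix_inner inner_matrix_vector_mult transpose_transpose)
  ultimately show ?thesis by (simp add: inner_diff_right)
qed

lemma transpose_riccati_jump: "transpose (riccati_jump Q P) = riccati_jump Q P"
proof -
  have inv_sym: "a \<bullet> (matrix_inv W *v b) = b \<bullet> (matrix_inv W *v a)" for a b
    by (metis W_inverse(1) inner_W_sym inner_commute)
  show ?thesis
    unfolding symmetric_matrix_iff inner_riccati_jump using symP inv_sym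
    by (metis symmetric_matrix_iff)
qed

text \<open>Completing the square: the cost is y . P y - 2 (u . b) + u . W u, smallest at
  \<open>a\<close>, and the amount a . b gained there is what \<open>riccati_jump\<close> subtracts
  from y . P y.\<close>

lemma dual_cost_identity:
  fixes y u
  defines "b \<equiv> C_mat *v (P *v y)"
  defines "a \<equiv> matrix_inv W *v b"
  shows "(y - transpose C_mat *v u) \<bullet> (P *v (y - transpose C_mat *v u)) + u \<bullet> (Q *v u) =
    y \<bullet> (riccati_jump Q P *v y) + (u - a) \<bullet> (W *v (u - a))"
proof -
  let ?c = "transpose C_mat *v u"
  have Wa: "W *v a = b" by (simp add: a_def W_inverse)
  have cb: "?c \<bullet> (P *v y) = u \<bullet> b"
    unfolding b_def by (simp only: inner_matrix_vector_mult[of u C_mat])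
  have bc: "y \<bullet> (P *v ?c) = u \<bullet> b"
    using cb symP by (metis symmetric_matrix_iff)
  have "(y - ?c) \<bullet> (P *v (y - ?c)) + u \<bullet> (Q *v u) = y \<bullet> (P *v y) - 2 * (u \<bullet> b) + u \<bullet> (W *v u)"
    by (simp add: inner_W matrix_vector_mult_diff_distrib inner_diff_left inner_diff_right cb bc)
  moreover have "(u - a) \<bullet> (W *v (u - a)) = u \<bullet> (W *v u) - 2 * (u \<bullet> b) + a \<bullet> b"
    using inner_W_sym[of a u]
    by (simp add: matrix_vector_mult_diff_distrib inner_diff_left inner_diff_right Wa inner_commute)
  moreover have "y \<bullet> (riccati_jump Q P *v y) = y \<bullet> (P *v y) - b \<bullet> a"
    by (simp add: inner_riccati_jump a_def b_def)
  ultimately show ?thesis by (simp add: inner_commute)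
qed

lemma riccati_jump_le:
  "y \<bullet> (riccati_jump Q P *v y) \<le>
    (y - transpose C_mat *v u) \<bullet> (P *v (y - transpose C_mat *v u)) + u \<bullet> (Q *v u)"
  unfolding dual_cost_identity
  using order_trans[OF _ inner_W_pos, of 0] q by simp

text \<open>The minimiser is K^T y, so \<open>y - transpose C_mat *v u\<close> is also the image of
  \<open>y\<close> under the adjoint of the error jump. One vector thus accounts for both the energy
  and the pairing with the error.\<close>

lemma riccati_jump_dual:
  obtains u where
    "y \<bullet> (riccati_jump Q P *v y) =
      (y - transpose C_mat *v u) \<bullet> (P *v (y - transpose C_mat *v u)) + u \<bullet> (Q *v u)"
    "\<And>x. y \<bullet> ((mat 1 - gain P Q ** C_mat) *v x) = (y - transpose C_mat *v u) \<bullet> x"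
proof (rule that)
  let ?u = "matrix_inv W *v (C_mat *v (P *v y))"
  show "y \<bullet> (riccati_jump Q P *v y) =
      (y - transpose C_mat *v ?u) \<bullet> (P *v (y - transpose C_mat *v ?u)) + ?u \<bullet> (Q *v ?u)"
    unfolding dual_cost_identity by simp
  have inv_sym: "a \<bullet> (matrix_inv W *v b) = (matrix_inv W *v a) \<bullet> b" for a b
    by (metis W_inverse(1) inner_W_sym inner_commute)
  show "y \<bullet> ((mat 1 - gain P Q ** C_mat) *v x) = (y - transpose C_mat *v ?u) \<bullet> x" for x
  proof -
    have "(mat 1 - gain P Q ** C_mat) *v x = x - P *v (transpose C_mat *v (matrix_inv W *v (C_mat *v x)))"
      by (simp add: gain_def W_def matrix_vector_mult_diff_rdistrib matrix_vector_mul_assoc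
          matrix_mul_assoc)
    moreover have "y \<bullet> (P *v (transpose C_mat *v v)) = (C_mat *v (P *v y)) \<bullet> v" for v
      by (metis symP symmetric_matrix_inner inner_matrix_vector_mult transpose_transpose)
    ultimately show ?thesis
      by (simp add: inner_diff_left inner_diff_right inv_sym)
        (metis inner_matrix_vector_mult)
  qed
qed

end

section \<open>The adjoint system during one interval of flow\<close>

lemma constant_of_zero_derivative:
  fixes f :: "real \<Rightarrow> 'a::real_inner"
  assumes "\<And>t. t \<in> {a..b} \<Longrightarrow> (f has_vector_derivative 0) (at t within {a..b})" "t \<in> {a..b}"
  shows "f t = f a"
proof (rule lipschitz_ode_unique[where f=f and g="\<lambda>_. f a" and a=a and b=t and F="\<lambda>_ _. 0" and L=0])
  show "a \<le> t" using assms(2) by simp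
  show "(f has_vector_derivative 0) (at r within {a..t})" if "r \<in> {a..t}" for r
    using that assms(2) by (intro has_vector_derivative_within_subset[OF assms(1)]) auto
qed simp_all

text \<open>A linear equation with bounded coefficients. As \<open>skew\<close> is antisymmetric, S
  S^T has derivative zero and stays the identity; for square matrices the reversed product
  follows.\<close>

lemma body_frame_exists:
  assumes "continuous_on {s..t} \<omega>" "s \<le> t"
  obtains S :: "real \<Rightarrow> real^3^3" where "S s = mat 1" "\<And>r. r \<in> {s..t} \<Longrightarrow> orthogonal_matrix (S r)"
    "\<And>r. r \<in> {s..t} \<Longrightarrow> (S has_vector_derivative S r ** skew (\<omega> r)) (at r within {s..t})"
proof -
  have "bounded (\<omega> ` {s..t})"
    by (intro compact_imp_bounded compact_continuous_image assms) auto
  then obtain B where "\<forall>v\<in>\<omega> ` {s..t}. norm v \<le> B" unfolding bounded_iff by blast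
  then have B: "norm (\<omega> r) \<le> B" if "r \<in> {s..t}" for r using that by blast
  obtain S :: "real \<Rightarrow> real^3^3" where S0: "S s = mat 1" and
    S: "\<And>r. r \<in> {s..t} \<Longrightarrow> (S has_vector_derivative S r ** skew (\<omega> r)) (at r within {s..t})"
  proof (rule lipschitz_ode_exists[of s t "\<lambda>r S. S ** skew (\<omega> r)" "2 * B" "mat 1"])
    show "continuous_on {s..t} (\<lambda>r. y r ** skew (\<omega> r))" if "continuous_on {s..t} y" for y :: "real \<Rightarrow> real^3^3"
      by (intro bounded_bilinear.continuous_on[OF bounded_bilinear_matrix_matrix_mult] that
          bounded_linear.continuous_on[OF bounded_linear_skew] assms)
    show "norm (X ** skew (\<omega> r) - Y ** skew (\<omega> r)) \<le> 2 * B * norm (X - Y)" if "r \<in> {s..t}" for r and X Y :: "real^3^3"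
    proof -
      have "norm (X ** skew (\<omega> r) - Y ** skew (\<omega> r)) = norm ((X - Y) ** skew (\<omega> r))"
        by (simp add: bounded_bilinear.diff_left[OF bounded_bilinear_matrix_matrix_mult])
      also have "\<dots> \<le> norm (X - Y) * norm (skew (\<omega> r))" by (rule norm_matrix_matrix_mult_le)
      also have "\<dots> \<le> norm (X - Y) * (2 * B)"
        using norm_skew_le[of "\<omega> r"] B[OF that] by (intro mult_left_mono) auto
      finally show ?thesis by (simp add: mult.commute)
    qed
  qed (use assms in auto)
  have "((\<lambda>r. S r ** transpose (S r)) has_vector_derivative 0) (at r within {s..t})" if "r \<in> {s..t}" for r
  proof -
    have "((\<lambda>r. S r ** transpose (S r)) has_vector_derivative
        S r ** transpose (S r ** skew (\<omega> r)) + (S r ** skew (\<omega> r)) ** transpose (S r)) (at r within {s..t})"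
      using S[OF that] by (intro bounded_bilinear.has_vector_derivative[OF bounded_bilinear_matrix_matrix_mult]
          bounded_linear.has_vector_derivative[OF bounded_linear_transpose])
    moreover have "S r ** transpose (S r ** skew (\<omega> r)) = - ((S r ** skew (\<omega> r)) ** transpose (S r))"
      by (simp add: matrix_transpose_mul transpose_skew matrix_mul_assoc
          bounded_bilinear.minus_left[OF bounded_bilinear_matrix_matrix_mult]
          bounded_bilinear.minus_right[OF bounded_bilinear_matrix_matrix_mult])
    ultimately show ?thesis by simp
  qed
  from constant_of_zero_derivative[OF this] have "S r ** transpose (S r) = mat 1" if "r \<in> {s..t}" for r
    using that S0 by simp
  then have "orthogonal_matrix (S r)" if "r \<in> {s..t}" for r
    using that by (simp add: orthogonal_matrix_def matrix_left_right_inverse)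
  with S0 S that show thesis by blast
qed

text \<open>Growth of adjoint solutions within time \<open>T\<close>: in the rotating frame each of
  the three blocks is a polynomial of degree at most 2 in the elapsed time, of norm at most 1 + T +
  T^2 times that of the terminal value.\<close>

definition dual_growth :: "real \<Rightarrow> real" where
  "dual_growth T = 3 * (1 + T + T\<^sup>2)"

lemma dual_growth_ge_1: "0 \<le> T \<Longrightarrow> 1 \<le> dual_growth T"
  by (simp add: dual_growth_def)

text \<open>
  In the frame obtained by integrating \<open>\<omega>\<close>, the adjoint system is a chain of integrators and can be
  solved explicitly.
\<close>

lemma dual_flow:
  assumes cont: "continuous_on {s..t} \<omega>" and "s \<le> t" "t - s \<le> T"
  defines "h \<equiv> t - s"
  obtains G :: "real^3^3" where "orthogonal_matrix G"
    "\<And>\<zeta>. \<exists>y. y t = \<zeta> \<and>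
      (\<forall>r\<in>{s..t}. (y has_vector_derivative - (transpose (A_mat (\<omega> r)) *v y r)) (at r within {s..t})) \<and>
      (\<forall>r\<in>{s..t}. norm (y r) \<le> dual_growth T * norm \<zeta>) \<and>
      y s = join3 (G *v blk 1 \<zeta>) (G *v (blk 2 \<zeta> + h *\<^sub>R blk 1 \<zeta>))
        (G *v (blk 3 \<zeta> + h *\<^sub>R blk 2 \<zeta> + (h\<^sup>2 / 2) *\<^sub>R blk 1 \<zeta>))"
proof -
  obtain S where S0: "S s = mat 1" and So: "\<And>r. r \<in> {s..t} \<Longrightarrow> orthogonal_matrix (S r)" and
    S: "\<And>r. r \<in> {s..t} \<Longrightarrow> (S has_vector_derivative S r ** skew (\<omega> r)) (at r within {s..t})"
    using body_frame_exists[OF cont \<open>s \<le> t\<close>] by blast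
  have d: "((\<lambda>r. transpose (S r) *v p r) has_vector_derivative
      transpose (S r) *v p' - cross3 (\<omega> r) (transpose (S r) *v p r)) (at r within {s..t})"
    if r: "r \<in> {s..t}" and p: "(p has_vector_derivative p') (at r within {s..t})" for p p' r
  proof -
    have "((\<lambda>r. transpose (S r) *v p r) has_vector_derivative
      transpose (S r) *v p' + transpose (S r ** skew (\<omega> r)) *v p r) (at r within {s..t})"
      by (intro bounded_bilinear.has_vector_derivative[OF bounded_bilinear_matrix_vector_mult]
          bounded_linear.has_vector_derivative[OF bounded_linear_transpose] S r p)
    moreover have "transpose (S r ** skew (\<omega> r)) *v p r = - cross3 (\<omega> r) (transpose (S r) *v p r)"
      by (simp add: matrix_transpose_mul transpose_skew skew_mult_vec
          bounded_bilinear.minus_left[OF bounded_bilinear_matrix_vector_mult]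
          flip: matrix_vector_mul_assoc skew_minus)
    ultimately show ?thesis by simp
  qed
  show thesis
  proof (rule that[of "S t"])
    show "orthogonal_matrix (S t)" using So \<open>s \<le> t\<close> by simp
    fix \<zeta> :: vec9
    define c1 where "c1 = S t *v blk 1 \<zeta>"
    define c2 where "c2 = S t *v blk 2 \<zeta>"
    define c3 where "c3 = S t *v blk 3 \<zeta>"
    \<comment> \<open>In the frame \<open>S\<close> the blocks of the adjoint solution satisfy p1' =
      0, p2' = - p1 and p3' = - p2, with values prescribed at the right end \<open>t\<close>; hence
      polynomials in \<open>t - r\<close>.\<close>
    define p2 where "p2 r = c2 + (t - r) *\<^sub>R c1" for r
    define p3 where "p3 r = c3 + (t - r) *\<^sub>R c2 + ((t - r)\<^sup>2 / 2) *\<^sub>R c1" for r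
    define y where "y r = join3 (transpose (S r) *v c1) (transpose (S r) *v p2 r) (transpose (S r) *v p3 r)" for r
    have p2: "(p2 has_vector_derivative - c1) (at r within {s..t})" for r
      unfolding p2_def by (auto intro!: derivative_eq_intros)
    have p3: "(p3 has_vector_derivative - p2 r) (at r within {s..t})" for r
    proof -
      have "((\<lambda>r. (t - r)\<^sup>2 / 2) has_real_derivative - (t - r)) (at r within {s..t})"
        by (auto intro!: derivative_eq_intros)
      then have 1: "((\<lambda>r. ((t - r)\<^sup>2 / 2) *\<^sub>R c1) has_vector_derivative (- (t - r)) *\<^sub>R c1) (at r within {s..t})"
        using has_vector_derivative_scaleR[OF _ has_vector_derivative_const] by fastforce
      have 2: "((\<lambda>r. c3 + (t - r) *\<^sub>R c2) has_vector_derivative - c2) (at r within {s..t})"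
        by (auto intro!: derivative_eq_intros)
      have "- c2 + (- (t - r)) *\<^sub>R c1 = - p2 r" by (simp add: p2_def scaleR_diff_left)
      then show ?thesis
        using has_vector_derivative_add[OF 2 1] by (simp only: p3_def[abs_def])
    qed
    have "S t ** transpose (S t) = mat 1" "transpose (S t) ** S t = mat 1"
      using So[of t] \<open>s \<le> t\<close> by (auto simp: orthogonal_matrix_def)
    then have yt: "y t = \<zeta>"
      by (simp add: y_def p2_def p3_def c1_def c2_def c3_def matrix_vector_mul_assoc)
    have yder: "(y has_vector_derivative - (transpose (A_mat (\<omega> r)) *v y r)) (at r within {s..t})" if r: "r \<in> {s..t}" for r
    proof -
      have "(y has_vector_derivative join3
          (transpose (S r) *v 0 - cross3 (\<omega> r) (transpose (S r) *v c1))
          (transpose (S r) *v (- c1) - cross3 (\<omega> r) (transpose (S r) *v p2 r))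
          (transpose (S r) *v (- p2 r) - cross3 (\<omega> r) (transpose (S r) *v p3 r))) (at r within {s..t})"
        unfolding y_def by (intro has_vector_derivative_join3 d r p2 p3 has_vector_derivative_const)
      moreover have "join3
          (transpose (S r) *v 0 - cross3 (\<omega> r) (transpose (S r) *v c1))
          (transpose (S r) *v (- c1) - cross3 (\<omega> r) (transpose (S r) *v p2 r))
          (transpose (S r) *v (- p2 r) - cross3 (\<omega> r) (transpose (S r) *v p3 r)) =
          - (transpose (A_mat (\<omega> r)) *v y r)"
        by (simp add: blk_eq_iff blk_linear_simps blk_transpose_A_mat y_def
            bounded_bilinear.minus_right[OF bounded_bilinear_matrix_vector_mult])
      ultimately show ?thesis by simp
    qed
    have ynorm: "norm (y r) \<le> dual_growth T * norm \<zeta>" if r: "r \<in> {s..t}" for r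
    proof -
      have tr: "norm (transpose (S r) *v v) = norm v" for v
        using So[OF r] by (intro orthogonal_matrix_mult_vec_norm) simp
      have c: "norm c1 \<le> norm \<zeta>" "norm c2 \<le> norm \<zeta>" "norm c3 \<le> norm \<zeta>"
        using So[of t] \<open>s \<le> t\<close> norm_blk_le by (auto simp: c1_def c2_def c3_def orthogonal_matrix_mult_vec_norm)
      have tr0: "0 \<le> t - r" "t - r \<le> T" "0 \<le> T" using r \<open>t - s \<le> T\<close> by auto
      then have sq: "(t - r)\<^sup>2 / 2 \<le> T\<^sup>2"
        using power_mono[OF tr0(2,1), of 2] zero_le_power2[of "t - r"] by linarith
      have T1: "(t - r) * norm v \<le> T * norm \<zeta>" "((t - r)\<^sup>2 / 2) * norm v \<le> T\<^sup>2 * norm \<zeta>"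
        if "norm v \<le> norm \<zeta>" for v :: "real^3"
        using tr0 sq that by (auto intro!: mult_mono simp del: times_divide_eq_left)
      have nn: "0 \<le> T * norm \<zeta>" "0 \<le> T\<^sup>2 * norm \<zeta>" using tr0 by auto
      have ex: "(1 + T + T\<^sup>2) * norm \<zeta> = norm \<zeta> + T * norm \<zeta> + T\<^sup>2 * norm \<zeta>"
        by (simp add: distrib_right)
      have "norm (p2 r) \<le> norm c2 + norm ((t - r) *\<^sub>R c1)" unfolding p2_def by (rule norm_triangle_ineq)
      also have "\<dots> = norm c2 + (t - r) * norm c1" using tr0 by simp
      finally have n2: "norm (p2 r) \<le> (1 + T + T\<^sup>2) * norm \<zeta>"
        unfolding ex using c T1(1)[OF c(1)] nn by linarith
      have "norm (p3 r) \<le> norm c3 + norm ((t - r) *\<^sub>R c2) + norm (((t - r)\<^sup>2 / 2) *\<^sub>R c1)"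
        unfolding p3_def by (intro norm_triangle_le add_mono norm_triangle_ineq order_refl)
      also have "\<dots> = norm c3 + (t - r) * norm c2 + ((t - r)\<^sup>2 / 2) * norm c1" using tr0 by simp
      finally have n3: "norm (p3 r) \<le> (1 + T + T\<^sup>2) * norm \<zeta>"
        unfolding ex using c T1(1)[OF c(2)] T1(2)[OF c(1)] nn by linarith
      have n1: "norm c1 \<le> (1 + T + T\<^sup>2) * norm \<zeta>" unfolding ex using c nn by linarith
      have "norm (y r) \<le> norm c1 + norm (p2 r) + norm (p3 r)"
        unfolding y_def using norm_join3_le by (metis tr)
      then show ?thesis using n1 n2 n3 unfolding dual_growth_def mult.assoc by linarith
    qed
    have "y s = join3 (S t *v blk 1 \<zeta>) (S t *v (blk 2 \<zeta> + h *\<^sub>R blk 1 \<zeta>))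
        (S t *v (blk 3 \<zeta> + h *\<^sub>R blk 2 \<zeta> + (h\<^sup>2 / 2) *\<^sub>R blk 1 \<zeta>))"
      by (simp add: y_def S0 p2_def p3_def c1_def c2_def c3_def h_def matrix_vector_right_distrib
          matrix_vector_mult_scaleR matrix_vector_mul_lid)
    then show "\<exists>y. y t = \<zeta> \<and>
      (\<forall>r\<in>{s..t}. (y has_vector_derivative - (transpose (A_mat (\<omega> r)) *v y r)) (at r within {s..t})) \<and>
      (\<forall>r\<in>{s..t}. norm (y r) \<le> dual_growth T * norm \<zeta>) \<and>
      y s = join3 (S t *v blk 1 \<zeta>) (S t *v (blk 2 \<zeta> + h *\<^sub>R blk 1 \<zeta>))
        (S t *v (blk 3 \<zeta> + h *\<^sub>R blk 2 \<zeta> + (h\<^sup>2 / 2) *\<^sub>R blk 1 \<zeta>))"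
      using yt yder ynorm by blast
  qed
qed

lemma dual_pairing_derivative:
  fixes A :: "real^'n^'n"
  assumes y: "(y has_vector_derivative - (transpose A *v y r)) (at r within S)"
    and x: "(x has_vector_derivative A *v x r) (at r within S)"
  shows "((\<lambda>r. y r \<bullet> x r) has_vector_derivative 0) (at r within S)"
  using bounded_bilinear.has_vector_derivative[OF bounded_bilinear_inner y x]
  by (simp add: inner_matrix_vector_mult[of "y r" A])

lemma dual_energy_derivative:
  fixes P :: "real \<Rightarrow> mat9"
  assumes y: "(y has_vector_derivative - (transpose (A_mat w) *v y r)) (at r within S)"
    and z: "(z has_vector_derivative - (transpose (A_mat w) *v z r)) (at r within S)"
    and P: "(P has_vector_derivative riccati_flow w V (P r)) (at r within S)"
  shows "((\<lambda>r. y r \<bullet> (P r *v z r)) has_vector_derivative y r \<bullet> (V *v z r)) (at r within S)"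
proof -
  have "((\<lambda>r. y r \<bullet> (P r *v z r)) has_vector_derivative
      y r \<bullet> (P r *v (- (transpose (A_mat w) *v z r)) + riccati_flow w V (P r) *v z r) +
      (- (transpose (A_mat w) *v y r)) \<bullet> (P r *v z r)) (at r within S)"
    by (intro bounded_bilinear.has_vector_derivative[OF bounded_bilinear_inner]
        bounded_bilinear.has_vector_derivative[OF bounded_bilinear_matrix_vector_mult] y z P)
  moreover have "riccati_flow w V (P r) *v z r =
      A_mat w *v (P r *v z r) + P r *v (transpose (A_mat w) *v z r) + V *v z r"
    by (simp add: riccati_flow_def matrix_vector_mult_add_rdistrib matrix_vector_mul_assoc)
  ultimately show ?thesis
    by (simp add: inner_add_right inner_matrix_vector_mult[of "y r" "A_mat w"]
        bounded_bilinear.minus_right[OF bounded_bilinear_matrix_vector_mult])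
qed

lemma diff_transpose_C_mat:
  "y - transpose C_mat *v u = join3 (blk 1 y - u) (blk 2 y) (blk 3 y)"
  by (simp add: blk_eq_iff transpose_C_mat_mult_vec blk_linear_simps)

text \<open>
  The cost of steering the adjoint system to zero by corrections at three consecutive jumps gives
  a bound on the solution of the Riccati equation that does not depend on its earlier values.
\<close>

definition deadbeat_growth :: "real \<Rightarrow> real \<Rightarrow> real" where
  "deadbeat_growth Tm TM = dual_growth TM ^ 3 * (2 + (1 + 2 * TM) / Tm\<^sup>2) * (2 + 1 / Tm)"

text \<open>The largest increase of the energy y . P y during one flow, per squared norm of the
  terminal value: the integral of y . V y is bounded through the growth of \<open>y\<close> and the
  maximal duration \<open>TM\<close>.\<close>

definition flow_cost :: "real \<Rightarrow> real \<Rightarrow> real" where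
  "flow_cost TM bV = bV * (dual_growth TM)\<^sup>2 * TM"

text \<open>\<open>c\<close> carries a bound through one interval of flow, so the first three
  summands cover the intervals 0, 1 and 2; the last one covers all later intervals, where three
  jumps are available for steering. All summands are nonnegative, so the sum stands in for the
  maximum.\<close>

definition riccati_bound :: "real \<Rightarrow> real \<Rightarrow> real \<Rightarrow> real \<Rightarrow> real \<Rightarrow> real" where
  "riccati_bound Tm TM bV bQ b0 =
     (let c = (\<lambda>b. b * (dual_growth TM)\<^sup>2 + flow_cost TM bV)
      in c b0 + c (c b0) + c (c (c b0)) + 3 * (flow_cost TM bV + bQ) * (deadbeat_growth Tm TM)\<^sup>2)"

text \<open>The bounds on the data are parameters fixed apart from the solution, so that the
  constants of decay built from them are common to all solutions.\<close>

locale riccati_observer = error_solution +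
  fixes cV cQ bV bQ b0 :: real
  assumes V_sym: "\<And>t. 0 \<le> t \<Longrightarrow> transpose (V t) = V t"
    and cV: "0 < cV" "\<And>t y. 0 \<le> t \<Longrightarrow> cV * (y \<bullet> y) \<le> y \<bullet> (V t *v y)"
    and bV: "\<And>t. 0 \<le> t \<Longrightarrow> norm (V t) \<le> bV"
    and Q_sym: "\<And>t. 0 \<le> t \<Longrightarrow> transpose (Q t) = Q t"
    and cQ: "0 < cQ" "\<And>t u. 0 \<le> t \<Longrightarrow> cQ * (u \<bullet> u) \<le> u \<bullet> (Q t *v u)"
    and bQ: "\<And>t. 0 \<le> t \<Longrightarrow> norm (Q t) \<le> bQ"
    and P0_sym: "transpose (P 0 0) = P 0 0" and P0_psd: "\<And>y. 0 \<le> y \<bullet> (P 0 0 *v y)"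
    and b0: "norm (P 0 0) \<le> b0"
begin

lemma bounds_nonneg: "0 \<le> bV" "0 \<le> bQ" "0 \<le> b0"
  using bV[of 0] bQ[of 0] b0 norm_ge_zero order_trans by blast+

lemma TM_pos: "0 < TM"
  using Tm by simp

lemma K_ge_1: "1 \<le> dual_growth TM"
  using TM_pos by (simp add: dual_growth_ge_1)

lemma V_psd: "0 \<le> t \<Longrightarrow> 0 \<le> y \<bullet> (V t *v y)"
  using cV(2)[of t y] cV(1) by (meson inner_ge_zero less_imp_le mult_nonneg_nonneg order_trans)

lemma continuous_on_\<omega>_interval: "(t, j) \<in> E \<Longrightarrow> continuous_on {en j..t} \<omega>"
  using en_nonneg[of t j] by (intro continuous_on_subset[OF cont_\<omega>]) auto

text \<open>For two adjoint solutions y and z, the difference y . P z - z . P y has derivative y . V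
  z - z . V y = 0, and it vanishes at the entry. Any two vectors at time \<open>t\<close> are
  terminal values of such solutions.\<close>

lemma symmetric_flow:
  assumes t: "(t, j) \<in> E" and sym: "transpose (P (en j) j) = P (en j) j"
  shows "transpose (P t j) = P t j"
  unfolding symmetric_matrix_iff
proof (intro allI)
  fix \<zeta> \<xi> :: vec9
  obtain G where G: "\<And>\<zeta>. \<exists>y. y t = \<zeta> \<and>
      (\<forall>r\<in>{en j..t}. (y has_vector_derivative - (transpose (A_mat (\<omega> r)) *v y r)) (at r within {en j..t}))"
    using dual_flow[OF continuous_on_\<omega>_interval[OF t] en_le[OF t] flow_length[OF t]] by metis
  obtain y where y: "y t = \<zeta>"
    "\<And>r. r \<in> {en j..t} \<Longrightarrow> (y has_vector_derivative - (transpose (A_mat (\<omega> r)) *v y r)) (at r within {en j..t})"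
    using G by blast
  obtain z where z: "z t = \<xi>"
    "\<And>r. r \<in> {en j..t} \<Longrightarrow> (z has_vector_derivative - (transpose (A_mat (\<omega> r)) *v z r)) (at r within {en j..t})"
    using G by blast
  define f where "f r = y r \<bullet> (P r j *v z r) - z r \<bullet> (P r j *v y r)" for r
  have "(f has_vector_derivative 0) (at r within {en j..t})" if r: "r \<in> {en j..t}" for r
  proof -
    have "0 \<le> r" using r en_nonneg[OF t] by simp
    then have "y r \<bullet> (V r *v z r) - z r \<bullet> (V r *v y r) = 0"
      using V_sym[of r] by (simp add: symmetric_matrix_iff)
    moreover have "(f has_vector_derivative y r \<bullet> (V r *v z r) - z r \<bullet> (V r *v y r)) (at r within {en j..t})"
      unfolding f_def using flow_derivatives(5)[OF t r] y(2)[OF r] z(2)[OF r]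
      by (intro has_vector_derivative_diff dual_energy_derivative)
    ultimately show ?thesis by simp
  qed
  then have "f t = f (en j)"
    by (rule constant_of_zero_derivative) (use en_le[OF t] in auto)
  moreover have "f (en j) = 0" using sym by (simp add: f_def symmetric_matrix_iff)
  ultimately show "\<zeta> \<bullet> (P t j *v \<xi>) = \<xi> \<bullet> (P t j *v \<zeta>)" by (simp add: f_def y z)
qed

text \<open>\<open>y\<close> stands for the entry value of the adjoint solution that ends in
  \<open>\<zeta>\<close>; the conjuncts record what is used of it. The last one is conditional on a
  bound for \<open>P\<close> because that bound is derived from the others first.\<close>

definition backward_step :: "real \<Rightarrow> nat \<Rightarrow> vec9 \<Rightarrow> vec9 \<Rightarrow> bool" where
  "backward_step t j \<zeta> y \<longleftrightarrow>
      norm y \<le> dual_growth TM * norm \<zeta> \<and>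
      y \<bullet> x (en j) j = \<zeta> \<bullet> x t j \<and>
      y \<bullet> (P (en j) j *v y) \<le> \<zeta> \<bullet> (P t j *v \<zeta>) \<and>
      \<zeta> \<bullet> (P t j *v \<zeta>) \<le> y \<bullet> (P (en j) j *v y) + flow_cost TM bV * (norm \<zeta>)\<^sup>2 \<and>
      (\<forall>b>0. (\<forall>r\<in>{en j..t}. \<forall>v. v \<bullet> (P r j *v v) \<le> b * (v \<bullet> v)) \<longrightarrow>
        exp (cV / b * (t - en j)) * (y \<bullet> (P (en j) j *v y)) \<le> \<zeta> \<bullet> (P t j *v \<zeta>))"

lemma backward_flow:
  assumes t: "(t, j) \<in> E"
  defines "h \<equiv> t - en j"
  obtains G :: "real^3^3" where "orthogonal_matrix G"
    "\<And>\<zeta>. \<exists>y. y = join3 (G *v blk 1 \<zeta>) (G *v (blk 2 \<zeta> + h *\<^sub>R blk 1 \<zeta>))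
        (G *v (blk 3 \<zeta> + h *\<^sub>R blk 2 \<zeta> + (h\<^sup>2 / 2) *\<^sub>R blk 1 \<zeta>)) \<and>
      backward_step t j \<zeta> y"
proof -
  note le = en_le[OF t]
  obtain G where G: "orthogonal_matrix G" "\<And>\<zeta>. \<exists>y. y t = \<zeta> \<and>
      (\<forall>r\<in>{en j..t}. (y has_vector_derivative - (transpose (A_mat (\<omega> r)) *v y r)) (at r within {en j..t})) \<and>
      (\<forall>r\<in>{en j..t}. norm (y r) \<le> dual_growth TM * norm \<zeta>) \<and>
      y (en j) = join3 (G *v blk 1 \<zeta>) (G *v (blk 2 \<zeta> + h *\<^sub>R blk 1 \<zeta>))
        (G *v (blk 3 \<zeta> + h *\<^sub>R blk 2 \<zeta> + (h\<^sup>2 / 2) *\<^sub>R blk 1 \<zeta>))"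
    using dual_flow[OF continuous_on_\<omega>_interval[OF t] le flow_length[OF t]] unfolding h_def by metis
  show thesis
  proof (rule that[OF G(1)])
    fix \<zeta> :: vec9
    obtain y where y: "y t = \<zeta>"
      "\<And>r. r \<in> {en j..t} \<Longrightarrow> (y has_vector_derivative - (transpose (A_mat (\<omega> r)) *v y r)) (at r within {en j..t})"
      "\<And>r. r \<in> {en j..t} \<Longrightarrow> norm (y r) \<le> dual_growth TM * norm \<zeta>"
      "y (en j) = join3 (G *v blk 1 \<zeta>) (G *v (blk 2 \<zeta> + h *\<^sub>R blk 1 \<zeta>))
        (G *v (blk 3 \<zeta> + h *\<^sub>R blk 2 \<zeta> + (h\<^sup>2 / 2) *\<^sub>R blk 1 \<zeta>))"
      using G(2)[of \<zeta>] by blast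
    have s: "en j \<in> {en j..t}" using le by simp
    have pos: "0 \<le> r" if "r \<in> {en j..t}" for r using that en_nonneg[OF t] by simp
    have "y t \<bullet> x t j = y (en j) \<bullet> x (en j) j"
      by (rule constant_of_zero_derivative[where f="\<lambda>r. y r \<bullet> x r j", OF dual_pairing_derivative[OF y(2) flow_derivatives(3)[OF t]]])
        (use le in auto)
    then have yx: "y (en j) \<bullet> x (en j) j = \<zeta> \<bullet> x t j" by (simp add: y(1))
    define f where "f r = y r \<bullet> (P r j *v y r)" for r
    have f: "(f has_vector_derivative y r \<bullet> (V r *v y r)) (at r within {en j..t})" if "r \<in> {en j..t}" for r
      unfolding f_def by (rule dual_energy_derivative[OF y(2)[OF that] y(2)[OF that] flow_derivatives(5)[OF t that]])
    note fm = has_vector_derivative_minus[OF f]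
    have "- f t \<le> - f (en j) + 0 * (t - en j)"
      by (rule derivative_bound_imp_increment_le[OF le fm]) (use V_psd pos in auto)
    then have inc: "f (en j) \<le> f t" by simp
    have "f t \<le> f (en j) + (bV * (dual_growth TM * norm \<zeta>)\<^sup>2) * (t - en j)"
    proof (rule derivative_bound_imp_increment_le[OF le f])
      fix r assume r: "r \<in> {en j..t}"
      have "y r \<bullet> (V r *v y r) \<le> bV * (norm (y r))\<^sup>2"
        by (rule quadratic_form_le[OF bV[OF pos[OF r]]])
      also have "\<dots> \<le> bV * (dual_growth TM * norm \<zeta>)\<^sup>2"
        using y(3)[OF r] bounds_nonneg by (intro mult_left_mono power_mono) auto
      finally show "y r \<bullet> (V r *v y r) \<le> bV * (dual_growth TM * norm \<zeta>)\<^sup>2" .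
    qed
    also have "\<dots> \<le> f (en j) + (bV * (dual_growth TM * norm \<zeta>)\<^sup>2) * TM"
      using flow_length[OF t] bounds_nonneg by (intro add_left_mono mult_left_mono) auto
    finally have up: "f t \<le> f (en j) + flow_cost TM bV * (norm \<zeta>)\<^sup>2"
      by (simp add: flow_cost_def power_mult_distrib mult_ac)
    have ex: "exp (cV / b * h) * f (en j) \<le> f t"
      if "b > 0" and b: "\<forall>r\<in>{en j..t}. \<forall>v. v \<bullet> (P r j *v v) \<le> b * (v \<bullet> v)" for b
    proof -
      \<comment> \<open>Where \<open>P\<close> is at most \<open>b\<close>, the form of
        \<open>V\<close> at y is at least cV |y|^2, hence at least cV / b times that of
        \<open>P\<close>. Gronwall's inequality applied to \<open>- f\<close> turns this into
        exponential growth of \<open>f\<close>.\<close>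
      have "- f t \<le> exp (cV / b * (t - en j)) * (- f (en j))"
      proof (rule exp_growth_bound[OF le fm])
        fix r assume r: "r \<in> {en j..t}"
        have "cV / b * f r \<le> cV / b * (b * (y r \<bullet> y r))"
          using b r \<open>b > 0\<close> cV(1) unfolding f_def by (intro mult_left_mono) auto
        also have "\<dots> \<le> y r \<bullet> (V r *v y r)" using cV(2)[OF pos[OF r], of "y r"] \<open>b > 0\<close> by simp
        finally show "- (y r \<bullet> (V r *v y r)) \<le> cV / b * - f r" by simp
      qed
      then show ?thesis by (simp add: h_def)
    qed
    show "\<exists>y. y = join3 (G *v blk 1 \<zeta>) (G *v (blk 2 \<zeta> + h *\<^sub>R blk 1 \<zeta>))
        (G *v (blk 3 \<zeta> + h *\<^sub>R blk 2 \<zeta> + (h\<^sup>2 / 2) *\<^sub>R blk 1 \<zeta>)) \<and>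
      backward_step t j \<zeta> y"
      unfolding backward_step_def
    proof (intro exI[of _ "y (en j)"] conjI)
      show "y (en j) \<bullet> (P (en j) j *v y (en j)) \<le> \<zeta> \<bullet> (P t j *v \<zeta>)"
        using inc by (simp add: f_def y(1))
      show "\<zeta> \<bullet> (P t j *v \<zeta>) \<le> y (en j) \<bullet> (P (en j) j *v y (en j)) + flow_cost TM bV * (norm \<zeta>)\<^sup>2"
        using up by (simp add: f_def y(1))
      show "\<forall>b>0. (\<forall>r\<in>{en j..t}. \<forall>v. v \<bullet> (P r j *v v) \<le> b * (v \<bullet> v)) \<longrightarrow>
        exp (cV / b * (t - en j)) * (y (en j) \<bullet> (P (en j) j *v y (en j))) \<le> \<zeta> \<bullet> (P t j *v \<zeta>)"
        using ex by (simp add: f_def y(1) h_def)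
    qed (use y(4) y(3)[OF s] yx in auto)
  qed
qed

lemma backward_step_exists:
  assumes "(t, j) \<in> E"
  obtains y where "backward_step t j \<zeta> y"
  using backward_flow[OF assms] by metis

text \<open>The jump formulas presuppose a symmetric positive semidefinite \<open>P\<close>, so this
  precedes every bound. Along a flow the energy at \<open>\<zeta>\<close> dominates that of an
  adjoint value at the entry; after a jump it is an earlier energy plus a nonnegative
  \<open>Q\<close> term.\<close>

lemma P_symmetric_psd:
  assumes "(t, j) \<in> E"
  shows "transpose (P t j) = P t j \<and> (\<forall>y. 0 \<le> y \<bullet> (P t j *v y))"
  using assms
proof (induction j arbitrary: t)
  have step: "transpose (P t j) = P t j \<and> (\<forall>y. 0 \<le> y \<bullet> (P t j *v y))"
    if t: "(t, j) \<in> E" and "transpose (P (en j) j) = P (en j) j" "\<And>y. 0 \<le> y \<bullet> (P (en j) j *v y)" for t j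
  proof (intro conjI allI)
    show "transpose (P t j) = P t j" by (rule symmetric_flow) fact+
    fix \<zeta>
    obtain y where "backward_step t j \<zeta> y" by (rule backward_step_exists[OF t])
    then have "y \<bullet> (P (en j) j *v y) \<le> \<zeta> \<bullet> (P t j *v \<zeta>)" by (simp add: backward_step_def)
    then show "0 \<le> \<zeta> \<bullet> (P t j *v \<zeta>)" using that(3)[of y] by linarith
  qed
  {
    case 0
    show ?case by (rule step) (use 0 P0_sym P0_psd in \<open>simp_all add: en_0\<close>)
  }
  case (Suc j)
  let ?r = "en (Suc j)"
  have in_j: "(?r, j) \<in> E" by (rule en_Suc_in[OF Suc.prems])
  have r: "0 \<le> ?r" by (rule en_nonneg[OF Suc.prems])
  note sym = Suc.IH[OF in_j, THEN conjunct1] and psd = Suc.IH[OF in_j, THEN conjunct2, rule_format]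
  note Pj = jump(6)[OF Suc.prems]
  show ?case
  proof (rule step[OF Suc.prems])
    show "transpose (P ?r (Suc j)) = P ?r (Suc j)"
      unfolding Pj by (rule transpose_riccati_jump[OF sym psd Q_sym[OF r] cQ(1) cQ(2)[OF r]])
    fix y
    obtain u where u: "y \<bullet> (riccati_jump (Q ?r) (P ?r j) *v y) =
      (y - transpose C_mat *v u) \<bullet> (P ?r j *v (y - transpose C_mat *v u)) + u \<bullet> (Q ?r *v u)"
      by (rule riccati_jump_dual[OF sym psd Q_sym[OF r] cQ(1) cQ(2)[OF r], of y]) blast
    have "0 \<le> u \<bullet> (Q ?r *v u)"
      using cQ(2)[OF r, of u] cQ(1) by (meson inner_ge_zero less_imp_le mult_nonneg_nonneg order_trans)
    then show "0 \<le> y \<bullet> (P ?r (Suc j) *v y)"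
      unfolding Pj u using psd by simp
  qed
qed

text \<open>Two uses of the same minimisation: an arbitrary \<open>u\<close> bounds the new energy
  from above, as steering needs, and the optimal \<open>u\<close> transports the pairing with
  \<open>x\<close> to before the jump without raising the energy, as decay needs.\<close>

lemma backward_jump:
  assumes t: "(t, Suc j) \<in> E"
  defines "r \<equiv> en (Suc j)"
  shows jump_cost_le: "y \<bullet> (P r (Suc j) *v y) \<le>
      join3 (blk 1 y - u) (blk 2 y) (blk 3 y) \<bullet> (P r j *v join3 (blk 1 y - u) (blk 2 y) (blk 3 y)) +
      bQ * (norm u)\<^sup>2"
    and jump_dual: "\<exists>z. z \<bullet> (P r j *v z) \<le> y \<bullet> (P r (Suc j) *v y) \<and> z \<bullet> x r j = y \<bullet> x r (Suc j)"
proof -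
  have in_j: "(r, j) \<in> E" unfolding r_def by (rule en_Suc_in[OF t])
  have r: "0 \<le> r" unfolding r_def by (rule en_nonneg[OF t])
  note sym = P_symmetric_psd[OF in_j, THEN conjunct1] and psd = P_symmetric_psd[OF in_j, THEN conjunct2, rule_format]
  note Pj = jump(6)[OF t, folded r_def] and xj = jump(5)[OF t, folded r_def]
  have "y \<bullet> (P r (Suc j) *v y) \<le>
      join3 (blk 1 y - u) (blk 2 y) (blk 3 y) \<bullet> (P r j *v join3 (blk 1 y - u) (blk 2 y) (blk 3 y)) + u \<bullet> (Q r *v u)"
    using riccati_jump_le[OF sym psd Q_sym[OF r] cQ(1) cQ(2)[OF r], of y u]
    unfolding Pj diff_transpose_C_mat by simp
  then show "y \<bullet> (P r (Suc j) *v y) \<le>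
      join3 (blk 1 y - u) (blk 2 y) (blk 3 y) \<bullet> (P r j *v join3 (blk 1 y - u) (blk 2 y) (blk 3 y)) +
      bQ * (norm u)\<^sup>2"
    using quadratic_form_le[OF bQ[OF r], of u] by linarith
  obtain u where u: "y \<bullet> (riccati_jump (Q r) (P r j) *v y) =
      (y - transpose C_mat *v u) \<bullet> (P r j *v (y - transpose C_mat *v u)) + u \<bullet> (Q r *v u)"
    "\<And>x. y \<bullet> ((mat 1 - gain (P r j) (Q r) ** C_mat) *v x) = (y - transpose C_mat *v u) \<bullet> x"
    by (rule riccati_jump_dual[OF sym psd Q_sym[OF r] cQ(1) cQ(2)[OF r], of y]) blast
  have "0 \<le> u \<bullet> (Q r *v u)"
    using cQ(2)[OF r, of u] cQ(1) by (meson inner_ge_zero less_imp_le mult_nonneg_nonneg order_trans)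
  then show "\<exists>z. z \<bullet> (P r j *v z) \<le> y \<bullet> (P r (Suc j) *v y) \<and> z \<bullet> x r j = y \<bullet> x r (Suc j)"
    by (intro exI[of _ "y - transpose C_mat *v u"]) (simp add: Pj xj u)
qed

section \<open>Uniform upper bound on the Riccati solution\<close>

lemma flow_cost_nonneg: "0 \<le> flow_cost TM bV"
  using bounds_nonneg TM_pos by (simp add: flow_cost_def)

lemma flow_cost_step:
  assumes t: "(t, j) \<in> E" and b: "\<And>y. y \<bullet> (P (en j) j *v y) \<le> b * (norm y)\<^sup>2" and "0 \<le> b"
  shows "\<zeta> \<bullet> (P t j *v \<zeta>) \<le> (b * (dual_growth TM)\<^sup>2 + flow_cost TM bV) * (norm \<zeta>)\<^sup>2"
proof -
  obtain y where y: "norm y \<le> dual_growth TM * norm \<zeta>"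
      "\<zeta> \<bullet> (P t j *v \<zeta>) \<le> y \<bullet> (P (en j) j *v y) + flow_cost TM bV * (norm \<zeta>)\<^sup>2"
    using backward_step_exists[OF t] unfolding backward_step_def by metis
  have "y \<bullet> (P (en j) j *v y) \<le> b * (norm y)\<^sup>2" by (rule b)
  also have "\<dots> \<le> b * (dual_growth TM * norm \<zeta>)\<^sup>2"
    using y(1) \<open>0 \<le> b\<close> by (intro mult_left_mono power_mono) auto
  finally show ?thesis using y(2) by (simp add: power_mult_distrib algebra_simps)
qed

lemma jump_cost_step:
  assumes t: "(t, Suc j) \<in> E" and b: "\<And>y. y \<bullet> (P (en (Suc j)) j *v y) \<le> b * (norm y)\<^sup>2"
  shows "y \<bullet> (P (en (Suc j)) (Suc j) *v y) \<le> b * (norm y)\<^sup>2"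
  using jump_cost_le[OF t, of y 0] b[of y] by simp

text \<open>Backwards in time, corrections at the jumps \<open>r3\<close>, \<open>r2\<close>,
  \<open>r1\<close> change block 1 only, and the flows of lengths \<open>h1\<close> and
  \<open>h2\<close> in between carry it into blocks 2 and 3. Setting block 1 to
  \<open>\<alpha>\<close> and then to \<open>\<beta>\<close> makes blocks 2 and 3 vanish at
  \<open>r1\<close>, where the third correction removes block 1. No earlier value of
  \<open>P\<close> survives in the cost, and \<open>Tm\<close>, a lower bound for \<open>h1\<close>
  and \<open>h2\<close>, keeps the corrections bounded.\<close>

lemma deadbeat_cost:
  assumes t: "(t, Suc (Suc (Suc j))) \<in> E"
  shows "\<zeta> \<bullet> (P t (Suc (Suc (Suc j))) *v \<zeta>) \<le>
    3 * (flow_cost TM bV + bQ) * (deadbeat_growth Tm TM)\<^sup>2 * (norm \<zeta>)\<^sup>2"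
proof -
  define K where "K = dual_growth TM"
  define D where "D = flow_cost TM bV"
  have K: "1 \<le> K" unfolding K_def by (rule K_ge_1)
  have D: "0 \<le> D" unfolding D_def by (rule flow_cost_nonneg)
  define r3 where "r3 = en (Suc (Suc (Suc j)))"
  define r2 where "r2 = en (Suc (Suc j))"
  define r1 where "r1 = en (Suc j)"
  have t2: "(r3, Suc (Suc j)) \<in> E" unfolding r3_def by (rule en_Suc_in[OF t])
  have t1: "(r2, Suc j) \<in> E" unfolding r2_def by (rule en_Suc_in[OF t2])
  define h1 where "h1 = r3 - r2"
  define h2 where "h2 = r2 - r1"
  have h1: "Tm \<le> h1" "h1 \<le> TM"
    using jump_interval[OF t] flow_length[OF t2] by (auto simp: h1_def r3_def r2_def)
  have h2: "Tm \<le> h2" "h2 \<le> TM"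
    using jump_interval[OF t2] flow_length[OF t1] by (auto simp: h2_def r2_def r1_def)
  have h: "0 < h1" "0 < h2" using h1 h2 Tm by auto
  define ka where "ka = (1 + 2 * TM) / Tm\<^sup>2"
  have ka: "0 \<le> ka" using TM_pos by (simp add: ka_def)
  define n where "n = norm \<zeta>"
  obtain y3 where y3: "norm y3 \<le> K * n"
    "\<zeta> \<bullet> (P t (Suc (Suc (Suc j))) *v \<zeta>) \<le> y3 \<bullet> (P r3 (Suc (Suc (Suc j))) *v y3) + D * n\<^sup>2"
    using backward_step_exists[OF t] unfolding backward_step_def K_def D_def r3_def n_def by metis
  define b where "b = blk 2 y3"
  define c where "c = blk 3 y3"
  \<comment> \<open>With \<open>\<beta>\<close> eliminated, block 3 at \<open>r1\<close> is, up to
    rotations, c + (h1 + h2 / 2) b + (h1 (h1 + h2) / 2) \<alpha>; this choice makes it zero.\<close>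
  define \<alpha> where "\<alpha> = - (2 / (h1 * (h1 + h2))) *\<^sub>R (c + (h1 + h2 / 2) *\<^sub>R b)"
  define u3 where "u3 = blk 1 y3 - \<alpha>"
  define z2 where "z2 = join3 \<alpha> b c"
  have bc: "norm (blk 1 y3) \<le> norm y3" "norm b \<le> norm y3" "norm c \<le> norm y3"
    using norm_blk_le by (auto simp: b_def c_def)
  have \<alpha>: "norm \<alpha> \<le> ka * norm y3"
  proof -
    have "Tm * (Tm + Tm) \<le> h1 * (h1 + h2)" using h1 h2 Tm by (intro mult_mono add_mono) auto
    then have q: "2 / (h1 * (h1 + h2)) \<le> 1 / Tm\<^sup>2"
      using Tm h by (simp add: power2_eq_square frac_le divide_simps mult_pos_pos)
    have "norm (c + (h1 + h2 / 2) *\<^sub>R b) \<le> norm c + norm ((h1 + h2 / 2) *\<^sub>R b)" by (rule norm_triangle_ineq)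
    also have "\<dots> = norm c + (h1 + h2 / 2) * norm b" using h by simp
    also have "\<dots> \<le> norm y3 + (2 * TM) * norm y3"
      using bc h1 h2 h TM_pos by (intro add_mono mult_mono) auto
    also have "\<dots> = (1 + 2 * TM) * norm y3" by (simp add: algebra_simps)
    finally have "2 / (h1 * (h1 + h2)) * norm (c + (h1 + h2 / 2) *\<^sub>R b) \<le> 1 / Tm\<^sup>2 * ((1 + 2 * TM) * norm y3)"
      using q by (intro mult_mono) auto
    moreover have "norm \<alpha> = 2 / (h1 * (h1 + h2)) * norm (c + (h1 + h2 / 2) *\<^sub>R b)"
      using h by (simp add: \<alpha>_def)
    ultimately show ?thesis by (simp add: ka_def)
  qed
  have c3: "y3 \<bullet> (P r3 (Suc (Suc (Suc j))) *v y3) \<le> z2 \<bullet> (P r3 (Suc (Suc j)) *v z2) + bQ * (norm u3)\<^sup>2"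
    using jump_cost_le[OF t, of y3 u3] by (simp add: u3_def z2_def b_def c_def r3_def)
  have nz2: "norm z2 \<le> (2 + ka) * norm y3" and nu3: "norm u3 \<le> (2 + ka) * norm y3"
    using norm_join3_le[of \<alpha> b c] norm_triangle_ineq4[of "blk 1 y3" \<alpha>] \<alpha> bc norm_ge_zero[of y3]
    unfolding z2_def u3_def distrib_right by linarith+
  obtain G y2 where y2: "y2 = join3 (G *v blk 1 z2) (G *v (blk 2 z2 + h1 *\<^sub>R blk 1 z2))
        (G *v (blk 3 z2 + h1 *\<^sub>R blk 2 z2 + (h1\<^sup>2 / 2) *\<^sub>R blk 1 z2))"
    and "backward_step r3 (Suc (Suc j)) z2 y2"
    using backward_flow[OF t2] unfolding r2_def h1_def by metis
  then have y2': "norm y2 \<le> K * norm z2"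
    "z2 \<bullet> (P r3 (Suc (Suc j)) *v z2) \<le> y2 \<bullet> (P r2 (Suc (Suc j)) *v y2) + D * (norm z2)\<^sup>2"
    by (simp_all add: backward_step_def K_def D_def r2_def)
  \<comment> \<open>Makes \<open>blk 2 y2 + h2 *\<^sub>R \<beta>\<close> zero, so that block 2
    vanishes at the end of the second backward flow.\<close>
  define \<beta> where "\<beta> = - (1 / h2) *\<^sub>R blk 2 y2"
  define u2 where "u2 = blk 1 y2 - \<beta>"
  define z1 where "z1 = join3 \<beta> (blk 2 y2) (blk 3 y2)"
  have c2: "y2 \<bullet> (P r2 (Suc (Suc j)) *v y2) \<le> z1 \<bullet> (P r2 (Suc j) *v z1) + bQ * (norm u2)\<^sup>2"
    using jump_cost_le[OF t2, of y2 u2] by (simp add: u2_def z1_def r2_def)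
  have bc2: "norm (blk 1 y2) \<le> norm y2" "norm (blk 2 y2) \<le> norm y2" "norm (blk 3 y2) \<le> norm y2"
    using norm_blk_le by auto
  have \<beta>: "norm \<beta> \<le> 1 / Tm * norm y2"
  proof -
    have "norm \<beta> = 1 / h2 * norm (blk 2 y2)" using h by (simp add: \<beta>_def)
    also have "\<dots> \<le> 1 / Tm * norm y2"
      using bc2 h2 Tm by (intro mult_mono divide_left_mono) auto
    finally show ?thesis .
  qed
  have nz1: "norm z1 \<le> (2 + 1 / Tm) * norm y2" and nu2: "norm u2 \<le> (2 + 1 / Tm) * norm y2"
    using norm_join3_le[of \<beta> "blk 2 y2" "blk 3 y2"] norm_triangle_ineq4[of "blk 1 y2" \<beta>] \<beta> bc2 norm_ge_zero[of y2]
    unfolding z1_def u2_def distrib_right by linarith+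
  obtain G' y1 where y1: "y1 = join3 (G' *v blk 1 z1) (G' *v (blk 2 z1 + h2 *\<^sub>R blk 1 z1))
        (G' *v (blk 3 z1 + h2 *\<^sub>R blk 2 z1 + (h2\<^sup>2 / 2) *\<^sub>R blk 1 z1))"
    and "backward_step r2 (Suc j) z1 y1"
    using backward_flow[OF t1] unfolding r1_def h2_def by metis
  then have y1': "norm y1 \<le> K * norm z1"
    "z1 \<bullet> (P r2 (Suc j) *v z1) \<le> y1 \<bullet> (P r1 (Suc j) *v y1) + D * (norm z1)\<^sup>2"
    by (simp_all add: backward_step_def K_def D_def r1_def)
  have "blk 2 z1 + h2 *\<^sub>R blk 1 z1 = 0" using h by (simp add: z1_def \<beta>_def)
  then have y1_2: "blk 2 y1 = 0" by (simp add: y1)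
  have "blk 3 z1 + h2 *\<^sub>R blk 2 z1 + (h2\<^sup>2 / 2) *\<^sub>R blk 1 z1 = blk 3 y2 + (h2 / 2) *\<^sub>R blk 2 y2"
  proof -
    have "(h2\<^sup>2 / 2) *\<^sub>R \<beta> = - (h2 / 2) *\<^sub>R blk 2 y2" using h by (simp add: \<beta>_def power2_eq_square)
    moreover have "h2 *\<^sub>R blk 2 y2 = (h2 / 2) *\<^sub>R blk 2 y2 + (h2 / 2) *\<^sub>R blk 2 y2"
      by (simp flip: scaleR_add_left)
    ultimately show ?thesis by (simp add: z1_def)
  qed
  \<comment> \<open>The same orthogonal matrix acts on all blocks, so it factors out, and
    \<open>\<alpha>\<close> can be chosen without knowing it.\<close>
  also have "\<dots> = G *v (c + h1 *\<^sub>R b + (h1\<^sup>2 / 2) *\<^sub>R \<alpha> + (h2 / 2) *\<^sub>R (b + h1 *\<^sub>R \<alpha>))"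
    by (simp add: y2 z2_def matrix_vector_right_distrib matrix_vector_mult_scaleR)
  also have "c + h1 *\<^sub>R b + (h1\<^sup>2 / 2) *\<^sub>R \<alpha> + (h2 / 2) *\<^sub>R (b + h1 *\<^sub>R \<alpha>) =
      (c + (h1 + h2 / 2) *\<^sub>R b) + (h1 * (h1 + h2) / 2) *\<^sub>R \<alpha>"
    by (simp add: vec_eq_iff field_simps power2_eq_square)
  also have "(h1 * (h1 + h2) / 2) *\<^sub>R \<alpha> = - (c + (h1 + h2 / 2) *\<^sub>R b)"
    using h by (simp add: \<alpha>_def)
  finally have y1_3: "blk 3 y1 = 0" by (simp add: y1)
  have "y1 \<bullet> (P r1 (Suc j) *v y1) \<le> 0 + bQ * (norm (blk 1 y1))\<^sup>2"
  proof -
    have "join3 0 0 0 = 0" by (simp add: blk_eq_iff blk_linear_simps)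
    then show ?thesis
      using jump_cost_le[OF t1, of y1 "blk 1 y1"] y1_2 y1_3 by (simp add: r1_def)
  qed
  then have c1: "y1 \<bullet> (P r1 (Suc j) *v y1) \<le> bQ * (norm y1)\<^sup>2"
    using mult_left_mono[OF power_mono[OF norm_blk_le[of 1 y1] norm_ge_zero, of 2] bounds_nonneg(2)] by linarith
  define a where "a = 2 + ka"
  define a' where "a' = 2 + 1 / Tm"
  have a: "1 \<le> a" "1 \<le> a'" using ka Tm by (auto simp: a_def a'_def)
  define m where "m = K ^ 3 * a * a'"
  have m_eq: "m = deadbeat_growth Tm TM" by (simp add: m_def deadbeat_growth_def K_def a_def a'_def ka_def)
  \<comment> \<open>Bounds for the vectors after each stage: \<open>s1\<close> for \<open>z2\<close>
    and \<open>u3\<close>, \<open>s2\<close> for \<open>z1\<close> and \<open>u2\<close>,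
    \<open>s3\<close> for \<open>y1\<close>. They increase, so each of the six cost terms is bounded
    through \<open>s3\<close>, which is \<open>deadbeat_growth\<close> times the norm of
    \<open>\<zeta>\<close>.\<close>
  define s1 where "s1 = a * (K * n)"
  define s2 where "s2 = a' * (K * s1)"
  define s3 where "s3 = K * s2"
  have n0: "0 \<le> n" by (simp add: n_def)
  have ge: "v \<le> w * v" if "1 \<le> w" "0 \<le> v" for v w :: real
    using mult_right_mono[OF that] by simp
  have ns: "n \<le> s1" "s1 \<le> s2" "s2 \<le> s3" "0 \<le> s1" "0 \<le> s2" "0 \<le> s3"
  proof -
    have "n \<le> K * n" "K * n \<le> s1" unfolding s1_def using K a n0 by (auto intro!: ge)
    then show 1: "n \<le> s1" "0 \<le> s1" using n0 by auto
    have "s1 \<le> K * s1" "K * s1 \<le> s2" unfolding s2_def using K a 1 by (auto intro!: ge)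
    then show 2: "s1 \<le> s2" "0 \<le> s2" using 1 by auto
    show "s2 \<le> s3" unfolding s3_def using K 2 by (intro ge)
    then show "0 \<le> s3" using 2 by simp
  qed
  have s3: "s3 = m * n" by (simp add: s3_def s2_def s1_def m_def power3_eq_cube mult_ac)
  have "a * norm y3 \<le> s1" unfolding s1_def using y3(1) a by (intro mult_left_mono) auto
  then have n2: "norm z2 \<le> s1" "norm u3 \<le> s1" using nz2 nu3 by (auto simp: a_def)
  have "norm y2 \<le> K * s1" using y2'(1) mult_left_mono[OF n2(1), of K] K by linarith
  then have "a' * norm y2 \<le> s2" unfolding s2_def using a by (intro mult_left_mono) auto
  then have n1: "norm z1 \<le> s2" "norm u2 \<le> s2" using nz1 nu2 by (auto simp: a'_def)
  have n0': "norm y1 \<le> s3" unfolding s3_def using y1'(1) mult_left_mono[OF n1(1), of K] K by linarith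
  have sq: "d * v\<^sup>2 \<le> d * s3\<^sup>2" if "0 \<le> v" "v \<le> s3" "0 \<le> d" for v d
    using that by (intro mult_left_mono power_mono) auto
  have "\<zeta> \<bullet> (P t (Suc (Suc (Suc j))) *v \<zeta>) \<le>
      D * n\<^sup>2 + bQ * (norm u3)\<^sup>2 + D * (norm z2)\<^sup>2 + bQ * (norm u2)\<^sup>2 + D * (norm z1)\<^sup>2 + bQ * (norm y1)\<^sup>2"
    using y3(2) c3 y2'(2) c2 y1'(2) c1 by linarith
  also have "\<dots> \<le> D * s3\<^sup>2 + bQ * s3\<^sup>2 + D * s3\<^sup>2 + bQ * s3\<^sup>2 + D * s3\<^sup>2 + bQ * s3\<^sup>2"
    using n0 n2 n1 n0' ns D bounds_nonneg by (intro add_mono sq) auto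
  also have "\<dots> = 3 * (D + bQ) * m\<^sup>2 * n\<^sup>2" by (simp add: s3 power_mult_distrib algebra_simps)
  finally show ?thesis by (simp add: D_def m_eq n_def)
qed

lemma riccati_bounded:
  assumes "(t, j) \<in> E"
  shows "\<zeta> \<bullet> (P t j *v \<zeta>) \<le> riccati_bound Tm TM bV bQ b0 * (norm \<zeta>)\<^sup>2"
proof -
  define c where "c b = b * (dual_growth TM)\<^sup>2 + flow_cost TM bV" for b
  define d where "d = 3 * (flow_cost TM bV + bQ) * (deadbeat_growth Tm TM)\<^sup>2"
  have c: "0 \<le> c b" if "0 \<le> b" for b using that flow_cost_nonneg by (simp add: c_def)
  have nn: "0 \<le> c b0" "0 \<le> c (c b0)" "0 \<le> c (c (c b0))" "0 \<le> d"
    using c bounds_nonneg flow_cost_nonneg by (auto simp: d_def)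
  have B: "riccati_bound Tm TM bV bQ b0 = c b0 + c (c b0) + c (c (c b0)) + d"
    by (simp add: riccati_bound_def Let_def c_def d_def)
  have 0: "y \<bullet> (P t 0 *v y) \<le> c b0 * (norm y)\<^sup>2" if "(t, 0) \<in> E" for t y
    unfolding c_def using flow_cost_step[OF that, of b0] quadratic_form_le[OF b0] bounds_nonneg by (simp add: en_0)
  have S: "y \<bullet> (P t (Suc j) *v y) \<le> c b * (norm y)\<^sup>2"
    if "(t, Suc j) \<in> E" "\<And>t y. (t, j) \<in> E \<Longrightarrow> y \<bullet> (P t j *v y) \<le> b * (norm y)\<^sup>2" "0 \<le> b" for t j y b
    unfolding c_def using that en_Suc_in[OF that(1)]
    by (intro flow_cost_step jump_cost_step) auto
  have 1: "y \<bullet> (P t (Suc 0) *v y) \<le> c (c b0) * (norm y)\<^sup>2" if "(t, Suc 0) \<in> E" for t y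
    using S[OF that 0] nn by simp
  have 2: "y \<bullet> (P t (Suc (Suc 0)) *v y) \<le> c (c (c b0)) * (norm y)\<^sup>2" if "(t, Suc (Suc 0)) \<in> E" for t y
    using S[OF that 1] nn by simp
  consider "j = 0" | "j = Suc 0" | "j = Suc (Suc 0)" | i where "j = Suc (Suc (Suc i))"
    by (metis not0_implies_Suc)
  then have "\<exists>b\<in>{c b0, c (c b0), c (c (c b0)), d}. \<zeta> \<bullet> (P t j *v \<zeta>) \<le> b * (norm \<zeta>)\<^sup>2"
  proof cases
    case 4
    then show ?thesis using deadbeat_cost assms unfolding d_def by blast
  qed (use 0 1 2 assms in auto)
  then obtain b where b: "b \<in> {c b0, c (c b0), c (c (c b0)), d}" "\<zeta> \<bullet> (P t j *v \<zeta>) \<le> b * (norm \<zeta>)\<^sup>2"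
    by blast
  have "b \<le> riccati_bound Tm TM bV bQ b0" using b(1) nn unfolding B by auto
  with b(2) show ?thesis by (meson mult_right_mono order_trans zero_le_power2)
qed

text \<open>Each flow contributes the exponential of its duration and a backward jump does not raise
  the energy; over all intervals the exponents add up to \<open>t\<close>. The uniform bound on
  \<open>P\<close> is what activates the last conjunct of \<open>backward_step\<close>.\<close>

lemma backward_decay:
  assumes "(t, j) \<in> E" and b: "riccati_bound Tm TM bV bQ b0 \<le> b" "0 < b"
  shows "\<exists>y. y \<bullet> x 0 0 = \<zeta> \<bullet> x t j \<and> exp (cV / b * t) * (y \<bullet> (P 0 0 *v y)) \<le> \<zeta> \<bullet> (P t j *v \<zeta>)"
  using assms(1)
proof (induction j arbitrary: t \<zeta>)
  have flow: "\<exists>y. y \<bullet> x (en j) j = \<zeta> \<bullet> x t j \<and>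
      exp (cV / b * (t - en j)) * (y \<bullet> (P (en j) j *v y)) \<le> \<zeta> \<bullet> (P t j *v \<zeta>)" if t: "(t, j) \<in> E" for t j \<zeta>
  proof -
    have "v \<bullet> (P r j *v v) \<le> b * (v \<bullet> v)" if "r \<in> {en j..t}" for r v
    proof -
      have "(r, j) \<in> E" using that between[OF t] by simp
      then have "v \<bullet> (P r j *v v) \<le> riccati_bound Tm TM bV bQ b0 * (norm v)\<^sup>2" by (rule riccati_bounded)
      also have "\<dots> \<le> b * (norm v)\<^sup>2" using b by (intro mult_right_mono) auto
      finally show ?thesis by (simp add: power2_norm_eq_inner)
    qed
    moreover obtain y where "backward_step t j \<zeta> y" by (rule backward_step_exists[OF t])
    ultimately show ?thesis using \<open>0 < b\<close> unfolding backward_step_def by blast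
  qed
  {
    case 0
    show ?case using flow[OF 0] by (simp add: en_0)
  next
    case (Suc j)
    let ?r = "en (Suc j)"
    have in_j: "(?r, j) \<in> E" by (rule en_Suc_in[OF Suc.prems])
    obtain y where y: "y \<bullet> x ?r (Suc j) = \<zeta> \<bullet> x t (Suc j)"
      "exp (cV / b * (t - ?r)) * (y \<bullet> (P ?r (Suc j) *v y)) \<le> \<zeta> \<bullet> (P t (Suc j) *v \<zeta>)"
      using flow[OF Suc.prems] by blast
    obtain z where z: "z \<bullet> (P ?r j *v z) \<le> y \<bullet> (P ?r (Suc j) *v y)" "z \<bullet> x ?r j = y \<bullet> x ?r (Suc j)"
      using jump_dual[OF Suc.prems] by blast
    obtain w where w: "w \<bullet> x 0 0 = z \<bullet> x ?r j" "exp (cV / b * ?r) * (w \<bullet> (P 0 0 *v w)) \<le> z \<bullet> (P ?r j *v z)"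
      using Suc.IH[OF in_j] by blast
    have "exp (cV / b * (t - ?r)) * (exp (cV / b * ?r) * (w \<bullet> (P 0 0 *v w))) \<le>
        exp (cV / b * (t - ?r)) * (y \<bullet> (P ?r (Suc j) *v y))"
      using w z by (intro mult_left_mono) auto
    also have "\<dots> \<le> \<zeta> \<bullet> (P t (Suc j) *v \<zeta>)" by (rule y(2))
    also have "exp (cV / b * (t - ?r)) * (exp (cV / b * ?r) * (w \<bullet> (P 0 0 *v w))) =
        exp (cV / b * t) * (w \<bullet> (P 0 0 *v w))"
      by (simp add: right_diff_distrib flip: mult.assoc exp_add)
    finally show ?case using w(1) z(2) y(1) by auto
  }
qed

text \<open>Take \<open>\<zeta> = x t j\<close>. Then |x|^2 = y . x0 is at most |y| |x0|, and p
  |y|^2 is at most y . P0 y, which is at most b |x|^2 times the decaying exponential. Solving for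
  |x| takes a square root, which halves the rate.\<close>

lemma x_decay:
  assumes t: "(t, j) \<in> E" and b: "riccati_bound Tm TM bV bQ b0 \<le> b" "0 < b"
    and p: "0 < p" "\<And>y. p * (y \<bullet> y) \<le> y \<bullet> (P 0 0 *v y)"
  shows "norm (x t j) \<le> sqrt (b / p) * exp (- (cV / b / 2) * t) * norm (x 0 0)"
proof -
  let ?e = "exp (cV / b * t)"
  obtain y where y: "y \<bullet> x 0 0 = x t j \<bullet> x t j" "?e * (y \<bullet> (P 0 0 *v y)) \<le> x t j \<bullet> (P t j *v x t j)"
    using backward_decay[OF t b] by blast
  have "?e * (p * (norm y)\<^sup>2) \<le> ?e * (y \<bullet> (P 0 0 *v y))"
    using p(2)[of y] by (intro mult_left_mono) (auto simp: power2_norm_eq_inner)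
  also have "\<dots> \<le> b * (norm (x t j))\<^sup>2"
    using y(2) riccati_bounded[OF t, of "x t j"] mult_right_mono[OF b(1) zero_le_power2[of "norm (x t j)"]] by linarith
  finally have "(norm y)\<^sup>2 \<le> b / p * exp (- (cV / b * t)) * (norm (x t j))\<^sup>2"
    using p(1) by (simp add: exp_minus field_simps)
  also have "\<dots> = (sqrt (b / p) * exp (- (cV / b / 2) * t) * norm (x t j))\<^sup>2"
    using p(1) b(2) by (simp add: power_mult_distrib flip: exp_double)
  finally have "norm y \<le> sqrt (b / p) * exp (- (cV / b / 2) * t) * norm (x t j)"
    by (rule power2_le_imp_le) (use p b in simp)
  then have "norm y * norm (x 0 0) \<le> sqrt (b / p) * exp (- (cV / b / 2) * t) * norm (x t j) * norm (x 0 0)"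
    by (rule mult_right_mono) simp
  then have "norm (x t j) * norm (x t j) \<le> norm (x t j) * (sqrt (b / p) * exp (- (cV / b / 2) * t) * norm (x 0 0))"
    using y(1) norm_cauchy_schwarz[of y "x 0 0"] by (simp add: dot_square_norm power2_eq_square mult_ac)
  then show ?thesis
    by (cases "x t j = 0") (use p b in simp, metis mult_left_le_imp_le zero_less_norm_iff)
qed

end

section \<open>The attitude observer\<close>

lemma vector_derivative_bound_imp_increment_le:
  fixes f :: "real \<Rightarrow> 'a::real_normed_vector"
  assumes "a \<le> b"
    and der: "\<And>t. t \<in> {a..b} \<Longrightarrow> (f has_vector_derivative f' t) (at t within {a..b})"
    and le: "\<And>t. t \<in> {a..b} \<Longrightarrow> norm (f' t) \<le> B"
  shows "norm (f b - f a) \<le> B * (b - a)"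
proof -
  have "norm (f b - f a) \<le> B * norm (b - a)"
  proof (rule differentiable_bound[where S="{a..b}"])
    show "\<And>x. x \<in> {a..b} \<Longrightarrow> (f has_derivative (\<lambda>h. h *\<^sub>R f' x)) (at x within {a..b})"
      using der by (simp add: has_vector_derivative_def)
    show "\<And>x. x \<in> {a..b} \<Longrightarrow> onorm (\<lambda>h. h *\<^sub>R f' x) \<le> B"
      using le by (intro onorm_le) (simp add: mult.commute[of B] mult_left_mono)
  qed (use assms in auto)
  then show ?thesis using \<open>a \<le> b\<close> by simp
qed

text \<open>Only the skew-symmetric part of \<open>B\<close> contributes to the trace. This is why
  \<open>psi (M ** R)\<close> is the gradient of the attitude potential.\<close>

lemma trace_mult_skew_eq_psi: "trace (B ** skew v) = - 2 * (psi B \<bullet> v)"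
  by (simp add: trace_def matrix_matrix_mult_def sum_3 skew_component inner_vec_def psi_component field_simps)

lemma linear_psi_mult: "linear (\<lambda>B. psi (M ** B))"
  using linear_compose[OF bounded_linear.linear[OF bounded_bilinear.bounded_linear_right[OF bounded_bilinear_matrix_matrix_mult]]
      bounded_linear.linear[OF bounded_linear_psi]]
  by (simp add: o_def)

text \<open>The guaranteed fractional loss of potential between consecutive jumps. For d at most e1,
  the squared gradient is at least 4 l^2 d^2 (1 - e1^2), and the potential is at most 4 L d^2; their
  quotient is multiplied by the gain and the minimal duration.\<close>

definition attitude_rate :: "real \<Rightarrow> real \<Rightarrow> real \<Rightarrow> real \<Rightarrow> real \<Rightarrow> real" where
  "attitude_rate kR Tm l L e1 = kR * Tm * (l\<^sup>2 * (1 - e1\<^sup>2) / L)"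

text \<open>The last summand serves the interval before the first jump, the product all later ones.
  There 1 + 8 kR^2 c^2 accounts for \<eta>, 4 l and 4 L compare potential and distance, 2 (1 + 4
  TM^2) is the growth during the first flow, and the exponential makes up for the first jump, which
  brings no contraction.\<close>

definition attitude_gain :: "real \<Rightarrow> real \<Rightarrow> real \<Rightarrow> real \<Rightarrow> real \<Rightarrow> real \<Rightarrow> real \<Rightarrow> real" where
  "attitude_gain kR Tm TM l L c e1 =
     (1 + 8 * kR\<^sup>2 * c\<^sup>2) / (4 * l) * (4 * L) * (2 * (1 + 4 * TM\<^sup>2)) * exp (attitude_rate kR Tm l L e1) +
     3 * (1 + 4 * TM\<^sup>2)"

text \<open>\<open>e1\<close> bounds the distance to the identity at jumps and \<open>e2\<close> in
  between, both below the value 1 of straight angles. The bound on \<open>kR\<close> serves twice: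
  it limits the drift of the distance to \<open>e2 - e1\<close>, and, as this is less than 1, the
  drift of the gradient to half its sampled value. \<open>init\<close> includes the drift caused by
  the initial \<open>\<eta>\<close>.\<close>

locale attitude_observer = error_solution +
  fixes l L c e1 e2 :: real
  assumes l: "0 < l" "\<And>v. l * (v \<bullet> v) \<le> v \<bullet> (Mbar N lm k *v v)"
    and L: "\<And>v. v \<bullet> (Mbar N lm k *v v) \<le> L * (v \<bullet> v)"
    and c: "0 < c" "\<And>B. norm (psi (M_mat N lm k ** B)) \<le> c * norm B"
    and e: "0 < e1" "e1 < e2" "e2 < 1"
    and kR: "0 < kR" "8 * TM * c * kR \<le> e2 - e1"
    and init: "rot_dist (R 0 0) + 2 * TM * norm (\<eta> 0 0) \<le> e1 * sqrt (l / L)"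
begin

abbreviation "M \<equiv> M_mat N lm k"

definition "pot t j = trace (M ** (mat 1 - R t j))"

lemma TM_pos: "0 < TM"
  using Tm by simp

lemma L_ge_l: "l \<le> L"
  using l(2)[of "axis 1 1"] L[of "axis 1 1"] by (simp add: inner_axis_axis)

lemma kR_small: "8 * TM * c * kR \<le> 1" "0 \<le> TM * c * kR"
  using kR e TM_pos c by auto

lemma potential_bounds:
  assumes "(t, j) \<in> E" "rot_dist (R t j) < 1"
  shows "4 * l * (rot_dist (R t j))\<^sup>2 \<le> pot t j" "pot t j \<le> 4 * L * (rot_dist (R t j))\<^sup>2"
    "4 * l\<^sup>2 * (rot_dist (R t j))\<^sup>2 * (1 - (rot_dist (R t j))\<^sup>2) \<le> (norm (psi (M ** R t j)))\<^sup>2"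
  unfolding pot_def
  using attitude_potential_bounds[OF transpose_M_mat _ assms(2) l(2)[unfolded Mbar_def] L[unfolded Mbar_def] l(1)]
    state_constraints[OF assms(1)] by auto

lemma rotation_state: "(t, j) \<in> E \<Longrightarrow> rotation_matrix (R t j)" "(t, j) \<in> E \<Longrightarrow> 0 \<le> rot_dist (R t j)"
  using state_constraints rot_dist_nonneg by auto

lemma rotation_drift:
  assumes t: "(t, j) \<in> E"
  shows "norm (R t j - R (en j) j) \<le> 4 * norm (\<eta> (en j) j) * (t - en j)"
    and "norm (R t j - R (en j) j) \<le> 4 * norm (\<eta> (en j) j) * TM"
    and "rot_dist (R t j) \<le> rot_dist (R (en j) j) + 2 * TM * norm (\<eta> (en j) j)"
proof -
  show 1: "norm (R t j - R (en j) j) \<le> 4 * norm (\<eta> (en j) j) * (t - en j)"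
  proof (rule vector_derivative_bound_imp_increment_le[OF en_le[OF t] flow_derivatives(1)[OF t]])
    fix r assume r: "r \<in> {en j..t}"
    have r_in: "(r, j) \<in> E" using between[OF t] r by simp
    have "norm (R r j ** skew (- \<eta> r j)) \<le> norm (R r j) * norm (skew (- \<eta> r j))"
      by (rule norm_matrix_matrix_mult_le)
    also have "\<dots> \<le> 2 * (2 * norm (- \<eta> r j))"
      using rotation_state(1)[OF r_in]
      by (intro mult_mono norm_orthogonal_matrix_le norm_skew_le) (auto simp: rotation_matrix_def)
    finally show "norm (R r j ** skew (- \<eta> r j)) \<le> 4 * norm (\<eta> (en j) j)"
      using \<eta>_flow[OF r_in] by simp
  qed
  also have "\<dots> \<le> 4 * norm (\<eta> (en j) j) * TM"
    using flow_length[OF t] by (intro mult_left_mono) auto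
  finally show 2: "norm (R t j - R (en j) j) \<le> 4 * norm (\<eta> (en j) j) * TM" .
  then have half: "norm (R t j - R (en j) j) / 2 \<le> 2 * TM * norm (\<eta> (en j) j)" by (simp add: algebra_simps)
  show "rot_dist (R t j) \<le> rot_dist (R (en j) j) + 2 * TM * norm (\<eta> (en j) j)"
    using rot_dist_le_rot_dist_add[OF rotation_state(1)[OF en_in[OF t]] rotation_state(1)[OF t]] half by linarith
qed

lemma potential_derivative:
  assumes t: "(t, j) \<in> E" and r: "r \<in> {en j..t}"
  shows "((\<lambda>t. pot t j) has_vector_derivative - 2 * (psi (M ** R r j) \<bullet> \<eta> r j)) (at r within {en j..t})"
proof -
  have "((\<lambda>t. pot t j) has_vector_derivative trace (M ** (0 - R r j ** skew (- \<eta> r j)))) (at r within {en j..t})"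
    unfolding pot_def
    by (intro bounded_linear.has_vector_derivative[OF bounded_linear_trace]
        bounded_linear.has_vector_derivative[OF bounded_bilinear.bounded_linear_right[OF bounded_bilinear_matrix_matrix_mult]]
        has_vector_derivative_diff has_vector_derivative_const flow_derivatives(1)[OF t r])
  moreover have "M ** (0 - R r j ** skew (- \<eta> r j)) = (M ** R r j) ** skew (\<eta> r j)"
    by (simp add: skew_minus matrix_mul_assoc bounded_bilinear.minus_right[OF bounded_bilinear_matrix_matrix_mult])
  ultimately show ?thesis by (simp add: trace_mult_skew_eq_psi)
qed

text \<open>The norm estimate uses that \<open>psi M\<close> is 0 for symmetric \<open>M\<close>:
  the gradient depends on the deviation of the attitude error from the identity only.\<close>

lemma \<eta>_after_jump:
  assumes t: "(t, Suc j) \<in> E"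
  defines "s \<equiv> en (Suc j)"
  shows "\<eta> s (Suc j) = kR *\<^sub>R psi (M ** R s (Suc j))"
    and "norm (psi (M ** R s (Suc j))) \<le> c * (sqrt 8 * rot_dist (R s (Suc j)))"
proof -
  show "\<eta> s (Suc j) = kR *\<^sub>R psi (M ** R s (Suc j))"
    using jump(3,4)[OF t] by (simp add: s_def)
  have "psi (M ** R s (Suc j)) = psi (M ** (R s (Suc j) - mat 1))"
    using psi_mult_skew(1)[OF transpose_M_mat, of N lm k] by (simp add: linear_diff[OF linear_psi_mult])
  also have "norm \<dots> \<le> c * norm (R s (Suc j) - mat 1)" by (rule c(2))
  also have "norm (R s (Suc j) - mat 1) = sqrt 8 * rot_dist (R s (Suc j))"
    using norm_rotation_matrix_diff_mat_1[OF rotation_state(1)[OF en_in[OF t]]] by (simp add: s_def)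
  finally show "norm (psi (M ** R s (Suc j))) \<le> c * (sqrt 8 * rot_dist (R s (Suc j)))" .
qed

text \<open>During the flow \<open>\<eta>\<close> stays at \<open>kR\<close> times the gradient
  sampled at the jump. The current gradient differs from the sample by at most half the sample's
  norm, so their inner product is at least half its square; with the factor 2 in the derivative the
  full square remains.\<close>

lemma descent:
  assumes t: "(t, Suc j) \<in> E"
  defines "s \<equiv> en (Suc j)"
  assumes small: "rot_dist (R s (Suc j)) \<le> e1"
  shows "rot_dist (R t (Suc j)) \<le> e2"
    and "pot t (Suc j) \<le> pot s (Suc j) - kR * (norm (psi (M ** R s (Suc j))))\<^sup>2 * (t - s)"
proof -
  define \<psi> where "\<psi> r = psi (M ** R r (Suc j))" for r
  have s_in: "(s, Suc j) \<in> E" unfolding s_def by (rule en_in[OF t])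
  have \<eta>s: "\<eta> s (Suc j) = kR *\<^sub>R \<psi> s" and \<psi>s: "norm (\<psi> s) \<le> c * (sqrt 8 * rot_dist (R s (Suc j)))"
    using \<eta>_after_jump[OF t] by (simp_all add: \<psi>_def s_def)
  have "rot_dist (R s (Suc j)) \<le> 1" using small e by simp
  \<comment> \<open>With sqrt 8 at most 3, the drift is at most 2 * 3 * TM c kR, which fits into the
    8 TM c kR allowed by the condition on the gain.\<close>
  then have "sqrt 8 * rot_dist (R s (Suc j)) \<le> 3 * 1"
    using rotation_state(2)[OF s_in] by (intro mult_mono real_le_lsqrt) auto
  then have "sqrt 8 * rot_dist (R s (Suc j)) \<le> 3" by simp
  then have "norm (\<psi> s) \<le> c * 3" using \<psi>s mult_left_mono[of "sqrt 8 * rot_dist (R s (Suc j))" 3 c] c(1) by linarith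
  then have "2 * TM * norm (\<eta> s (Suc j)) \<le> 2 * TM * (kR * (c * 3))"
    unfolding \<eta>s using kR(1) TM_pos by (intro mult_left_mono) (simp_all add: mult_left_mono)
  also have "\<dots> \<le> e2 - e1" using kR(2) kR_small(2) by (simp add: mult_ac)
  finally show "rot_dist (R t (Suc j)) \<le> e2"
    using rotation_drift(3)[OF t] small by (simp add: s_def)
  have "pot t (Suc j) \<le> pot s (Suc j) + (- (kR * (norm (\<psi> s))\<^sup>2)) * (t - s)"
    unfolding s_def
  proof (rule derivative_bound_imp_increment_le[OF en_le[OF t] potential_derivative[OF t]])
    fix r assume r: "r \<in> {en (Suc j)..t}"
    have r_in: "(r, Suc j) \<in> E" using between[OF t] r by simp
    have "norm (\<psi> r - \<psi> s) \<le> c * norm (R r (Suc j) - R s (Suc j))"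
      unfolding \<psi>_def using c(2) by (simp flip: linear_diff[OF linear_psi_mult])
    also have "\<dots> \<le> c * (4 * norm (\<eta> s (Suc j)) * TM)"
      using rotation_drift(2)[OF r_in] c(1) unfolding s_def by (intro mult_left_mono) auto
    also have "\<dots> = (4 * TM * c * kR) * norm (\<psi> s)" using kR(1) by (simp add: \<eta>s)
    also have "\<dots> \<le> (1 / 2) * norm (\<psi> s)" using kR_small by (intro mult_right_mono) auto
    finally have d: "norm (\<psi> r - \<psi> s) \<le> (1 / 2) * norm (\<psi> s)" .
    have "(\<psi> s - \<psi> r) \<bullet> \<psi> s \<le> norm (\<psi> s - \<psi> r) * norm (\<psi> s)" by (rule norm_cauchy_schwarz)
    also have "\<dots> \<le> (1 / 2) * norm (\<psi> s) * norm (\<psi> s)"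
      using d by (intro mult_right_mono) (auto simp: norm_minus_commute)
    finally have "(norm (\<psi> s))\<^sup>2 \<le> 2 * (\<psi> r \<bullet> \<psi> s)"
      by (simp add: inner_diff_left dot_square_norm power2_eq_square)
    then have "kR * (norm (\<psi> s))\<^sup>2 \<le> kR * (2 * (\<psi> r \<bullet> \<psi> s))" using kR(1) by (intro mult_left_mono) auto
    moreover have "\<eta> r (Suc j) = kR *\<^sub>R \<psi> s" using \<eta>_flow[OF r_in] \<eta>s by (simp add: s_def)
    ultimately show "- 2 * (psi (M ** R r (Suc j)) \<bullet> \<eta> r (Suc j)) \<le> - (kR * (norm (\<psi> (en (Suc j))))\<^sup>2)"
      by (simp add: \<psi>_def s_def)
  qed
  then show "pot t (Suc j) \<le> pot s (Suc j) - kR * (norm (psi (M ** R s (Suc j))))\<^sup>2 * (t - s)"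
    by (simp add: \<psi>_def)
qed

text \<open>The lower bound on the potential holds away from straight angles only. A crude distance
  bound below 1 therefore comes first, from the drift, and is then sharpened to
  \<open>e1\<close>.\<close>

lemma rot_dist_le_of_potential:
  assumes "(t, j) \<in> E" "rot_dist (R t j) < 1" "pot t j \<le> 4 * l * e1\<^sup>2"
  shows "rot_dist (R t j) \<le> e1"
proof -
  have "l * (rot_dist (R t j))\<^sup>2 \<le> l * e1\<^sup>2" using potential_bounds(1)[OF assms(1,2)] assms(3) by simp
  then have "(rot_dist (R t j))\<^sup>2 \<le> e1\<^sup>2" using l(1) by (rule mult_left_le_imp_le)
  then show ?thesis by (rule power2_le_imp_le) (use e in simp)
qed

text \<open>Before the first jump \<open>\<eta>\<close> is unrelated to the gradient, so no descent
  can be used and only the drift bound is available.\<close>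

lemma first_flow:
  assumes t: "(t, 0) \<in> E"
  shows "rot_dist (R t 0) \<le> e1 * sqrt (l / L)" "rot_dist (R t 0) < 1"
proof -
  show 1: "rot_dist (R t 0) \<le> e1 * sqrt (l / L)"
    using rotation_drift(3)[OF t] init by (simp add: en_0)
  have "e1 * sqrt (l / L) \<le> e1 * 1" using L_ge_l l(1) e by (intro mult_left_mono) auto
  then show "rot_dist (R t 0) < 1" using 1 e by linarith
qed

text \<open>At the first jump the distance is at most e1 sqrt (l / L), so the potential is at most 4
  L e1^2 l / L = 4 l e1^2. By the lower bound this level again confines the distance to
  \<open>e1\<close>, and from then on the potential does not increase.\<close>

lemma invariant:
  assumes "(t, Suc j) \<in> E"
  shows "rot_dist (R (en (Suc j)) (Suc j)) \<le> e1 \<and> pot (en (Suc j)) (Suc j) \<le> 4 * l * e1\<^sup>2"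
  using assms
proof (induction j arbitrary: t)
  case 0
  let ?s = "en (Suc 0)"
  have s: "(?s, 0) \<in> E" "(?s, Suc 0) \<in> E" using en_Suc_in[OF 0] en_in[OF 0] .
  note f = first_flow[OF s(1)]
  have "pot ?s 0 \<le> 4 * L * (rot_dist (R ?s 0))\<^sup>2" by (rule potential_bounds(2)[OF s(1) f(2)])
  also have "\<dots> \<le> 4 * L * (e1 * sqrt (l / L))\<^sup>2"
    using f(1) rotation_state(2)[OF s(1)] L_ge_l l(1) by (intro mult_left_mono power_mono) auto
  also have "\<dots> = 4 * l * e1\<^sup>2" using L_ge_l l(1) by (simp add: power_mult_distrib)
  finally have p: "pot ?s 0 \<le> 4 * l * e1\<^sup>2" .
  show ?case
    using p rot_dist_le_of_potential[OF s(1) f(2) p] jump(3)[OF 0] by (simp add: pot_def)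
next
  case (Suc j)
  let ?s = "en (Suc (Suc j))"
  have s: "(?s, Suc j) \<in> E" using en_Suc_in[OF Suc.prems] .
  note IH = Suc.IH[OF s]
  have "rot_dist (R ?s (Suc j)) < 1" using descent(1)[OF s] IH e by simp
  moreover have "0 \<le> kR * (norm (psi (M ** R (en (Suc j)) (Suc j))))\<^sup>2 * (?s - en (Suc j))"
    using kR(1) en_le[OF s] by simp
  then have "pot ?s (Suc j) \<le> 4 * l * e1\<^sup>2"
    using descent(2)[OF s] IH by linarith
  ultimately show ?case
    using rot_dist_le_of_potential[OF s] jump(3)[OF Suc.prems] by (simp add: pot_def)
qed

abbreviation "rate \<equiv> attitude_rate kR Tm l L e1"

text \<open>Counted from the first jump, since the interval before it need not contract: between the
  jumps 1 and \<open>Suc j\<close> there are \<open>j\<close> intervals, each of duration at least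
  \<open>Tm\<close>.\<close>

lemma potential_decay:
  assumes "(t, Suc j) \<in> E"
  shows "pot (en (Suc j)) (Suc j) \<le> exp (- rate * real j) * pot (en 1) 1"
  using assms
proof (induction j arbitrary: t)
  case (Suc j)
  let ?s = "en (Suc j)" and ?t = "en (Suc (Suc j))"
  have t: "(?t, Suc j) \<in> E" using en_Suc_in[OF Suc.prems] .
  have s: "(?s, Suc j) \<in> E" by (rule en_in[OF t])
  have r: "rot_dist (R ?s (Suc j)) \<le> e1" using invariant[OF t] by simp
  then have r1: "rot_dist (R ?s (Suc j)) < 1" using e by simp
  define \<rho> where "\<rho> = (rot_dist (R ?s (Suc j)))\<^sup>2"
  define \<psi>2 where "\<psi>2 = (norm (psi (M ** R ?s (Suc j))))\<^sup>2"
  have \<rho>: "\<rho> \<le> e1\<^sup>2" "0 \<le> \<rho>"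
    using r rotation_state(2)[OF s] by (auto simp: \<rho>_def intro: power_mono)
  have e1: "e1\<^sup>2 < 1" using e by (simp add: abs_square_less_1)
  note pb = potential_bounds[OF s r1, folded \<rho>_def \<psi>2_def]
  have "l\<^sup>2 * (1 - e1\<^sup>2) / L * pot ?s (Suc j) \<le> l\<^sup>2 * (1 - e1\<^sup>2) / L * (4 * L * \<rho>)"
    using pb(2) e1 l(1) L_ge_l by (intro mult_left_mono) auto
  also have "\<dots> = 4 * l\<^sup>2 * \<rho> * (1 - e1\<^sup>2)" using l(1) L_ge_l by simp
  also have "\<dots> \<le> 4 * l\<^sup>2 * \<rho> * (1 - \<rho>)" using \<rho> by (intro mult_left_mono) auto
  also have "\<dots> \<le> \<psi>2" by (rule pb(3))
  finally have "kR * Tm * (l\<^sup>2 * (1 - e1\<^sup>2) / L * pot ?s (Suc j)) \<le> kR * Tm * \<psi>2"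
    using kR(1) Tm by (intro mult_left_mono) auto
  also have "\<dots> = kR * \<psi>2 * Tm" by simp
  also have "\<dots> \<le> kR * \<psi>2 * (?t - ?s)"
    using jump_interval[OF Suc.prems] kR(1) by (intro mult_left_mono) (auto simp: \<psi>2_def)
  also have "\<dots> \<le> pot ?s (Suc j) - pot ?t (Suc j)"
    using descent(2)[OF t r] by (simp add: \<psi>2_def)
  finally have "pot ?t (Suc j) \<le> (1 + - rate) * pot ?s (Suc j)"
    by (simp add: attitude_rate_def algebra_simps)
  \<comment> \<open>1 - rate is at most exp (- rate) for every rate, so no further smallness of the
    gain is spent here.\<close>
  also have "\<dots> \<le> exp (- rate) * pot ?s (Suc j)"
  proof (rule mult_right_mono[OF exp_ge_add_one_self])
    have "0 \<le> 4 * l * \<rho>" using l(1) \<rho> by simp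
    then show "0 \<le> pot ?s (Suc j)" using pb(1) by linarith
  qed
  also have "\<dots> \<le> exp (- rate) * (exp (- rate * real j) * pot (en 1) 1)"
    using Suc.IH[OF t] by (intro mult_left_mono) auto
  also have "\<dots> = exp (- rate * real (Suc j)) * pot (en 1) 1"
  proof -
    have "exp (- rate * real (Suc j)) = exp (- rate) * exp (- rate * real j)"
      by (simp only: exp_add[symmetric]) (simp add: algebra_simps)
    then show ?thesis by simp
  qed
  finally show ?case using jump(3)[OF Suc.prems] by (simp add: pot_def)
qed simp

lemma first_flow_le:
  assumes t: "(t, 0) \<in> E"
  shows "(rot_dist (R t 0))\<^sup>2 \<le> 2 * (1 + 4 * TM\<^sup>2) * ((rot_dist (R 0 0))\<^sup>2 + (norm (\<eta> 0 0))\<^sup>2)"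
proof -
  define a where "a = rot_dist (R 0 0)"
  define b where "b = norm (\<eta> 0 0)"
  have "(rot_dist (R t 0))\<^sup>2 \<le> (a + 2 * TM * b)\<^sup>2"
    using rotation_drift(3)[OF t] rotation_state(2)[OF t] by (intro power_mono) (simp_all add: en_0 a_def b_def)
  also have "\<dots> \<le> 2 * (a\<^sup>2 + (2 * TM * b)\<^sup>2)"
    using zero_le_power2[of "a - 2 * TM * b"] by (simp add: power2_eq_square algebra_simps)
  also have "\<dots> \<le> 2 * (1 + 4 * TM\<^sup>2) * (a\<^sup>2 + b\<^sup>2)"
    by (simp add: power_mult_distrib algebra_simps)
  finally show ?thesis by (simp add: a_def b_def)
qed

abbreviation "gain_bound \<equiv> attitude_gain kR Tm TM l L c e1"

text \<open>After a jump both quantities are controlled by the potential at that jump: the distance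
  because the potential decreases along the flow, and \<open>\<eta>\<close> because it is the
  sampled gradient. The potential at the first jump is in turn bounded by the initial error through
  the drift of the first flow.\<close>

lemma attitude_decay:
  assumes t: "(t, j) \<in> E"
  shows "(rot_dist (R t j))\<^sup>2 + (norm (\<eta> t j))\<^sup>2 \<le>
    gain_bound * exp (- rate * real j) * ((rot_dist (R 0 0))\<^sup>2 + (norm (\<eta> 0 0))\<^sup>2)"
proof (cases j)
  case 0
  let ?i = "(rot_dist (R 0 0))\<^sup>2 + (norm (\<eta> 0 0))\<^sup>2"
  define X where "X = 2 * (1 + 4 * TM\<^sup>2) * ?i"
  have n: "(norm (\<eta> t 0))\<^sup>2 = (norm (\<eta> 0 0))\<^sup>2" using \<eta>_flow[of t 0] t 0 by (simp add: en_0)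
  have f: "(rot_dist (R t 0))\<^sup>2 \<le> X" using first_flow_le t unfolding 0 X_def by blast
  have "(rot_dist (R t j))\<^sup>2 + (norm (\<eta> t j))\<^sup>2 \<le> X + 1 * ?i"
    unfolding 0 n by (rule order_trans[OF add_right_mono[OF f]]) simp
  also have "\<dots> \<le> X + (1 + 4 * TM\<^sup>2) * ?i"
    by (intro add_left_mono mult_right_mono) auto
  also have "\<dots> = 3 * (1 + 4 * TM\<^sup>2) * ?i" by (simp add: X_def algebra_simps)
  also have "\<dots> \<le> gain_bound * ?i"
    unfolding attitude_gain_def using l(1) L_ge_l by (intro mult_right_mono) auto
  finally show ?thesis using 0 by simp
next
  case (Suc i)
  let ?i = "(rot_dist (R 0 0))\<^sup>2 + (norm (\<eta> 0 0))\<^sup>2"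
  have tS: "(t, Suc i) \<in> E" using t Suc by simp
  let ?s = "en (Suc i)"
  have s: "(?s, Suc i) \<in> E" by (rule en_in[OF tS])
  have rs: "rot_dist (R ?s (Suc i)) \<le> e1" using invariant[OF tS] by simp
  have rt: "rot_dist (R t (Suc i)) < 1" using descent(1)[OF tS rs] e by simp
  have "0 \<le> kR * (norm (psi (M ** R ?s (Suc i))))\<^sup>2 * (t - ?s)" using kR(1) en_le[OF tS] by simp
  then have pt: "pot t (Suc i) \<le> pot ?s (Suc i)" using descent(2)[OF tS rs] by linarith
  have r2: "(rot_dist (R t (Suc i)))\<^sup>2 \<le> pot ?s (Suc i) / (4 * l)"
    using potential_bounds(1)[OF tS rt] pt l(1) by (simp add: field_simps)
  have s2: "(rot_dist (R ?s (Suc i)))\<^sup>2 \<le> pot ?s (Suc i) / (4 * l)"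
    using potential_bounds(1)[OF s] rs e l(1) by (simp add: field_simps)
  have "(norm (\<eta> t (Suc i)))\<^sup>2 = kR\<^sup>2 * (norm (psi (M ** R ?s (Suc i))))\<^sup>2"
    using \<eta>_flow[OF tS] \<eta>_after_jump(1)[OF tS] by (simp add: power_mult_distrib)
  also have "\<dots> \<le> kR\<^sup>2 * (c * (sqrt 8 * rot_dist (R ?s (Suc i))))\<^sup>2"
    using \<eta>_after_jump(2)[OF tS] by (intro mult_left_mono power_mono) auto
  also have "\<dots> = 8 * kR\<^sup>2 * c\<^sup>2 * (rot_dist (R ?s (Suc i)))\<^sup>2" by (simp add: power_mult_distrib)
  also have "\<dots> \<le> 8 * kR\<^sup>2 * c\<^sup>2 * (pot ?s (Suc i) / (4 * l))" using s2 by (intro mult_left_mono) auto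
  finally have "(rot_dist (R t (Suc i)))\<^sup>2 + (norm (\<eta> t (Suc i)))\<^sup>2 \<le> (1 + 8 * kR\<^sup>2 * c\<^sup>2) * (pot ?s (Suc i) / (4 * l))"
    using r2 unfolding distrib_right by linarith
  also have "\<dots> = (1 + 8 * kR\<^sup>2 * c\<^sup>2) / (4 * l) * pot ?s (Suc i)" by simp
  also have "\<dots> \<le> (1 + 8 * kR\<^sup>2 * c\<^sup>2) / (4 * l) * (exp (- rate * real i) * (4 * L * (2 * (1 + 4 * TM\<^sup>2) * ?i)))"
  proof (rule mult_left_mono)
    have one: "(en 1, 0) \<in> E" "pot (en 1) 1 = pot (en 1) 0"
    proof -
      have "(en 1, 1) \<in> E" using s
      proof (induction i)
        case (Suc i)
        then show ?case using en_in[OF en_Suc_in[OF Suc.prems]] by simp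
      qed simp
      then show "(en 1, 0) \<in> E" "pot (en 1) 1 = pot (en 1) 0"
        using en_Suc_in[of "en 1" 0] jump(3)[of "en 1" 0] by (simp_all add: pot_def)
    qed
    have "pot (en 1) 1 \<le> 4 * L * (rot_dist (R (en 1) 0))\<^sup>2"
      using potential_bounds(2)[OF one(1) first_flow(2)[OF one(1)]] one(2) by simp
    also have "\<dots> \<le> 4 * L * (2 * (1 + 4 * TM\<^sup>2) * ?i)"
      using first_flow_le[OF one(1)] l(1) L_ge_l by (intro mult_left_mono) auto
    finally have "exp (- rate * real i) * pot (en 1) 1 \<le> exp (- rate * real i) * (4 * L * (2 * (1 + 4 * TM\<^sup>2) * ?i))"
      by (rule mult_left_mono) simp
    then show "pot ?s (Suc i) \<le> exp (- rate * real i) * (4 * L * (2 * (1 + 4 * TM\<^sup>2) * ?i))"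
      using potential_decay[OF tS] by linarith
  qed (use l(1) in \<open>simp add: add_nonneg_nonneg\<close>)
  \<comment> \<open>\<open>j\<close> jumps provide only \<open>i = j - 1\<close> contracting
    intervals; the missing factor \<open>exp rate\<close> goes into
    \<open>attitude_gain\<close>.\<close>
  also have "exp (- rate * real i) = exp rate * exp (- rate * real j)"
    by (simp only: exp_add[symmetric] Suc) (simp add: algebra_simps)
  also have "(1 + 8 * kR\<^sup>2 * c\<^sup>2) / (4 * l) * (exp rate * exp (- rate * real j) * (4 * L * (2 * (1 + 4 * TM\<^sup>2) * ?i))) =
      (gain_bound - 3 * (1 + 4 * TM\<^sup>2)) * (exp (- rate * real j) * ?i)"
    by (simp add: attitude_gain_def)
  also have "\<dots> \<le> gain_bound * (exp (- rate * real j) * ?i)"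
  proof (rule mult_right_mono)
    have "0 \<le> 3 * (1 + 4 * TM\<^sup>2)" by (intro mult_nonneg_nonneg add_nonneg_nonneg) auto
    then show "gain_bound - 3 * (1 + 4 * TM\<^sup>2) \<le> gain_bound" by linarith
  qed simp
  finally show ?thesis by (simp add: Suc)
qed

end

section \<open>Completeness of maximal solutions\<close>

text \<open>The last slice \<open>L\<close> may be half-open or a shorter closed interval; in both
  cases it is replaced by \<open>{s J..T}\<close>. Jumps into interval \<open>J\<close> are
  preserved because \<open>y\<close> agrees with \<open>z\<close> at the common point
  \<open>s J\<close>.\<close>

lemma hybrid_solution_extend_flow:
  fixes H :: "'a::euclidean_space hybrid_system"
  assumes sol: "hybrid_solution H E z" and s: "s 0 = 0" "incseq s"
    and E: "E = (\<Union>j<J. {s j..s (Suc j)} \<times> {j}) \<union> L \<times> {J}"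
    and L: "s J \<in> L" "L \<subseteq> {s J..T}"
    and yz: "\<And>t. t \<in> L \<Longrightarrow> y t = z t J"
    and der: "\<And>t. t \<in> {s J..T} \<Longrightarrow> (y has_vector_derivative flow_map H t (y t)) (at t within {s J..T})"
    and cont: "continuous_on {s J..T} (\<lambda>t. flow_map H t (y t))"
    and flow: "\<And>t. t \<in> {s J<..<T} \<Longrightarrow> y t \<in> flow_set H"
  shows "hybrid_solution H (E \<union> {s J..T} \<times> {J}) (\<lambda>t j. if j = J then y t else z t j)"
    (is "hybrid_solution H ?E ?z")
proof -
  have sT: "s J \<le> T" using L by auto
  have E': "?E = (\<Union>j<J. {s j..s (Suc j)} \<times> {j}) \<union> {s J..T} \<times> {J}" using E L(2) by auto
  \<comment> \<open>The old sequence beyond \<open>J\<close> need not fit the new right end, so it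
    is replaced there by the constant \<open>T\<close>.\<close>
  define s' where "s' j = (if j \<le> J then s j else T)" for j
  have "s' 0 = 0" by (simp add: s'_def s)
  moreover have "incseq s'"
    using sT s(2) by (intro incseq_SucI) (auto simp: s'_def incseq_Suc_iff not_less_eq_eq le_Suc_eq)
  moreover have "?E = (\<Union>j<J. {s' j..s' (Suc j)} \<times> {j}) \<union> {s' J..s' (Suc J)} \<times> {J}"
    unfolding E' by (auto simp: s'_def)
  ultimately have dom: "hybrid_time_domain ?E"
    unfolding hybrid_time_domain_def by blast
  have slice: "{t. (t, j) \<in> ?E} = (if j < J then {t. (t, j) \<in> E} else if j = J then {s J..T} else {})" for j
    using L(2) unfolding E by (auto dest: subsetD)
  have init: "?z 0 0 = z 0 0" using yz[of 0] L(1) s(1) by auto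
  note z00 = hybrid_solutionD(2)[OF sol] and flows = hybrid_solutionD(3)[OF sol]
    and jumps = hybrid_solutionD(4)[OF sol]
  have flows': "hybrid_arc H {t. (t, j) \<in> ?E} (\<lambda>t. ?z t j)" for j
  proof (cases "j = J")
    case True
    have "absolutely_continuous_on a b y" if "a \<le> b" "{a..b} \<subseteq> {s J..T}" for a b
      by (rule absolutely_continuous_on_subinterval[OF has_vector_derivative_imp_absolutely_continuous_on[OF der cont] that(2)])
    then have "locally_absolutely_continuous_on {s J..T} y"
      by (simp add: locally_absolutely_continuous_on_def)
    moreover have "negligible {}" by simp
    ultimately show ?thesis
      using der flow unfolding slice hybrid_arc_def by (auto simp: True interior_atLeastAtMost_real simp del: negligible_empty intro!: exI[of _ "{}"])
  next
    case False
    show ?thesis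
    proof (cases "j < J")
      case True
      then show ?thesis using flows[of j] False unfolding slice by simp
    next
      case False
      then show ?thesis using \<open>j \<noteq> J\<close> unfolding slice
        by (auto simp: hybrid_arc_def locally_absolutely_continuous_on_def intro!: exI[of _ "{}"])
    qed
  qed
  have jumps': "?z t j \<in> jump_set H \<and> ?z t (Suc j) \<in> jump_map H t (?z t j)"
    if "(t, j) \<in> ?E" "(t, Suc j) \<in> ?E" for t j
  proof -
    have j: "j < J" using that(2) unfolding E' by auto
    then have 1: "(t, j) \<in> E" "t \<le> s (Suc j)" using that(1) unfolding E' E by auto
    have "(t, Suc j) \<in> E \<and> ?z t (Suc j) = z t (Suc j)"
    proof (cases "Suc j = J")
      case True
      then have "t = s J" using that(2) 1(2) unfolding E' by auto
      then show ?thesis using L(1) yz[of t] True unfolding E by auto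
    next
      case False
      then show ?thesis using that(2) unfolding E' E by auto
    qed
    then show ?thesis using jumps[of t j] 1 j by auto
  qed
  have "?z 0 0 \<in> flow_set H \<union> jump_set H" using z00 init by simp
  from hybrid_solutionI[OF dom this flows' jumps'] show ?thesis .
qed

lemma hybrid_solution_extend_jump:
  fixes H :: "'a::euclidean_space hybrid_system"
  assumes sol: "hybrid_solution H E z" and s: "s 0 = 0" "incseq s"
    and E: "E = (\<Union>j<J. {s j..s (Suc j)} \<times> {j}) \<union> {s J..s (Suc J)} \<times> {J}"
    and jump: "z (s (Suc J)) J \<in> jump_set H" "w \<in> jump_map H (s (Suc J)) (z (s (Suc J)) J)"
  shows "hybrid_solution H (E \<union> {(s (Suc J), Suc J)}) (\<lambda>t j. if j = Suc J then w else z t j)"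
    (is "hybrid_solution H ?E ?z")
proof -
  define s' where "s' j = (if j \<le> Suc J then s j else s (Suc J))" for j
  have "s' 0 = 0" by (simp add: s'_def s)
  moreover have "incseq s'"
    using s(2) by (intro incseq_SucI) (auto simp: s'_def incseq_Suc_iff not_less_eq_eq le_Suc_eq)
  moreover have "?E = (\<Union>j<Suc J. {s' j..s' (Suc j)} \<times> {j}) \<union> {s' (Suc J)..s' (Suc (Suc J))} \<times> {Suc J}"
    unfolding E by (auto simp: s'_def less_Suc_eq)
  ultimately have dom: "hybrid_time_domain ?E"
    unfolding hybrid_time_domain_def by blast
  have slice: "{t. (t, j) \<in> ?E} = (if j = Suc J then {s (Suc J)} else {t. (t, j) \<in> E})" for j
    unfolding E by auto
  note z00 = hybrid_solutionD(2)[OF sol] and flows = hybrid_solutionD(3)[OF sol]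
    and jumps = hybrid_solutionD(4)[OF sol]
  have flows': "hybrid_arc H {t. (t, j) \<in> ?E} (\<lambda>t. ?z t j)" for j
  proof (cases "j = Suc J")
    case True
    have "locally_absolutely_continuous_on {s (Suc J)} (\<lambda>_. w)"
      by (simp add: locally_absolutely_continuous_on_def absolutely_continuous_on_const)
    \<comment> \<open>A jump adds a single point as a new slice. Its interior is empty, and the
      point itself is the exceptional null set, so no differential equation has to hold
      there.\<close>
    then show ?thesis
      unfolding slice hybrid_arc_def by (auto simp: True intro!: exI[of _ "{s (Suc J)}"])
  next
    case False
    then show ?thesis using flows[of j] unfolding slice by simp
  qed
  have jumps': "?z t j \<in> jump_set H \<and> ?z t (Suc j) \<in> jump_map H t (?z t j)"
    if tj: "(t, j) \<in> ?E" "(t, Suc j) \<in> ?E" for t j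
  proof (cases "j = J")
    case True
    then have "t = s (Suc J)" using tj(2) unfolding E by auto
    then show ?thesis using jump True by simp
  next
    case False
    then have "(t, j) \<in> E" "(t, Suc j) \<in> E" "j \<noteq> Suc J" using tj unfolding E by auto
    then show ?thesis using jumps[of t j] False by simp
  qed
  have "?z 0 0 \<in> flow_set H \<union> jump_set H" using z00 by simp
  from hybrid_solutionI[OF dom this flows' jumps'] show ?thesis .
qed

text \<open>The determinant is continuous along the frame, equals 1 at the start and is 1 or -1
  throughout; passing to -1 would make it vanish somewhere.\<close>

lemma body_frame_rotation:
  assumes "continuous_on {s..t} \<omega>" "s \<le> t"
  obtains S :: "real \<Rightarrow> real^3^3" where "S s = mat 1" "\<And>r. r \<in> {s..t} \<Longrightarrow> rotation_matrix (S r)"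
    "\<And>r. r \<in> {s..t} \<Longrightarrow> (S has_vector_derivative S r ** skew (\<omega> r)) (at r within {s..t})"
proof -
  obtain S :: "real \<Rightarrow> real^3^3" where S: "S s = mat 1" "\<And>r. r \<in> {s..t} \<Longrightarrow> orthogonal_matrix (S r)"
    "\<And>r. r \<in> {s..t} \<Longrightarrow> (S has_vector_derivative S r ** skew (\<omega> r)) (at r within {s..t})"
    using body_frame_exists[OF assms] by blast
  have "continuous_on {s..t} S" using S(3) by (rule continuous_on_vector_derivative)
  then have c: "continuous_on {s..t} (\<lambda>r. det (S r))"
    unfolding det_def by (intro continuous_intros)
  have "det (S r) = 1" if r: "r \<in> {s..t}" for r
  proof (rule ccontr)
    assume "det (S r) \<noteq> 1"
    then have "det (S r) = -1" using det_orthogonal_matrix[OF S(2)[OF r]] by simp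
    moreover have "continuous_on {s..r} (\<lambda>r. det (S r))" using c r by (rule_tac continuous_on_subset) auto
    ultimately obtain u where "s \<le> u" "u \<le> r" "det (S u) = 0"
      using IVT2'[of "\<lambda>r. det (S r)" r 0 s] r S(1) by auto
    then show False using det_orthogonal_matrix[OF S(2)[of u]] r by auto
  qed
  then show thesis using that[of S] S by (simp add: rotation_matrix_def)
qed

text \<open>The quadratic term of the Riccati equation sits in the jumps, so during flow
  \<open>x\<close> obeys a linear and \<open>P\<close> an affine equation, with solutions on the
  whole interval; \<open>R\<close> is \<open>R0\<close> times a frame and stays a rotation. The
  uniqueness clause allows shorter intervals, as it has to identify the new arc with the given one
  on its slice.\<close>

lemma error_flow_exists:
  assumes cont: "continuous_on {s..T} \<omega>" "continuous_on {s..T} V" and "s \<le> T" and R0: "rotation_matrix R0"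
  obtains R x P where "R s = R0" "x s = x0" "P s = P0" "\<And>t. t \<in> {s..T} \<Longrightarrow> rotation_matrix (R t)"
    "\<And>t. t \<in> {s..T} \<Longrightarrow> (R has_vector_derivative R t ** skew (- \<eta>0)) (at t within {s..T})"
    "\<And>t. t \<in> {s..T} \<Longrightarrow> (x has_vector_derivative A_mat (\<omega> t) *v x t) (at t within {s..T})"
    "\<And>t. t \<in> {s..T} \<Longrightarrow> (P has_vector_derivative riccati_flow (\<omega> t) (V t) (P t)) (at t within {s..T})"
    "\<And>t R' x' P'. \<lbrakk>t \<in> {s..T}; R' s = R0; x' s = x0; P' s = P0;
      \<And>r. r \<in> {s..t} \<Longrightarrow> (R' has_vector_derivative R' r ** skew (- \<eta>0)) (at r within {s..t});
      \<And>r. r \<in> {s..t} \<Longrightarrow> (x' has_vector_derivative A_mat (\<omega> r) *v x' r) (at r within {s..t});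
      \<And>r. r \<in> {s..t} \<Longrightarrow> (P' has_vector_derivative riccati_flow (\<omega> r) (V r) (P' r)) (at r within {s..t})\<rbrakk>
      \<Longrightarrow> R' t = R t \<and> x' t = x t \<and> P' t = P t"
proof -
  note mm = bounded_bilinear_matrix_matrix_mult and mv = bounded_bilinear_matrix_vector_mult
  have contA: "continuous_on {s..T} (\<lambda>t. A_mat (\<omega> t))" by (rule continuous_on_A_mat[OF cont(1)])
  have "bounded ((\<lambda>t. A_mat (\<omega> t)) ` {s..T})"
    by (intro compact_imp_bounded compact_continuous_image contA) auto
  then obtain B where "\<forall>v\<in>(\<lambda>t. A_mat (\<omega> t)) ` {s..T}. norm v \<le> B" unfolding bounded_iff by blast
  then have B: "norm (A_mat (\<omega> t)) \<le> B" if "t \<in> {s..T}" for t using that by blast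
  have lipR: "norm (X ** skew (- \<eta>0) - Y ** skew (- \<eta>0)) \<le> norm (skew (- \<eta>0)) * norm (X - Y)" for X Y :: "real^3^3"
    using norm_matrix_matrix_mult_le[of "X - Y" "skew (- \<eta>0)"]
    by (simp add: bounded_bilinear.diff_left[OF mm] mult.commute)
  have lipx: "norm (A_mat (\<omega> t) *v u - A_mat (\<omega> t) *v v) \<le> B * norm (u - v)" if "t \<in> {s..T}" for t u v
  proof -
    have "norm (A_mat (\<omega> t) *v u - A_mat (\<omega> t) *v v) = norm (A_mat (\<omega> t) *v (u - v))"
      by (simp add: bounded_bilinear.diff_right[OF mv])
    also have "\<dots> \<le> norm (A_mat (\<omega> t)) * norm (u - v)" by (rule norm_matrix_vector_mult_le)
    also have "\<dots> \<le> B * norm (u - v)" using B[OF that] by (intro mult_right_mono) auto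
    finally show ?thesis .
  qed
  have lipP: "norm (riccati_flow (\<omega> t) (V t) X - riccati_flow (\<omega> t) (V t) Y) \<le> 2 * B * norm (X - Y)"
    if "t \<in> {s..T}" for t X Y
  proof -
    have "riccati_flow (\<omega> t) (V t) X - riccati_flow (\<omega> t) (V t) Y =
        A_mat (\<omega> t) ** (X - Y) + (X - Y) ** transpose (A_mat (\<omega> t))"
      by (simp add: riccati_flow_def bounded_bilinear.diff_left[OF mm] bounded_bilinear.diff_right[OF mm])
    also have "norm \<dots> \<le> norm (A_mat (\<omega> t)) * norm (X - Y) + norm (X - Y) * norm (A_mat (\<omega> t))"
      using norm_matrix_matrix_mult_le[of "X - Y" "transpose (A_mat (\<omega> t))"]
      by (intro norm_triangle_le add_mono norm_matrix_matrix_mult_le) (simp add: norm_transpose)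
    also have "\<dots> \<le> B * norm (X - Y) + norm (X - Y) * B"
      using B[OF that] by (intro add_mono mult_right_mono mult_left_mono) auto
    finally show ?thesis by simp
  qed
  obtain S where S: "S s = mat 1" "\<And>r. r \<in> {s..T} \<Longrightarrow> rotation_matrix (S r)"
    "\<And>r. r \<in> {s..T} \<Longrightarrow> (S has_vector_derivative S r ** skew (- \<eta>0)) (at r within {s..T})"
    using body_frame_rotation[OF continuous_on_const \<open>s \<le> T\<close>] by metis
  define R where "R t = R0 ** S t" for t
  have R: "(R has_vector_derivative R t ** skew (- \<eta>0)) (at t within {s..T})" if "t \<in> {s..T}" for t
    using bounded_linear.has_vector_derivative[OF bounded_bilinear.bounded_linear_right[OF mm] S(3)[OF that], of R0]
    by (simp add: R_def[abs_def] matrix_mul_assoc)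
  have Rrot: "rotation_matrix (R t)" if "t \<in> {s..T}" for t
    using R0 S(2)[OF that] by (auto simp: rotation_matrix_def R_def det_mul intro: orthogonal_matrix_mul)
  obtain x where x: "x s = x0"
    "\<And>t. t \<in> {s..T} \<Longrightarrow> (x has_vector_derivative A_mat (\<omega> t) *v x t) (at t within {s..T})"
    by (rule lipschitz_ode_exists[of s T "\<lambda>t x. A_mat (\<omega> t) *v x" B x0])
      (use \<open>s \<le> T\<close> lipx contA in \<open>auto intro!: bounded_bilinear.continuous_on[OF mv]\<close>)
  obtain P where P: "P s = P0"
    "\<And>t. t \<in> {s..T} \<Longrightarrow> (P has_vector_derivative riccati_flow (\<omega> t) (V t) (P t)) (at t within {s..T})"
  proof (rule lipschitz_ode_exists[of s T "\<lambda>t. riccati_flow (\<omega> t) (V t)" "2 * B" P0])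
    show "continuous_on {s..T} (\<lambda>t. riccati_flow (\<omega> t) (V t) (y t))" if "continuous_on {s..T} y" for y
      unfolding riccati_flow_def
      by (intro continuous_on_add bounded_bilinear.continuous_on[OF mm] contA cont that
          bounded_linear.continuous_on[OF bounded_linear_transpose])
  qed (use \<open>s \<le> T\<close> lipP in auto)
  show thesis
  proof (rule that[of R x P])
    fix t and R' :: "real \<Rightarrow> real^3^3" and x' :: "real \<Rightarrow> vec9" and P' :: "real \<Rightarrow> mat9"
    assume t: "t \<in> {s..T}" and init: "R' s = R0" "x' s = x0" "P' s = P0"
      and d: "\<And>r. r \<in> {s..t} \<Longrightarrow> (R' has_vector_derivative R' r ** skew (- \<eta>0)) (at r within {s..t})"
      "\<And>r. r \<in> {s..t} \<Longrightarrow> (x' has_vector_derivative A_mat (\<omega> r) *v x' r) (at r within {s..t})"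
      "\<And>r. r \<in> {s..t} \<Longrightarrow> (P' has_vector_derivative riccati_flow (\<omega> r) (V r) (P' r)) (at r within {s..t})"
    have sub: "{s..t} \<subseteq> {s..T}" and st: "s \<le> t" using t by auto
    have "R' t = R t"
      by (rule lipschitz_ode_unique[where F="\<lambda>_ X. X ** skew (- \<eta>0)" and f=R' and g=R and a=s and b=t and L="norm (skew (- \<eta>0))"])
        (use st d(1) lipR init S(1) sub in \<open>auto simp: R_def[of s] intro: has_vector_derivative_within_subset[OF R]\<close>)
    moreover have "x' t = x t"
      by (rule lipschitz_ode_unique[where F="\<lambda>t x. A_mat (\<omega> t) *v x" and f=x' and g=x and a=s and b=t and L=B])
        (use st d(2) lipx init x(1) sub in \<open>auto intro: has_vector_derivative_within_subset[OF x(2)]\<close>)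
    moreover have "P' t = P t"
      by (rule lipschitz_ode_unique[where F="\<lambda>t. riccati_flow (\<omega> t) (V t)" and f=P' and g=P and a=s and b=t and L="2 * B"])
        (use st d(3) lipP init P(1) sub in \<open>auto intro: has_vector_derivative_within_subset[OF P(2)]\<close>)
    ultimately show "R' t = R t \<and> x' t = x t \<and> P' t = P t" by simp
  qed (use R Rrot x P S(1) in \<open>auto simp: R_def[of s]\<close>)
qed

context error_solution
begin

text \<open>The condition on the timer says that it does not run out before \<open>T\<close>, so the
  prolonged arc stays in the flow set; by uniqueness it agrees with the given arc on
  \<open>L\<close>.\<close>

lemma extend_flow:
  assumes s: "s 0 = 0" "incseq s"
    and E: "E = (\<Union>j<J. {s j..s (Suc j)} \<times> {j}) \<union> L \<times> {J}"
    and L: "s J \<in> L" "L \<subset> {s J..T}" "\<And>t. t \<in> L \<Longrightarrow> s J \<le> t"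
    and remaining: "\<tau> (s J) J - (T - s J) \<ge> 0"
  shows "\<exists>E' z'. hybrid_solution (error_system N lm k kR Tm TM \<omega> V Q) E' z' \<and> E \<subset> E' \<and>
    (\<forall>(t, j)\<in>E. z' t j = ((R t j, \<eta> t j, x t j, \<tau> t j), P t j))"
proof -
  let ?H = "error_system N lm k kR Tm TM \<omega> V Q"
  have sJ: "(s J, J) \<in> E" using E L(1) by auto
  have enJ: "en J = s J"
    using en_le[OF sJ] en_in[OF sJ] L(3) E by (intro antisym) auto
  have sT: "s J \<le> T" using L by auto
  have pos: "{s J..T} \<subseteq> {0..}" using time_nonneg[OF sJ] by auto
  note c = continuous_on_subset[OF cont_\<omega> pos] continuous_on_subset[OF cont_V pos]
  obtain Ry xy Py where y: "Ry (s J) = R (s J) J" "xy (s J) = x (s J) J" "Py (s J) = P (s J) J"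
    "\<And>t. t \<in> {s J..T} \<Longrightarrow> rotation_matrix (Ry t)"
    "\<And>t. t \<in> {s J..T} \<Longrightarrow> (Ry has_vector_derivative Ry t ** skew (- \<eta> (s J) J)) (at t within {s J..T})"
    "\<And>t. t \<in> {s J..T} \<Longrightarrow> (xy has_vector_derivative A_mat (\<omega> t) *v xy t) (at t within {s J..T})"
    "\<And>t. t \<in> {s J..T} \<Longrightarrow> (Py has_vector_derivative riccati_flow (\<omega> t) (V t) (Py t)) (at t within {s J..T})"
    and uniq: "\<And>t R' x' P'. \<lbrakk>t \<in> {s J..T}; R' (s J) = R (s J) J; x' (s J) = x (s J) J; P' (s J) = P (s J) J;
      \<And>r. r \<in> {s J..t} \<Longrightarrow> (R' has_vector_derivative R' r ** skew (- \<eta> (s J) J)) (at r within {s J..t});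
      \<And>r. r \<in> {s J..t} \<Longrightarrow> (x' has_vector_derivative A_mat (\<omega> r) *v x' r) (at r within {s J..t});
      \<And>r. r \<in> {s J..t} \<Longrightarrow> (P' has_vector_derivative riccati_flow (\<omega> r) (V r) (P' r)) (at r within {s J..t})\<rbrakk>
      \<Longrightarrow> R' t = Ry t \<and> x' t = xy t \<and> P' t = Py t"
    by (rule error_flow_exists[OF c sT state_constraints[OF sJ, THEN conjunct1],
          of "x (s J) J" "P (s J) J" "\<eta> (s J) J"]) blast
  define y where "y t = ((Ry t, \<eta> (s J) J, xy t, \<tau> (s J) J - (t - s J)), Py t)" for t
  have yz: "y t = ((R t J, \<eta> t J, x t J, \<tau> t J), P t J)" if t: "t \<in> L" for t
  proof -
    have tE: "(t, J) \<in> E" and tT: "t \<in> {s J..T}" using t E L by auto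
    have "((\<lambda>t. R t J) has_vector_derivative R r J ** skew (- \<eta> (s J) J)) (at r within {s J..t})"
      if r: "r \<in> {s J..t}" for r
      using flow_derivatives(1)[OF tE, of r] r \<eta>_flow[of r J] between[OF tE, of r] by (simp add: enJ)
    then have "R t J = Ry t \<and> x t J = xy t \<and> P t J = Py t"
      using uniq[OF tT, of "\<lambda>t. R t J" "\<lambda>t. x t J" "\<lambda>t. P t J"] flow_derivatives(3,5)[OF tE] by (simp add: enJ)
    then show ?thesis using \<eta>_flow[OF tE] timer[OF tE] by (simp add: y_def enJ)
  qed
  have ty: "((\<lambda>t. \<tau> (s J) J - (t - s J)) has_vector_derivative - 1) (at t within S)" for t S
    by (auto intro!: derivative_eq_intros simp: has_real_derivative_iff_has_vector_derivative[symmetric])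
  have der: "(y has_vector_derivative flow_map ?H t (y t)) (at t within {s J..T})" if t: "t \<in> {s J..T}" for t
    unfolding y_def[abs_def] error_system_def
    using y(5,6,7)[OF t] ty by (auto intro!: has_vector_derivative_Pair has_vector_derivative_const)
  have "continuous_on {s J..T} y" using der by (rule continuous_on_vector_derivative)
  then have cont: "continuous_on {s J..T} (\<lambda>t. flow_map ?H t (y t))"
    using continuous_on_error_flow[OF _ c] by (simp add: error_system_def)
  have flow: "y t \<in> flow_set ?H" if t: "t \<in> {s J<..<T}" for t
    using y(4)[of t] t remaining state_constraints[OF sJ] by (auto simp: y_def error_system_def)
  have "hybrid_solution ?H (E \<union> {s J..T} \<times> {J})
      (\<lambda>t j. if j = J then y t else ((R t j, \<eta> t j, x t j, \<tau> t j), P t j))"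
    using L by (intro hybrid_solution_extend_flow[OF sol s E _ _ yz der cont flow]) auto
  moreover have "E \<subset> E \<union> {s J..T} \<times> {J}" using L(2) E by auto
  moreover have "\<forall>(t, j)\<in>E. (if j = J then y t else ((R t j, \<eta> t j, x t j, \<tau> t j), P t j)) =
      ((R t j, \<eta> t j, x t j, \<tau> t j), P t j)"
  proof safe
    fix t j assume "(t, j) \<in> E"
    then show "(if j = J then y t else ((R t j, \<eta> t j, x t j, \<tau> t j), P t j)) =
      ((R t j, \<eta> t j, x t j, \<tau> t j), P t j)"
      using yz[of t] E by auto
  qed
  ultimately show ?thesis by blast
qed

text \<open>A bounded domain has a last interval, and that interval is bounded. If it is half-open,
  its right end can be added by flowing. If it is closed, either the timer is 0 there and a jump is
  possible, or flow continues for the time that the timer still shows.\<close>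

lemma maximal_imp_complete:
  assumes max: "maximal_hybrid_solution (error_system N lm k kR Tm TM \<omega> V Q) E
      (\<lambda>t j. ((R t j, \<eta> t j, x t j, \<tau> t j), P t j))"
  shows "complete_domain E"
proof (rule ccontr)
  let ?H = "error_system N lm k kR Tm TM \<omega> V Q"
  assume "\<not> complete_domain E"
  then obtain B where "\<forall>p\<in>(\<lambda>(t, j). (t, real j)) ` E. norm p \<le> B"
    unfolding complete_domain_def bounded_iff by blast
  then have "norm (t, real j) \<le> B" if "(t, j) \<in> E" for t j using that by force
  then have B: "t \<le> B" "real j \<le> B" if "(t, j) \<in> E" for t j
    using that norm_fst_le[of t "real j"] norm_snd_le[of "real j" t] by fastforce+
  have no_ext: "\<not> (\<exists>E' z'. hybrid_solution ?H E' z' \<and> E \<subset> E' \<and>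
      (\<forall>(t, j)\<in>E. z' t j = ((R t j, \<eta> t j, x t j, \<tau> t j), P t j)))"
    using max by (simp add: maximal_hybrid_solution_def)
  obtain s :: "nat \<Rightarrow> real" where s: "s 0 = 0" "incseq s" and
    E: "E = (\<Union>j. {s j..s (Suc j)} \<times> {j}) \<or>
         (\<exists>J L. (L = {s J..s (Suc J)} \<or> (\<exists>T>s J. L = {s J..<T}) \<or> L = {s J..}) \<and>
                E = (\<Union>j<J. {s j..s (Suc j)} \<times> {j}) \<union> L \<times> {J})"
    using domain unfolding hybrid_time_domain_def by blast
  have mono: "s j \<le> s (Suc j)" for j using s(2) by (rule incseq_SucD)
  from E show False
  proof
    assume E: "E = (\<Union>j. {s j..s (Suc j)} \<times> {j})"
    obtain j where "B < real j" using reals_Archimedean2 by blast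
    moreover have "(s j, j) \<in> E" using mono[of j] by (auto simp: E)
    ultimately show False using B(2)[of "s j" j] by simp
  next
    assume "\<exists>J L. (L = {s J..s (Suc J)} \<or> (\<exists>T>s J. L = {s J..<T}) \<or> L = {s J..}) \<and>
                E = (\<Union>j<J. {s j..s (Suc j)} \<times> {j}) \<union> L \<times> {J}"
    then obtain J L where L: "L = {s J..s (Suc J)} \<or> (\<exists>T>s J. L = {s J..<T}) \<or> L = {s J..}"
      and E: "E = (\<Union>j<J. {s j..s (Suc j)} \<times> {j}) \<union> L \<times> {J}" by blast
    from L show False
    proof (elim disjE exE conjE)
      assume L: "L = {s J..}"
      have "(max (s J) (B + 1), J) \<in> E" by (auto simp: E L)
      then show False using B(1)[of "max (s J) (B + 1)" J] by simp
    next
      fix T assume T: "s J < T" "L = {s J..<T}"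
      have sJ: "(s J, J) \<in> E" using T by (auto simp: E)
      have enJ: "en J = s J"
        using en_le[OF sJ] en_in[OF sJ] T E by (intro antisym) auto
      have rem: "T - s J \<le> \<tau> (s J) J"
      \<comment> \<open>\<open>T\<close> itself is not in the slice, so nonnegativity of the timer
        is used at times arbitrarily close to it.\<close>
      proof (rule field_le_epsilon)
        fix d :: real assume "d > 0"
        define t where "t = max (s J) (T - d)"
        have "(t, J) \<in> E" using T \<open>d > 0\<close> by (auto simp: E t_def)
        then have "0 \<le> \<tau> (s J) J - (t - s J)" using timer[of t J] state_constraints[of t J] by (simp add: enJ)
        then show "T - s J \<le> \<tau> (s J) J + d" by (simp add: t_def)
      qed
      have sub: "L \<subset> {s J..T}"
      proof
        show "L \<subseteq> {s J..T}" using T(2) by auto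
        have "T \<in> {s J..T}" "T \<notin> L" using T by auto
        then show "L \<noteq> {s J..T}" by blast
      qed
      have "s J \<in> L" "\<And>t. t \<in> L \<Longrightarrow> s J \<le> t" "0 \<le> \<tau> (s J) J - (T - s J)" using T rem by simp_all
      from no_ext extend_flow[OF s E this(1) sub this(2,3)] show False by (rule notE)
    next
      assume L: "L = {s J..s (Suc J)}"
      let ?b = "s (Suc J)"
      have sJ: "(s J, J) \<in> E" and b: "(?b, J) \<in> E" using mono by (auto simp: E L)
      have enJ: "en J = s J"
        using en_le[OF sJ] en_in[OF sJ] L E by (intro antisym) auto
      show False
      proof (cases "\<tau> ?b J = 0")
        case True
        \<comment> \<open>One admissible successor; the timer may be reset to any value in
          \<open>{Tm..TM}\<close>, and \<open>Tm\<close> is taken.\<close>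
        define w where "w = ((R ?b J, kR *\<^sub>R psi (M_mat N lm k ** R ?b J),
            (mat 1 - gain (P ?b J) (Q ?b) ** C_mat) *v x ?b J, Tm), riccati_jump (Q ?b) (P ?b J))"
        have "hybrid_solution ?H (E \<union> {(?b, Suc J)})
            (\<lambda>t j. if j = Suc J then w else ((R t j, \<eta> t j, x t j, \<tau> t j), P t j))"
          using True state_constraints[OF b] Tm L E
          by (intro hybrid_solution_extend_jump[OF sol s]) (auto simp: error_system_def w_def)
        moreover have "E \<subset> E \<union> {(?b, Suc J)}" by (auto simp: E)
        moreover have "\<forall>(t, j)\<in>E. (if j = Suc J then w else ((R t j, \<eta> t j, x t j, \<tau> t j), P t j)) =
            ((R t j, \<eta> t j, x t j, \<tau> t j), P t j)" by (auto simp: E)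
        ultimately show False using no_ext by blast
      next
        case False
        then have pos: "0 < \<tau> ?b J" using state_constraints[OF b] by auto
        have rem: "\<tau> (s J) J - (?b + \<tau> ?b J - s J) = 0" using timer[OF b] by (simp add: enJ)
        have sub: "L \<subset> {s J..?b + \<tau> ?b J}"
        proof
          show "L \<subseteq> {s J..?b + \<tau> ?b J}" using L pos by auto
          have "?b + \<tau> ?b J \<in> {s J..?b + \<tau> ?b J}" "?b + \<tau> ?b J \<notin> L" using L pos mono[of J] by auto
          then show "L \<noteq> {s J..?b + \<tau> ?b J}" by blast
        qed
        have "s J \<in> L" "\<And>t. t \<in> L \<Longrightarrow> s J \<le> t" "0 \<le> \<tau> (s J) J - (?b + \<tau> ?b J - s J)"
          using L mono[of J] rem by simp_all
        from no_ext extend_flow[OF s E this(1) sub this(2,3)] show False by (rule notE)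
      qed
    qed
  qed
qed

end

section \<open>From the observer to the estimation error\<close>

lemma rotation_matrix_transpose: "rotation_matrix (R :: real^'n^'n) \<Longrightarrow> rotation_matrix (transpose R)"
  by (simp add: rotation_matrix_def det_transpose)

lemma rotation_matrix_mult:
  "rotation_matrix (A :: real^'n^'n) \<Longrightarrow> rotation_matrix B \<Longrightarrow> rotation_matrix (A ** B)"
  by (simp add: rotation_matrix_def det_mul orthogonal_matrix_mul)

lemma rotation_matrix_inverse:
  assumes "rotation_matrix (R :: real^'n^'n)"
  shows "R *v (transpose R *v u) = u" "transpose R *v (R *v u) = u"
  using assms by (simp_all add: rotation_matrix_def orthogonal_matrix_def matrix_vector_mul_assoc)

lemma psi_outer_product:
  "psi ((\<chi> r c. q $ r * q $ c) ** B) = - (1/2) *\<^sub>R cross3 q (transpose B *v q)"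
  by (simp add: vec_eq_iff forall_3 psi_component matrix_matrix_mult_def sum_3 cross_components
      matrix_vector_mult_def transpose_def field_simps)

context
  fixes N :: nat and lm :: "nat \<Rightarrow> real^3" and k :: "nat \<Rightarrow> real"
  assumes k_sum: "(\<Sum>i=1..N. k i) = 1"
begin

lemma centroid_deviation_sum: "(\<Sum>i=1..N. k i *\<^sub>R (lm i - centroid N lm k)) = 0"
  using k_sum by (simp add: scaleR_diff_right sum_subtractf centroid_def flip: scaleR_left.sum)

lemma psi_M_mat_mult:
  "psi (M_mat N lm k ** B) =
    - (1/2) *\<^sub>R (\<Sum>i=1..N. k i *\<^sub>R cross3 (lm i - centroid N lm k) (transpose B *v (lm i - centroid N lm k)))"
proof -
  define q where "q i = lm i - centroid N lm k" for i
  have M: "M_mat N lm k = (\<Sum>i=1..N. k i *\<^sub>R (\<chi> r c. q i $ r * q i $ c))"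
    by (simp add: M_mat_def q_def Let_def)
  have lin: "linear (\<lambda>A. psi (A ** B))"
    using linear_compose[OF bounded_linear.linear[OF bounded_bilinear.bounded_linear_left[OF bounded_bilinear_matrix_matrix_mult]]
        bounded_linear.linear[OF bounded_linear_psi]] by (simp add: o_def)
  have "psi (M_mat N lm k ** B) = (\<Sum>i=1..N. k i *\<^sub>R psi ((\<chi> r c. q i $ r * q i $ c) ** B))"
    unfolding M by (simp add: linear_sum[OF lin] linear_scale[OF lin])
  then show ?thesis
    unfolding psi_outer_product q_def[symmetric] by (simp add: scaleR_sum_right mult.commute)
qed

lemma landmark_residual:
  assumes "rotation_matrix R" "rotation_matrix Rh"
  shows "Rh *v landmark_measurement lm R p i = transpose (R ** transpose Rh) *v (lm i - p)"
  by (simp add: landmark_measurement_def matrix_transpose_mul matrix_vector_mul_assoc)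

text \<open>Each residual is w + q_i - B q_i with one and the same w, which contains the whole
  position error. The weighted deviations q_i sum to zero, so w drops out and the correction depends
  on the attitude error alone.\<close>

lemma sigma_R_eq:
  assumes "rotation_matrix R" "rotation_matrix Rh"
  shows "sigma_R N lm k (landmark_measurement lm R p) Rh ph = psi (M_mat N lm k ** (R ** transpose Rh))"
proof -
  define B where "B = transpose (R ** transpose Rh)"
  define q where "q i = lm i - centroid N lm k" for i
  define w where "w = centroid N lm k - ph - B *v (centroid N lm k - p)"
  have eq: "lm i - ph - Rh *v landmark_measurement lm R p i = w + q i - B *v q i" for i
    unfolding landmark_residual[OF assms] B_def[symmetric]
    by (simp add: w_def q_def matrix_vector_mult_diff_distrib)
  have "(\<Sum>i=1..N. k i *\<^sub>R cross3 (q i) w) = cross3 (\<Sum>i=1..N. k i *\<^sub>R q i) w"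
  proof -
    have "linear (\<lambda>u. cross3 u w)" by (rule linearI) (simp_all add: cross_add_left cross_mult_left)
    from linear_sum[OF this, of "\<lambda>i. k i *\<^sub>R q i" "{1..N}"] show ?thesis by (simp add: cross_mult_left)
  qed
  then have 0: "(\<Sum>i=1..N. k i *\<^sub>R cross3 (q i) w) = 0"
    using centroid_deviation_sum by (simp add: q_def)
  have "k i *\<^sub>R (skew (q i) *v (w + q i - B *v q i)) = k i *\<^sub>R cross3 (q i) w - k i *\<^sub>R cross3 (q i) (B *v q i)" for i
    by (simp add: skew_mult_vec cross_add_right Cross3.right_diff_distrib scaleR_diff_right)
  then have "sigma_R N lm k (landmark_measurement lm R p) Rh ph =
      (1/2) *\<^sub>R ((\<Sum>i=1..N. k i *\<^sub>R cross3 (q i) w) - (\<Sum>i=1..N. k i *\<^sub>R cross3 (q i) (B *v q i)))"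
    unfolding sigma_R_def eq q_def[symmetric] by (simp add: sum_subtractf)
  then show ?thesis unfolding 0 psi_M_mat_mult B_def[symmetric] q_def[symmetric] by simp
qed

text \<open>The complementary cancellation in the same decomposition: the deviations sum to zero and
  the weights to 1, so w is all that remains.\<close>

lemma innovation_eq:
  assumes "rotation_matrix R" "rotation_matrix Rh"
  shows "innovation N lm k (landmark_measurement lm R p) Rh ph =
    centroid N lm k - ph - transpose (R ** transpose Rh) *v (centroid N lm k - p)"
proof -
  define B where "B = transpose (R ** transpose Rh)"
  define q where "q i = lm i - centroid N lm k" for i
  define w where "w = centroid N lm k - ph - B *v (centroid N lm k - p)"
  have eq: "lm i - ph - Rh *v landmark_measurement lm R p i = w + q i - B *v q i" for i
    unfolding landmark_residual[OF assms] B_def[symmetric]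
    by (simp add: w_def q_def matrix_vector_mult_diff_distrib)
  have "k i *\<^sub>R (w + q i - B *v q i) = k i *\<^sub>R w + (k i *\<^sub>R q i - B *v (k i *\<^sub>R q i))" for i
    by (simp add: scaleR_add_right scaleR_diff_right matrix_vector_mult_scaleR)
  then have "innovation N lm k (landmark_measurement lm R p) Rh ph =
      (\<Sum>i=1..N. k i) *\<^sub>R w + ((\<Sum>i=1..N. k i *\<^sub>R q i) - B *v (\<Sum>i=1..N. k i *\<^sub>R q i))"
    unfolding innovation_def eq
    by (simp add: sum.distrib sum_subtractf scaleR_left.sum
        bounded_bilinear.sum_right[OF bounded_bilinear_matrix_vector_mult])
  also have "(\<Sum>i=1..N. k i *\<^sub>R q i) = 0" unfolding q_def by (rule centroid_deviation_sum)
  finally show ?thesis unfolding k_sum w_def B_def by simp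
qed

text \<open>As Rt y = pt and Rt Rh = R, the measured vector Rh^T y equals R^T pt, the first block of
  the error and hence C x. The corrections are carried from the estimated to the true body frame and
  become K C x.\<close>

lemma estimation_error_jump:
  assumes R: "rotation_matrix R" "rotation_matrix Rh"
    and w: "w \<in> observer_jump N lm k kR Q Tm TM t ((R, p, v), (Rh, \<eta>, ph, vh, gh), \<tau>, P)"
  shows "estimation_error (centroid N lm k) g w \<in> error_jump (M_mat N lm k) kR Q Tm TM t
    (estimation_error (centroid N lm k) g ((R, p, v), (Rh, \<eta>, ph, vh, gh), \<tau>, P))"
proof -
  define pc where "pc = centroid N lm k"
  define Rt where "Rt = R ** transpose Rh"
  define K where "K = gain P (Q t)"
  define y where "y = innovation N lm k (landmark_measurement lm R p) Rh ph"
  define pt where "pt = p - Rt *v ph - (mat 1 - Rt) *v pc"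
  define vt where "vt = v - Rt *v vh"
  define gt where "gt = g - Rt *v gh"
  have Rt: "rotation_matrix Rt"
    unfolding Rt_def by (intro rotation_matrix_mult rotation_matrix_transpose R)
  have RtRh: "Rt *v (Rh *v u) = R *v u" for u
    using rotation_matrix_inverse(2)[OF R(2)]
    by (simp add: Rt_def flip: matrix_vector_mul_assoc)
  have "Rt *v y = pt"
    unfolding y_def innovation_eq[OF R] Rt_def[symmetric] pc_def[symmetric]
    by (simp add: pt_def matrix_vector_mult_diff_distrib matrix_vector_mult_diff_rdistrib
        rotation_matrix_inverse[OF Rt] matrix_vector_mul_lid)
  moreover have "transpose Rh *v y = transpose R *v (Rt *v y)"
    using rotation_matrix_inverse(2)[OF R(1)]
    by (simp add: Rt_def flip: matrix_vector_mul_assoc)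
  ultimately have y: "transpose Rh *v y = transpose R *v pt" by simp
  obtain \<tau>' where \<tau>': "\<tau>' \<in> {Tm..TM}" and weq: "w = ((R, p, v), (Rh, kR *\<^sub>R psi (M_mat N lm k ** Rt),
      ph + Rh *v (row_block 1 K *v (transpose Rh *v y)),
      vh + Rh *v (row_block 2 K *v (transpose Rh *v y)),
      gh + Rh *v (row_block 3 K *v (transpose Rh *v y))), \<tau>', riccati_jump (Q t) P)"
    using w by (auto simp: Let_def sigma_R_eq[OF R] y_def K_def Rt_def)
  define x where "x = join3 (transpose R *v pt) (transpose R *v vt) (transpose R *v gt)"
  have blkK: "blk b (K *v u) = row_block b K *v u" for b u
    by (simp add: blk_def row_block_def matrix_vector_mult_def vec_eq_iff)
  have "estimation_error pc g w = ((Rt, kR *\<^sub>R psi (M_mat N lm k ** Rt), (mat 1 - K ** C_mat) *v x, \<tau>'), riccati_jump (Q t) P)"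
  proof -
    have d: "transpose R *v (a - (b + Rt *v (Rh *v u)) - c) = transpose R *v (a - b - c) - u"
      "transpose R *v (a - (b + Rt *v (Rh *v u))) = transpose R *v (a - b) - u" for a b c u
      using rotation_matrix_inverse(2)[OF R(1), of u]
      by (simp_all add: RtRh matrix_vector_mult_diff_distrib matrix_vector_right_distrib)
    have "join3 (transpose R *v (p - Rt *v (ph + Rh *v (row_block 1 K *v (transpose Rh *v y))) - (mat 1 - Rt) *v pc))
        (transpose R *v (v - Rt *v (vh + Rh *v (row_block 2 K *v (transpose Rh *v y)))))
        (transpose R *v (g - Rt *v (gh + Rh *v (row_block 3 K *v (transpose Rh *v y)))))
      = (mat 1 - K ** C_mat) *v x"
      unfolding matrix_vector_right_distrib d y pt_def[symmetric] vt_def[symmetric] gt_def[symmetric]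
      by (simp add: blk_eq_iff matrix_vector_mult_diff_rdistrib blk_linear_simps blkK C_mat_mult_vec x_def flip: matrix_vector_mul_assoc)
    then show ?thesis
      by (simp add: weq Let_def Rt_def[symmetric])
  qed
  moreover have "estimation_error pc g ((R, p, v), (Rh, \<eta>, ph, vh, gh), \<tau>, P) = ((Rt, \<eta>, x, \<tau>), P)"
    by (simp add: x_def pt_def vt_def gt_def Rt_def Let_def)
  ultimately show ?thesis
    using \<tau>' unfolding pc_def[symmetric] by (auto simp: K_def)
qed

end

text \<open>The terms of the observer with \<open>\<eta>\<close> compensate the rotation of the
  attitude error, and those with \<open>a\<close> agree because Rt Rh = R. What remains is pt' = vt,
  vt' = gt, gt' = 0; passing to the body frame adds the gyroscopic term to each block, which gives
  \<open>A_mat\<close>.\<close>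

lemma estimation_error_derivative:
  assumes z: "((\<lambda>t. ((R t, p t, v t), (Rh t, \<eta> t, ph t, vh t, gh t), \<tau> t, P t)) has_vector_derivative
      observer_flow pc \<omega> a V g r ((R r, p r, v r), (Rh r, \<eta> r, ph r, vh r, gh r), \<tau> r, P r)) (at r within S)"
    and Rh: "rotation_matrix (Rh r)"
  shows "((\<lambda>t. estimation_error pc g ((R t, p t, v t), (Rh t, \<eta> t, ph t, vh t, gh t), \<tau> t, P t)) has_vector_derivative
      error_flow \<omega> V r (estimation_error pc g ((R r, p r, v r), (Rh r, \<eta> r, ph r, vh r, gh r), \<tau> r, P r))) (at r within S)"
proof -
  note f = bounded_linear.has_vector_derivative[OF bounded_linear_fst]
    and s = bounded_linear.has_vector_derivative[OF bounded_linear_snd]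
    and mm = bounded_bilinear_matrix_matrix_mult and mv = bounded_bilinear_matrix_vector_mult
  have 1: "((\<lambda>t. (R t, p t, v t)) has_vector_derivative (R r ** skew (\<omega> r), v r, g + R r *v a r)) (at r within S)"
    using f[OF z] by simp
  have 2: "((\<lambda>t. ((Rh t, \<eta> t, ph t, vh t, gh t), \<tau> t, P t)) has_vector_derivative
      ((Rh r ** skew (\<omega> r + transpose (Rh r) *v \<eta> r), 0, skew (\<eta> r) *v (ph r - pc) + vh r,
       skew (\<eta> r) *v vh r + gh r + Rh r *v a r, skew (\<eta> r) *v gh r), -1, riccati_flow (\<omega> r) (V r) (P r))) (at r within S)"
    using s[OF z] by simp
  have dR: "(R has_vector_derivative R r ** skew (\<omega> r)) (at r within S)" using f[OF 1] by simp
  have 11: "((\<lambda>t. (p t, v t)) has_vector_derivative (v r, g + R r *v a r)) (at r within S)" using s[OF 1] by simp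
  have dp: "(p has_vector_derivative v r) (at r within S)" and dv: "(v has_vector_derivative g + R r *v a r) (at r within S)"
    using f[OF 11] s[OF 11] by simp_all
  have 3: "((\<lambda>t. (\<tau> t, P t)) has_vector_derivative (-1, riccati_flow (\<omega> r) (V r) (P r))) (at r within S)"
    using s[OF 2] by simp
  have d\<tau>: "(\<tau> has_vector_derivative -1) (at r within S)"
    and dP: "(P has_vector_derivative riccati_flow (\<omega> r) (V r) (P r)) (at r within S)"
    using f[OF 3] s[OF 3] by simp_all
  have 4: "((\<lambda>t. (Rh t, \<eta> t, ph t, vh t, gh t)) has_vector_derivative
      (Rh r ** skew (\<omega> r + transpose (Rh r) *v \<eta> r), 0, skew (\<eta> r) *v (ph r - pc) + vh r,
       skew (\<eta> r) *v vh r + gh r + Rh r *v a r, skew (\<eta> r) *v gh r)) (at r within S)"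
    using f[OF 2] by simp
  have dRh: "(Rh has_vector_derivative Rh r ** skew (\<omega> r + transpose (Rh r) *v \<eta> r)) (at r within S)"
    using f[OF 4] by simp
  have 5: "((\<lambda>t. (\<eta> t, ph t, vh t, gh t)) has_vector_derivative
      (0, skew (\<eta> r) *v (ph r - pc) + vh r,
       skew (\<eta> r) *v vh r + gh r + Rh r *v a r, skew (\<eta> r) *v gh r)) (at r within S)"
    using s[OF 4] by simp
  have d\<eta>: "(\<eta> has_vector_derivative 0) (at r within S)" using f[OF 5] by simp
  have 6: "((\<lambda>t. (ph t, vh t, gh t)) has_vector_derivative
      (skew (\<eta> r) *v (ph r - pc) + vh r,
       skew (\<eta> r) *v vh r + gh r + Rh r *v a r, skew (\<eta> r) *v gh r)) (at r within S)"
    using s[OF 5] by simp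
  have dph: "(ph has_vector_derivative skew (\<eta> r) *v (ph r - pc) + vh r) (at r within S)" using f[OF 6] by simp
  have 7: "((\<lambda>t. (vh t, gh t)) has_vector_derivative
      (skew (\<eta> r) *v vh r + gh r + Rh r *v a r, skew (\<eta> r) *v gh r)) (at r within S)"
    using s[OF 6] by simp
  have dvh: "(vh has_vector_derivative skew (\<eta> r) *v vh r + gh r + Rh r *v a r) (at r within S)"
    and dgh: "(gh has_vector_derivative skew (\<eta> r) *v gh r) (at r within S)"
    using f[OF 7] s[OF 7] by simp_all
  define Rt where "Rt t = R t ** transpose (Rh t)" for t
  define pt where "pt t = p t - Rt t *v ph t - (mat 1 - Rt t) *v pc" for t
  define vt where "vt t = v t - Rt t *v vh t" for t
  define gt where "gt t = g - Rt t *v gh t" for t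
  have RhRh: "Rh r ** transpose (Rh r) = mat 1" using Rh by (simp add: rotation_matrix_def orthogonal_matrix_def)
  have RhRh': "transpose (Rh r) ** Rh r = mat 1" using Rh by (simp add: rotation_matrix_def orthogonal_matrix_def)
  have dRt: "(Rt has_vector_derivative Rt r ** skew (- \<eta> r)) (at r within S)"
  proof -
    have "(Rt has_vector_derivative
        R r ** transpose (Rh r ** skew (\<omega> r + transpose (Rh r) *v \<eta> r)) + (R r ** skew (\<omega> r)) ** transpose (Rh r)) (at r within S)"
      unfolding Rt_def by (intro bounded_bilinear.has_vector_derivative[OF mm]
          bounded_linear.has_vector_derivative[OF bounded_linear_transpose] dR dRh)
    moreover have "transpose (Rh r ** skew (\<omega> r + transpose (Rh r) *v \<eta> r)) =
        - (skew (\<omega> r) ** transpose (Rh r)) - transpose (Rh r) ** skew (\<eta> r)"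
    proof -
      \<comment> \<open>Conjugation rewrites the correction of the angular velocity as
        \<open>\<eta>\<close> in the inertial frame. The terms with \<open>\<omega>\<close> then
        cancel, and the attitude error is driven by \<open>- \<eta>\<close> alone.\<close>
      have "skew (transpose (Rh r) *v \<eta> r) = transpose (Rh r) ** skew (\<eta> r) ** Rh r"
        using rotation_matrix_skew[OF rotation_matrix_transpose[OF Rh]] by simp
      then have h: "skew (transpose (Rh r) *v \<eta> r) ** transpose (Rh r) = transpose (Rh r) ** skew (\<eta> r)"
        by (simp add: RhRh flip: matrix_mul_assoc)
      have t: "transpose (Rh r ** skew u) = - (skew u ** transpose (Rh r))" for u
        by (simp add: matrix_transpose_mul transpose_skew bounded_bilinear.minus_left[OF mm])
      have a: "skew (u + u') = skew u + skew u'" for u u'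
        by (rule linear_add[OF bounded_linear.linear[OF bounded_linear_skew]])
      show ?thesis
        unfolding t unfolding a bounded_bilinear.add_left[OF mm] h by simp
    qed
    ultimately show ?thesis
      by (simp add: Rt_def skew_minus bounded_bilinear.minus_right[OF mm] bounded_bilinear.diff_right[OF mm]
          matrix_mul_assoc)
  qed
  have Rt': "(Rt r ** skew (- \<eta> r)) *v u = - (Rt r *v cross3 (\<eta> r) u)" for u
    by (simp add: skew_minus bounded_bilinear.minus_right[OF mm] bounded_bilinear.minus_left[OF mv] skew_mult_vec
        flip: matrix_vector_mul_assoc)
  have RtRh: "Rt r *v (Rh r *v u) = R r *v u" for u
    by (simp add: Rt_def matrix_vector_mul_assoc RhRh' flip: matrix_mul_assoc)
  \<comment> \<open>The centroid enters twice, through \<open>ph - pc\<close> in the observer and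
    through (I - Rt) pc in the error; the two contributions cancel.\<close>
  have dpt: "(pt has_vector_derivative vt r) (at r within S)"
  proof -
    have "(pt has_vector_derivative v r - (Rt r *v (skew (\<eta> r) *v (ph r - pc) + vh r) + (Rt r ** skew (- \<eta> r)) *v ph r) -
        ((mat 1 - Rt r) *v 0 + (0 - Rt r ** skew (- \<eta> r)) *v pc)) (at r within S)"
      unfolding pt_def by (intro has_vector_derivative_diff bounded_bilinear.has_vector_derivative[OF mv]
          has_vector_derivative_const dp dph dRt)
    then show ?thesis
      by (simp add: Rt' skew_mult_vec vt_def matrix_vector_right_distrib matrix_vector_mult_diff_distrib
          Cross3.right_diff_distrib bounded_bilinear.minus_left[OF mv])
  qed
  have dvt: "(vt has_vector_derivative gt r) (at r within S)"
  proof -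
    have "(vt has_vector_derivative (g + R r *v a r) - (Rt r *v (skew (\<eta> r) *v vh r + gh r + Rh r *v a r) +
        (Rt r ** skew (- \<eta> r)) *v vh r)) (at r within S)"
      unfolding vt_def by (intro has_vector_derivative_diff bounded_bilinear.has_vector_derivative[OF mv] dv dvh dRt)
    then show ?thesis
      by (simp add: Rt' RtRh skew_mult_vec gt_def matrix_vector_right_distrib)
  qed
  have dgt: "(gt has_vector_derivative 0) (at r within S)"
  proof -
    have "(gt has_vector_derivative 0 - (Rt r *v (skew (\<eta> r) *v gh r) + (Rt r ** skew (- \<eta> r)) *v gh r)) (at r within S)"
      unfolding gt_def by (intro has_vector_derivative_diff bounded_bilinear.has_vector_derivative[OF mv]
          has_vector_derivative_const dgh dRt)
    then show ?thesis by (simp add: Rt' skew_mult_vec)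
  qed
  have d: "((\<lambda>t. transpose (R t) *v u t) has_vector_derivative
      transpose (R r) *v u' - cross3 (\<omega> r) (transpose (R r) *v u r)) (at r within S)"
    if "(u has_vector_derivative u') (at r within S)" for u u'
  proof -
    have "((\<lambda>t. transpose (R t) *v u t) has_vector_derivative
      transpose (R r) *v u' + transpose (R r ** skew (\<omega> r)) *v u r) (at r within S)"
      by (intro bounded_bilinear.has_vector_derivative[OF mv]
          bounded_linear.has_vector_derivative[OF bounded_linear_transpose] dR that)
    moreover have "transpose (R r ** skew (\<omega> r)) *v u r = - cross3 (\<omega> r) (transpose (R r) *v u r)"
      by (simp add: matrix_transpose_mul transpose_skew skew_mult_vec bounded_bilinear.minus_left[OF mv]
          flip: matrix_vector_mul_assoc skew_minus)
    ultimately show ?thesis by simp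
  qed
  define x where "x t = join3 (transpose (R t) *v pt t) (transpose (R t) *v vt t) (transpose (R t) *v gt t)" for t
  have dx: "(x has_vector_derivative A_mat (\<omega> r) *v x r) (at r within S)"
  proof -
    have "(x has_vector_derivative join3
        (transpose (R r) *v vt r - cross3 (\<omega> r) (transpose (R r) *v pt r))
        (transpose (R r) *v gt r - cross3 (\<omega> r) (transpose (R r) *v vt r))
        (transpose (R r) *v 0 - cross3 (\<omega> r) (transpose (R r) *v gt r))) (at r within S)"
      unfolding x_def by (intro has_vector_derivative_join3 d dpt dvt dgt)
    moreover have "A_mat (\<omega> r) *v x r = join3
        (transpose (R r) *v vt r - cross3 (\<omega> r) (transpose (R r) *v pt r))
        (transpose (R r) *v gt r - cross3 (\<omega> r) (transpose (R r) *v vt r))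
        (transpose (R r) *v 0 - cross3 (\<omega> r) (transpose (R r) *v gt r))"
      by (simp add: blk_eq_iff blk_A_mat x_def)
    ultimately show ?thesis by simp
  qed
  have ee: "estimation_error pc g ((R t, p t, v t), (Rh t, \<eta> t, ph t, vh t, gh t), \<tau> t, P t) = ((Rt t, \<eta> t, x t, \<tau> t), P t)" for t
    by (simp add: x_def pt_def vt_def gt_def Rt_def Let_def)
  show ?thesis
    unfolding ee using dRt d\<eta> dx d\<tau> dP by (auto intro!: has_vector_derivative_Pair)
qed

lemma absolutely_continuous_on_estimation_error:
  assumes "absolutely_continuous_on a b z"
  shows "absolutely_continuous_on a b (\<lambda>t. estimation_error pc g (z t))"
proof -
  note f = absolutely_continuous_on_fst and s = absolutely_continuous_on_snd
    and bb = absolutely_continuous_on_bounded_bilinear and bl = absolutely_continuous_on_bounded_linear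
    and mm = bounded_bilinear_matrix_matrix_mult and mv = bounded_bilinear_matrix_vector_mult
    and df = absolutely_continuous_on_diff and pr = absolutely_continuous_on_Pair
    and const = absolutely_continuous_on_const
  define R where "R t = fst (fst (z t))" for t
  define p where "p t = fst (snd (fst (z t)))" for t
  define v where "v t = snd (snd (fst (z t)))" for t
  define Rh where "Rh t = fst (fst (snd (z t)))" for t
  define \<eta> where "\<eta> t = fst (snd (fst (snd (z t))))" for t
  define ph where "ph t = fst (snd (snd (fst (snd (z t)))))" for t
  define vh where "vh t = fst (snd (snd (snd (fst (snd (z t))))))" for t
  define gh where "gh t = snd (snd (snd (snd (fst (snd (z t))))))" for t
  define \<tau> where "\<tau> t = fst (snd (snd (z t)))" for t
  define P where "P t = snd (snd (snd (z t)))" for t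
  have z: "z t = ((R t, p t, v t), (Rh t, \<eta> t, ph t, vh t, gh t), \<tau> t, P t)" for t
    by (simp add: R_def p_def v_def Rh_def \<eta>_def ph_def vh_def gh_def \<tau>_def P_def)
  have ac: "absolutely_continuous_on a b R" "absolutely_continuous_on a b p" "absolutely_continuous_on a b v"
    "absolutely_continuous_on a b Rh" "absolutely_continuous_on a b \<eta>" "absolutely_continuous_on a b ph"
    "absolutely_continuous_on a b vh" "absolutely_continuous_on a b gh" "absolutely_continuous_on a b \<tau>"
    "absolutely_continuous_on a b P"
    unfolding R_def p_def v_def Rh_def \<eta>_def ph_def vh_def gh_def \<tau>_def P_def
    by (intro f s assms)+
  have join: "absolutely_continuous_on a b (\<lambda>t. join3 (u t) (u' t) (u'' t))"
    if "absolutely_continuous_on a b u" "absolutely_continuous_on a b u'" "absolutely_continuous_on a b u''" for u u' u''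
    using bl[OF bounded_linear_join3 pr[OF that(1) pr[OF that(2,3)]]] by simp
  show ?thesis
    unfolding z estimation_error.simps Let_def
    by (intro pr join bb[OF mm] bb[OF mv] bl[OF bounded_linear_transpose] df const ac)
qed

text \<open>The time domain is kept and the error map is applied pointwise. The map is built from
  linear maps and products, which preserve absolute continuity.\<close>

lemma observer_solution_imp_error_solution:
  assumes k: "(\<Sum>i=1..N. k i) = 1"
    and sol: "hybrid_solution (observer_system N lm k kR Tm TM \<omega> a g V Q) E z"
  shows "hybrid_solution (error_system N lm k kR Tm TM \<omega> V Q) E
    (\<lambda>t j. estimation_error (centroid N lm k) g (z t j))"
proof -
  let ?O = "observer_system N lm k kR Tm TM \<omega> a g V Q" and ?H = "error_system N lm k kR Tm TM \<omega> V Q"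
  let ?e = "estimation_error (centroid N lm k) g"
  note dom = hybrid_solutionD(1)[OF sol] and z00 = hybrid_solutionD(2)[OF sol]
    and flows = hybrid_solutionD(3)[OF sol] and jumps = hybrid_solutionD(4)[OF sol]
  have rot: "rotation_matrix (A ** transpose B)" if "rotation_matrix A" "rotation_matrix B" for A B :: "real^3^3"
    using that by (intro rotation_matrix_mult rotation_matrix_transpose)
  have fs: "?e w \<in> flow_set ?H" if "w \<in> flow_set ?O" for w
  proof -
    obtain R p v Rh \<eta> ph vh gh \<tau> P where w: "w = ((R, p, v), (Rh, \<eta>, ph, vh, gh), \<tau>, P)"
      by (metis prod.exhaust)
    show ?thesis
      using that rot unfolding w by (simp add: observer_system_def error_system_def Let_def)
  qed
  have js: "?e w \<in> jump_set ?H" if "w \<in> jump_set ?O" for w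
  proof -
    obtain R p v Rh \<eta> ph vh gh \<tau> P where w: "w = ((R, p, v), (Rh, \<eta>, ph, vh, gh), \<tau>, P)"
      by (metis prod.exhaust)
    show ?thesis
      using that rot unfolding w by (simp add: observer_system_def error_system_def Let_def)
  qed
  have jm: "?e w' \<in> jump_map ?H t (?e w)" if "w \<in> jump_set ?O" "w' \<in> jump_map ?O t w" for w w' t
  proof -
    obtain R p v Rh \<eta> ph vh gh \<tau> P where w: "w = ((R, p, v), (Rh, \<eta>, ph, vh, gh), \<tau>, P)"
      by (metis prod.exhaust)
    show ?thesis
      using that estimation_error_jump[OF k, of R Rh w' lm kR Q Tm TM t p v \<eta> ph vh gh \<tau> P g]
      unfolding w observer_system_def error_system_def by simp
  qed
  have flows': "hybrid_arc ?H {t. (t, j) \<in> E} (\<lambda>t. ?e (z t j))" for j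
  proof -
    define I where "I = {t. (t, j) \<in> E}"
    have lac: "locally_absolutely_continuous_on I (\<lambda>t. z t j)" and fl: "\<And>t. t \<in> interior I \<Longrightarrow> z t j \<in> flow_set ?O"
      and "\<exists>Z. negligible Z \<and> (\<forall>t\<in>I - Z. ((\<lambda>t. z t j) has_vector_derivative flow_map ?O t (z t j)) (at t within I))"
      using flows[of j] unfolding I_def[symmetric] hybrid_arc_def by blast+
    then obtain Z where Z: "negligible Z"
      "\<And>t. t \<in> I - Z \<Longrightarrow> ((\<lambda>t. z t j) has_vector_derivative flow_map ?O t (z t j)) (at t within I)"
      by blast
    \<comment> \<open>The derivative formula uses that \<open>Rh t\<close> is a rotation, which is
      at hand in the interior of the interval of flow; the endpoints are put into the exceptional
      set.\<close>
    have "negligible (Z \<union> frontier I)"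
      using convex_hybrid_time_domain[OF dom] Z(1)
      by (intro negligible_Un negligible_convex_frontier) (simp_all add: I_def)
    moreover have "((\<lambda>t. ?e (z t j)) has_vector_derivative flow_map ?H t (?e (z t j))) (at t within I)"
      if t: "t \<in> I - (Z \<union> frontier I)" for t
    proof -
      define R where "R t = fst (fst (z t j))" for t
      define p where "p t = fst (snd (fst (z t j)))" for t
      define v where "v t = snd (snd (fst (z t j)))" for t
      define Rh where "Rh t = fst (fst (snd (z t j)))" for t
      define \<eta> where "\<eta> t = fst (snd (fst (snd (z t j))))" for t
      define ph where "ph t = fst (snd (snd (fst (snd (z t j)))))" for t
      define vh where "vh t = fst (snd (snd (snd (fst (snd (z t j))))))" for t
      define gh where "gh t = snd (snd (snd (snd (fst (snd (z t j))))))" for t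
      define \<tau> where "\<tau> t = fst (snd (snd (z t j)))" for t
      define P where "P t = snd (snd (snd (z t j)))" for t
      have z: "z t j = ((R t, p t, v t), (Rh t, \<eta> t, ph t, vh t, gh t), \<tau> t, P t)" for t
        by (simp add: R_def p_def v_def Rh_def \<eta>_def ph_def vh_def gh_def \<tau>_def P_def)
      have "t \<in> interior I" using t closure_subset[of I] by (auto simp: frontier_def)
      then have "rotation_matrix (Rh t)" using fl[of t] by (simp add: observer_system_def z)
      moreover have "((\<lambda>t. z t j) has_vector_derivative observer_flow (centroid N lm k) \<omega> a V g t (z t j)) (at t within I)"
        using Z(2)[of t] t by (simp add: observer_system_def)
      ultimately show ?thesis
        unfolding z error_system_def by (simp only: hybrid_system.simps estimation_error_derivative)
    qed
    moreover have "locally_absolutely_continuous_on I (\<lambda>t. ?e (z t j))"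
      using lac absolutely_continuous_on_estimation_error unfolding locally_absolutely_continuous_on_def by blast
    ultimately show ?thesis
      unfolding I_def[symmetric] hybrid_arc_def using fl fs by blast
  qed
  show ?thesis
  proof (rule hybrid_solutionI[OF dom _ flows'])
    show "?e (z 0 0) \<in> flow_set ?H \<union> jump_set ?H" using z00 fs js by blast
    show "?e (z t j) \<in> jump_set ?H \<and> ?e (z t (Suc j)) \<in> jump_map ?H t (?e (z t j))"
      if "(t, j) \<in> E" "(t, Suc j) \<in> E" for t j
      using jumps[OF that] js jm by blast
  qed
qed

section \<open>Exponential stability\<close>

lemma closed_Abar: "closed (Abar TM)"
proof -
  have "Abar TM = {mat 1} \<times> {0} \<times> {0} \<times> {0..TM}"
    by (auto simp: Abar_def rotation_matrix_def orthogonal_matrix_def)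
  then show ?thesis by (simp add: closed_Times)
qed

text \<open>Joins decay in \<open>j\<close> of the attitude part \<open>A\<close> with decay in
  \<open>t\<close> of the translational part \<open>X\<close>. The lower bound on \<open>t\<close>
  converts the latter into decay in \<open>j\<close>, at the cost of exp (2 c Tm) for the first
  interval; \<open>\<mu>\<close> is the slower of the two rates for the squares.\<close>

lemma exponential_estimate:
  fixes A A0 X X0 G K r c Tm TM t :: real and j :: nat
  assumes "0 < Tm" "0 < TM" "0 < r" "0 < c" "0 \<le> G" "0 \<le> A0" "0 \<le> X"
    and t: "t \<le> (real j + 1) * TM" "(real j - 1) * Tm \<le> t"
    and A: "A \<le> G * exp (- r * real j) * A0" and X: "X \<le> K * exp (- c * t) * X0"
  defines "\<mu> \<equiv> min r (2 * c * Tm)"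
  shows "sqrt (A + X\<^sup>2) \<le> sqrt ((G + K\<^sup>2 * exp (2 * c * Tm)) * exp \<mu>) *
    exp (- (\<mu> / (2 * (TM + 1))) * (t + real j)) * sqrt (A0 + X0\<^sup>2)"
proof -
  define e where "e = exp (- \<mu> * real j)"
  define lam where "lam = \<mu> / (2 * (TM + 1))"
  have \<mu>: "0 < \<mu>" "\<mu> \<le> r" "\<mu> \<le> 2 * c * Tm" using assms by (auto simp: \<mu>_def)
  have "A \<le> G * e * A0"
  proof -
    have "exp (- r * real j) \<le> e" unfolding e_def using \<mu> by (simp add: mult_right_mono)
    then have "G * exp (- r * real j) * A0 \<le> G * e * A0"
      using assms by (intro mult_right_mono mult_left_mono) auto
    then show ?thesis using A by simp
  qed
  moreover have "X\<^sup>2 \<le> K\<^sup>2 * exp (2 * c * Tm) * e * X0\<^sup>2"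
  proof -
    have "X\<^sup>2 \<le> (K * exp (- c * t) * X0)\<^sup>2" using X \<open>0 \<le> X\<close> by (rule power_mono)
    also have "\<dots> = K\<^sup>2 * exp (- (2 * c) * t) * X0\<^sup>2"
      by (simp add: power_mult_distrib flip: exp_double)
    also have "\<dots> \<le> K\<^sup>2 * (exp (2 * c * Tm) * e) * X0\<^sup>2"
    proof (intro mult_right_mono mult_left_mono)
      have "\<mu> * real j \<le> 2 * c * Tm * real j" using \<mu> by (intro mult_right_mono) auto
      moreover have "2 * c * ((real j - 1) * Tm) \<le> 2 * c * t" using t(2) \<open>0 < c\<close> by (intro mult_left_mono) auto
      ultimately have "- (2 * c) * t \<le> 2 * c * Tm + - \<mu> * real j" by (simp add: algebra_simps)
      then show "exp (- (2 * c) * t) \<le> exp (2 * c * Tm) * e" unfolding e_def by (simp flip: exp_add)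
    qed auto
    finally show ?thesis by (simp only: mult.assoc)
  qed
  ultimately have "A + X\<^sup>2 \<le> G * e * A0 + K\<^sup>2 * exp (2 * c * Tm) * e * X0\<^sup>2" by (rule add_mono)
  also have "\<dots> \<le> (G + K\<^sup>2 * exp (2 * c * Tm)) * e * (A0 + X0\<^sup>2)"
  proof -
    have "0 \<le> G * e * X0\<^sup>2" "0 \<le> K\<^sup>2 * exp (2 * c * Tm) * e * A0"
      using assms by (simp_all add: e_def)
    then show ?thesis by (simp add: algebra_simps)
  qed
  also have "\<dots> \<le> (G + K\<^sup>2 * exp (2 * c * Tm)) * (exp \<mu> * exp (- 2 * lam * (t + real j))) * (A0 + X0\<^sup>2)"
  proof (intro mult_right_mono mult_left_mono)
    \<comment> \<open>Decay in \<open>j\<close> becomes decay in \<open>t + j\<close>, since each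
      jump accounts for at most \<open>TM + 1\<close> units of hybrid time. The 2 in
      \<open>lam\<close> is for the square root taken at the end.\<close>
    have "t + real j \<le> (real j + 1) * (TM + 1)" using t(1) by (simp add: algebra_simps)
    then have "2 * lam * (t + real j) \<le> 2 * lam * ((real j + 1) * (TM + 1))"
      using \<mu> assms(2) by (intro mult_left_mono) (auto simp: lam_def)
    also have "\<dots> = lam * (2 * (TM + 1)) * (real j + 1)" by simp
    also have "lam * (2 * (TM + 1)) = \<mu>"
      using assms(2) by (intro nonzero_divide_eq_eq[THEN iffD1, symmetric]) (simp_all add: lam_def)
    finally have "- \<mu> * real j \<le> \<mu> + - 2 * lam * (t + real j)" by (simp add: algebra_simps)
    then show "e \<le> exp \<mu> * exp (- 2 * lam * (t + real j))" unfolding e_def by (simp flip: exp_add)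
  qed (use assms in auto)
  also have "\<dots> = (G + K\<^sup>2 * exp (2 * c * Tm)) * exp \<mu> * (exp (- lam * (t + real j)))\<^sup>2 * (A0 + X0\<^sup>2)"
    by (simp flip: exp_double)
  finally have "sqrt (A + X\<^sup>2) \<le> sqrt ((G + K\<^sup>2 * exp (2 * c * Tm)) * exp \<mu> * (exp (- lam * (t + real j)))\<^sup>2 * (A0 + X0\<^sup>2))"
    by (rule real_sqrt_le_mono)
  also have "\<dots> = sqrt ((G + K\<^sup>2 * exp (2 * c * Tm)) * exp \<mu>) * exp (- lam * (t + real j)) * sqrt (A0 + X0\<^sup>2)"
    by (simp add: real_sqrt_mult)
  finally show ?thesis unfolding lam_def .
qed

lemma positive_definite_eigenvalue_pos:
  fixes A :: "real^'n^'n"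
  assumes "\<And>x. x \<noteq> 0 \<Longrightarrow> 0 < x \<bullet> (A *v x)" "m \<in> eigenvalues A"
  shows "0 < m"
proof -
  obtain x where x: "x \<noteq> 0" "A *v x = m *\<^sub>R x" using assms(2) by (auto simp: eigenvalues_def)
  have "0 < m * (x \<bullet> x)" using assms(1)[OF x(1)] x(2) by simp
  then show ?thesis by (rule zero_less_mult_pos2) (use x(1) in simp)
qed

lemma positive_definite_lower_bound:
  assumes "positive_definite (A :: real^'n^'n)"
  obtains m where "0 < m" "\<And>y. m * (y \<bullet> y) \<le> y \<bullet> (A *v y)"
proof -
  obtain m where m: "m \<in> eigenvalues A" "\<And>y. m * (y \<bullet> y) \<le> y \<bullet> (A *v y)"
    using rayleigh_minimum assms unfolding positive_definite_def by blast
  have "0 < m"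
    by (rule positive_definite_eigenvalue_pos[OF _ m(1)]) (use assms in \<open>simp add: positive_definite_def\<close>)
  with m(2) show thesis using that by blast
qed

text \<open>Stability concerns the error system alone, so its derivation from the observer is part
  of the claim. As \<open>P\<close> belongs to the state, its initial value enters as a condition on
  the solution; \<open>\<kappa>\<close> and \<open>lam\<close> are fixed before the
  solution.\<close>

theorem theorem11:
  fixes N :: nat and lm :: "nat \<Rightarrow> real^3" and k :: "nat \<Rightarrow> real"
    and Tm TM :: real
    and \<omega> a :: "real \<Rightarrow> real^3" and g :: "real^3"
    and V :: "real \<Rightarrow> mat9" and Q :: "real \<Rightarrow> real^3^3" and P0 :: mat9
  assumes "3 \<le> N"
    and "\<forall>i\<in>{1..N}. 0 < k i" and "(\<Sum>i=1..N. k i) = 1"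
    and "\<exists>i\<in>{1..N}. \<exists>j\<in>{1..N}. \<exists>l\<in>{1..N}. \<not> collinear {lm i, lm j, lm l}"
    and "0 < Tm" and "Tm \<le> TM"
    and "continuous_on {0..} \<omega>" and "bounded (\<omega> ` {0..})"
    and "continuous_on {0..} V" and "bounded (V ` {0..})" and "uniformly_positive_definite V"
    and "bounded (Q ` {0..})" and "uniformly_positive_definite Q"
    and "positive_definite P0"
  shows
    "(\<forall>kR>0. \<forall>E z. hybrid_solution (observer_system N lm k kR Tm TM \<omega> a g V Q) E z \<longrightarrow>
        hybrid_solution (error_system N lm k kR Tm TM \<omega> V Q) E
          (\<lambda>t j. estimation_error (centroid N lm k) g (z t j))) \<and>
     closed (Abar TM) \<and>
     (\<forall>\<epsilon>. 0 < \<epsilon> \<and> \<epsilon> < 1 \<longrightarrow>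
       (\<exists>\<eta>s>0. \<exists>kRs>0. \<forall>kR. 0 < kR \<and> kR < kRs \<longrightarrow>
         (\<exists>\<kappa>>0. \<exists>lam>0. \<forall>E Rt \<eta> x \<tau> P.
            maximal_hybrid_solution (error_system N lm k kR Tm TM \<omega> V Q) E
              (\<lambda>t j. ((Rt t j, \<eta> t j, x t j, \<tau> t j), P t j)) \<and>
            P 0 0 = P0 \<and>
            rot_dist (Rt 0 0) \<le> \<epsilon> * sqrt (varsigma_M N lm k) \<and>
            norm (\<eta> 0 0) \<le> \<eta>s
            \<longrightarrow> complete_domain E \<and>
                (\<forall>(t, j)\<in>E.
                   Abar_dist (Rt t j, \<eta> t j, x t j, \<tau> t j)
                   \<le> \<kappa> * exp (- lam * (t + real j)) * Abar_dist (Rt 0 0, \<eta> 0 0, x 0 0, \<tau> 0 0)))))"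
proof (intro conjI allI impI)
  fix kR E z
  assume "hybrid_solution (observer_system N lm k kR Tm TM \<omega> a g V Q) E z"
  then show "hybrid_solution (error_system N lm k kR Tm TM \<omega> V Q) E
      (\<lambda>t j. estimation_error (centroid N lm k) g (z t j))"
    by (rule observer_solution_imp_error_solution[OF assms(3)])
next
  show "closed (Abar TM)" by (rule closed_Abar)
next
  fix \<epsilon> :: real
  assume \<epsilon>: "0 < \<epsilon> \<and> \<epsilon> < 1"
  define M where "M = M_mat N lm k"
  define l where "l = lambda_min (Mbar N lm k)"
  define L where "L = lambda_max (Mbar N lm k)"
  have TM: "0 < TM" using assms(5,6) by simp
  have l: "l * (v \<bullet> v) \<le> v \<bullet> (Mbar N lm k *v v)" for v
    unfolding l_def by (rule lambda_min_le_rayleigh[OF transpose_Mbar])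
  have L: "v \<bullet> (Mbar N lm k *v v) \<le> L * (v \<bullet> v)" for v
    unfolding L_def by (rule rayleigh_le_lambda_max[OF transpose_Mbar])
  have l_pos: "0 < l"
    unfolding l_def
    by (rule positive_definite_eigenvalue_pos[OF Mbar_positive[OF assms(2,4)] lambda_min_in_eigenvalues[OF transpose_Mbar]])
  have "l \<le> L" using l[of "axis 1 1"] L[of "axis 1 1"] by (simp add: inner_axis_axis)
  then have L_pos: "0 < L" using l_pos by simp
  obtain c where c: "0 < c" "\<And>B. norm (psi (M ** B)) \<le> norm B * c"
    using bounded_linear.pos_bounded[OF linear_psi_mult[of M, unfolded linear_conv_bounded_linear]] by blast
  \<comment> \<open>Midpoints: \<open>e1\<close> between \<open>\<epsilon>\<close> and 1 leaves room
    for the drift before the first jump, \<open>e2\<close> between \<open>e1\<close> and 1 for the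
    drift between later jumps.\<close>
  define e1 where "e1 = (1 + \<epsilon>) / 2"
  define e2 where "e2 = (1 + e1) / 2"
  have e: "0 < e1" "\<epsilon> < e1" "e1 < e2" "e2 < 1" using \<epsilon> by (auto simp: e1_def e2_def)
  define s where "s = sqrt (l / L)"
  have s: "0 < s" "s = sqrt (varsigma_M N lm k)"
    using l_pos L_pos by (simp_all add: s_def varsigma_M_def l_def L_def)
  \<comment> \<open>Both thresholds spend exactly the room available: 2 TM \<open>\<eta>s\<close> is
    the gap \<open>(e1 - \<epsilon>) * s\<close> for the first flow, and 8 TM c \<open>kRs\<close>
    is \<open>e2 - e1\<close>.\<close>
  define \<eta>s where "\<eta>s = (e1 - \<epsilon>) * s / (2 * TM)"
  define kRs where "kRs = (e2 - e1) / (8 * TM * c)"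
  have pos: "0 < \<eta>s" "0 < kRs" using e s TM c by (simp_all add: \<eta>s_def kRs_def)
  obtain bV where "\<forall>v\<in>V ` {0..}. norm v \<le> bV" using assms(10) unfolding bounded_iff by blast
  then have bV: "norm (V t) \<le> bV" if "0 \<le> t" for t using that by simp
  obtain bQ where "\<forall>v\<in>Q ` {0..}. norm v \<le> bQ" using assms(12) unfolding bounded_iff by blast
  then have bQ: "norm (Q t) \<le> bQ" if "0 \<le> t" for t using that by simp
  obtain cV where cV: "0 < cV" "\<And>t y. 0 \<le> t \<Longrightarrow> cV * (y \<bullet> y) \<le> y \<bullet> (V t *v y)"
    and V_sym: "\<And>t. 0 \<le> t \<Longrightarrow> transpose (V t) = V t"
    using assms(11) unfolding uniformly_positive_definite_def by blast
  obtain cQ where cQ: "0 < cQ" "\<And>t y. 0 \<le> t \<Longrightarrow> cQ * (y \<bullet> y) \<le> y \<bullet> (Q t *v y)"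
    and Q_sym: "\<And>t. 0 \<le> t \<Longrightarrow> transpose (Q t) = Q t"
    using assms(13) unfolding uniformly_positive_definite_def by blast
  obtain p where p: "0 < p" "\<And>y. p * (y \<bullet> y) \<le> y \<bullet> (P0 *v y)"
    using positive_definite_lower_bound[OF assms(14)] by blast
  have P0: "transpose P0 = P0" "0 \<le> y \<bullet> (P0 *v y)" for y
  proof -
    show "transpose P0 = P0" using assms(14) by (simp add: positive_definite_def)
    have "0 \<le> p * (y \<bullet> y)" using p(1) by simp
    then show "0 \<le> y \<bullet> (P0 *v y)" using p(2)[of y] by linarith
  qed
  \<comment> \<open>The decay rate is a quotient with denominator \<open>b\<close>; the maximum with
    1 makes it positive.\<close>
  define b where "b = max 1 (riccati_bound Tm TM bV bQ (norm P0))"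
  have b: "0 < b" "riccati_bound Tm TM bV bQ (norm P0) \<le> b" by (auto simp: b_def)
  define K where "K = sqrt (b / p)"
  define d where "d = cV / b / 2"
  have d: "0 < d" using cV(1) b(1) by (simp add: d_def)
  show "\<exists>\<eta>s>0. \<exists>kRs>0. \<forall>kR. 0 < kR \<and> kR < kRs \<longrightarrow>
         (\<exists>\<kappa>>0. \<exists>lam>0. \<forall>E Rt \<eta> x \<tau> P.
            maximal_hybrid_solution (error_system N lm k kR Tm TM \<omega> V Q) E
              (\<lambda>t j. ((Rt t j, \<eta> t j, x t j, \<tau> t j), P t j)) \<and>
            P 0 0 = P0 \<and>
            rot_dist (Rt 0 0) \<le> \<epsilon> * sqrt (varsigma_M N lm k) \<and>
            norm (\<eta> 0 0) \<le> \<eta>s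
            \<longrightarrow> complete_domain E \<and>
                (\<forall>(t, j)\<in>E.
                   Abar_dist (Rt t j, \<eta> t j, x t j, \<tau> t j)
                   \<le> \<kappa> * exp (- lam * (t + real j)) * Abar_dist (Rt 0 0, \<eta> 0 0, x 0 0, \<tau> 0 0)))"
  proof (rule exI[of _ \<eta>s], intro conjI pos(1), rule exI[of _ kRs], intro conjI pos(2) allI impI)
    fix kR assume kR: "0 < kR \<and> kR < kRs"
    define r where "r = attitude_rate kR Tm l L e1"
    define G where "G = attitude_gain kR Tm TM l L c e1"
    define \<mu> where "\<mu> = min r (2 * d * Tm)"
    define \<kappa> where "\<kappa> = sqrt ((G + K\<^sup>2 * exp (2 * d * Tm)) * exp \<mu>)"
    define lam where "lam = \<mu> / (2 * (TM + 1))"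
    have "e1\<^sup>2 < 1" using e by (simp add: abs_square_less_1)
    then have r: "0 < r" using kR assms(5) l_pos L_pos by (simp add: r_def attitude_rate_def)
    have "0 < 3 * (1 + 4 * TM\<^sup>2)" by (simp add: add_pos_nonneg)
    then have G: "0 < G" unfolding G_def attitude_gain_def using l_pos L_pos
      by (intro add_nonneg_pos mult_nonneg_nonneg divide_nonneg_nonneg) auto
    have \<kappa>: "0 < \<kappa>" using G by (simp add: \<kappa>_def add_pos_nonneg)
    have lam: "0 < lam" using r d assms(5) TM by (simp add: lam_def \<mu>_def)
    show "\<exists>\<kappa>>0. \<exists>lam>0. \<forall>E Rt \<eta> x \<tau> P.
            maximal_hybrid_solution (error_system N lm k kR Tm TM \<omega> V Q) E
              (\<lambda>t j. ((Rt t j, \<eta> t j, x t j, \<tau> t j), P t j)) \<and>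
            P 0 0 = P0 \<and>
            rot_dist (Rt 0 0) \<le> \<epsilon> * sqrt (varsigma_M N lm k) \<and>
            norm (\<eta> 0 0) \<le> \<eta>s
            \<longrightarrow> complete_domain E \<and>
                (\<forall>(t, j)\<in>E.
                   Abar_dist (Rt t j, \<eta> t j, x t j, \<tau> t j)
                   \<le> \<kappa> * exp (- lam * (t + real j)) * Abar_dist (Rt 0 0, \<eta> 0 0, x 0 0, \<tau> 0 0))"
    proof (rule exI[of _ \<kappa>], intro conjI \<kappa>, rule exI[of _ lam], intro conjI[OF lam] allI impI; elim conjE)
      fix E Rt \<eta> x \<tau> P
      assume max: "maximal_hybrid_solution (error_system N lm k kR Tm TM \<omega> V Q) E
              (\<lambda>t j. ((Rt t j, \<eta> t j, x t j, \<tau> t j), P t j))"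
        and P00: "P 0 0 = P0" and Rt0: "rot_dist (Rt 0 0) \<le> \<epsilon> * sqrt (varsigma_M N lm k)"
        and \<eta>0: "norm (\<eta> 0 0) \<le> \<eta>s"
      interpret es: error_solution N lm k kR Tm TM \<omega> V Q E Rt \<eta> x \<tau> P
        using max assms by unfold_locales (auto simp: maximal_hybrid_solution_def)
      interpret ro: riccati_observer N lm k kR Tm TM \<omega> V Q E Rt \<eta> x \<tau> P cV cQ bV bQ "norm P0"
        by unfold_locales (use V_sym cV bV Q_sym cQ bQ P0 P00 in auto)
      interpret ao: attitude_observer N lm k kR Tm TM \<omega> V Q E Rt \<eta> x \<tau> P l L c e1 e2
      proof
        show "norm (psi (M_mat N lm k ** B)) \<le> c * norm B" for B
          using c(2)[of B] by (simp add: M_def mult.commute)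
        have "8 * TM * c * kR \<le> 8 * TM * c * kRs" using kR TM c(1) by (intro mult_left_mono) auto
        then show "8 * TM * c * kR \<le> e2 - e1" using TM c(1) by (simp add: kRs_def)
        have "2 * TM * norm (\<eta> 0 0) \<le> 2 * TM * \<eta>s" using \<eta>0 TM by (intro mult_left_mono) auto
        also have "\<dots> = (e1 - \<epsilon>) * s" using TM by (simp add: \<eta>s_def)
        finally show "rot_dist (Rt 0 0) + 2 * TM * norm (\<eta> 0 0) \<le> e1 * sqrt (l / L)"
          using Rt0 unfolding s(2)[symmetric] s_def[symmetric] by (simp add: algebra_simps)
      qed (use l_pos l L c(1) e kR in auto)
      show "complete_domain E \<and> (\<forall>(t, j)\<in>E. Abar_dist (Rt t j, \<eta> t j, x t j, \<tau> t j)
          \<le> \<kappa> * exp (- lam * (t + real j)) * Abar_dist (Rt 0 0, \<eta> 0 0, x 0 0, \<tau> 0 0))"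
      proof (intro conjI es.maximal_imp_complete[OF max] ballI, clarify)
        fix t j assume t: "(t, j) \<in> E"
        have "norm (x t j) \<le> K * exp (- d * t) * norm (x 0 0)"
          using ro.x_decay[OF t b(2,1) p(1)] p(2) P00 by (simp add: K_def d_def)
        then show "Abar_dist (Rt t j, \<eta> t j, x t j, \<tau> t j)
            \<le> \<kappa> * exp (- lam * (t + real j)) * Abar_dist (Rt 0 0, \<eta> 0 0, x 0 0, \<tau> 0 0)"
          using exponential_estimate[OF assms(5) TM r d, of G, OF _ _ norm_ge_zero es.time_bounds[OF t],
              of "(rot_dist (Rt 0 0))\<^sup>2 + (norm (\<eta> 0 0))\<^sup>2", OF _ _ ao.attitude_decay[OF t, folded r_def G_def]] G
          by (simp add: \<kappa>_def lam_def \<mu>_def)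
      qed
    qed
  qed
qed

end
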